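(* Let $m\geqslant 2$ be an integer. On a compact oriented surface $M$ with $\chi(M)<0$ the following sets are in one-to-one correspondence: (i) the triples $(g,A,\theta)$ consisting of a Riemannian metric $g$, a differential $A$ of degree $m$ and a $1$-form $\theta$ such that $$K_g=-1+\delta_g\theta+(m-1)|A|^2_g\quad\text{and}\quad\overline{\partial}A=\left(\frac{m-1}{2}\right)\left(\theta-i\star\theta\right)\otimes A;$$ (ii) the triples $([g],\overline{\partial}_{L_m},P)$ consisting of a conformal structure $[g]$, a holomorphic line bundle structure $\overline{\partial}_{L_m}$ on $L_m$ and a holomorphic section $P$ of $L_m\otimes K_M^m$ having the property that the symmetric part of the Ricci curvature of the conformal connection associated to $\overline{\partial}_{L_m}$ plus $(1-m)\mathbb{P}$ is negative definite.
   Context: $K_g$ is the Gauss curvature, $\delta_g$ the co-differential and $\star=\star_g$ the Hodge star (acting on $1$-forms, it depends only on $[g]$ and the orientation). $K_M$ is the canonical bundle of the Riemann surface determined by $[g]$ and the orientation; a differential of degree $m$ is a section $A$ of $K_M^m$. Norm normalisation: with $\omega_1,\omega_2$ a local positively oriented orthonormal coframe and $A=\tilde a(\omega_1+i\omega_2)^m$, one has $|A|_g^2=|\tilde a|^2$. $L_m:=\Lambda^2(TM)^{(m-1)/2}\otimes\mathbb{C}$, a smooth complex line bundle (powers of the oriented real line bundle $\Lambda^2(TM)$); $(\det g)^{-(m-1)/4}$ is a nowhere vanishing section of $L_m$. A holomorphic line bundle structure on $L_m$ is given by a Dolbeault operator $\overline{\partial}_{L_m}:\Gamma(M,L_m)\to\Omega^{0,1}(M,L_m)$.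 A $[g]$-conformal connection (Weyl connection) is a torsion-free connection $\nabla$ on $TM$ such that for some (hence any) $g\in[g]$ there is a $1$-form $\theta$ with $\nabla g=2\theta\otimes g$. These are precisely the connections ${}^{(g,\theta)}\nabla={}^g\nabla+g\otimes\theta^\sharp-\theta\otimes\mathrm{Id}-\mathrm{Id}\otimes\theta$, where ${}^g\nabla$ is the Levi-Civita connection of $g$ and $\theta^\sharp$ the $g$-dual vector field of $\theta$; one has ${}^{(e^{2u}g,\theta+du)}\nabla={}^{(g,\theta)}\nabla$ for $u\in C^\infty(M)$, and the symmetric part of the Ricci curvature of ${}^{(g,\theta)}\nabla$ is $(K_g-\delta_g\theta)g$. Holomorphic line bundle structures on $L_m$ and $[g]$-conformal connections are in canonical bijection, being associated to each other by $\overline{\partial}_{L_m}={}^{(g,\theta)}\nabla^{(0,1)}$ (the $(0,1)$-part of the connection induced on $L_m$, extended complex linearly), equivalently $$\overline{\partial}_{L_m}(\det g)^{-(m-1)/4}=-\left(\frac{m-1}{2}\right)(\theta-i\star_g\theta)\otimes(\det g)^{-(m-1)/4}.$$ For a section $P$ of $L_m\otimes K_M^m$, set $|P|_g^2:=|A|_g^2$ where $A:=(\det g)^{(m-1)/4}\otimes P$, and $\mathbb{P}:=|P|_g^2\,g$, a quadratic form which, for given $P$, depends only on $[g]$. *)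

theory Defs
  imports "HOL-Analysis.Analysis" "HOL-Homology.Homology"
begin

section \<open>Euler characteristic\<close>

definition int_independent :: "('b, 'c) monoid_scheme \<Rightarrow> 'b set \<Rightarrow> bool" where
  "int_independent G S \<longleftrightarrow> finite S \<and> S \<subseteq> carrier G \<and>
     (\<forall>a :: 'b \<Rightarrow> int. finprod G (\<lambda>x. x [^]\<^bsub>G\<^esub> a x) S = \<one>\<^bsub>G\<^esub> \<longrightarrow> (\<forall>x\<in>S. a x = 0))"

text \<open>The rank is the maximal size of an integrally independent set. The supremum is only
  meaningful for groups of finite rank, such as the homology groups of compact manifolds.\<close>

definition abelian_rank :: "('b, 'c) monoid_scheme \<Rightarrow> nat" where
  "abelian_rank G = Sup (card ` {S. int_independent G S})"

text \<open>For surfaces; the singular homology vanishes in degrees above 2.\<close>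

definition euler_characteristic :: "'a topology \<Rightarrow> int" where
  "euler_characteristic X = (\<Sum>p\<in>{0,1,2}. (-1) ^ p * int (abelian_rank (homology_group (int p) X)))"


section \<open>Smooth oriented surfaces\<close>

text \<open>These are used on open sets \<open>S\<close> only. A map is \<open>C\<^sup>k\<^sup>+\<^sup>1\<close> if it is differentiable and all of
  its directional derivatives are \<open>C\<^sup>k\<close>.\<close>

primrec Ck_on :: "nat \<Rightarrow> 'a::real_normed_vector set \<Rightarrow> ('a \<Rightarrow> 'b::real_normed_vector) \<Rightarrow> bool" where
  "Ck_on 0 S f \<longleftrightarrow> continuous_on S f"
| "Ck_on (Suc k) S f \<longleftrightarrow> (\<forall>x\<in>S. f differentiable (at x)) \<and>
     (\<forall>v. Ck_on k S (\<lambda>x. frechet_derivative f (at x) v))"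

definition smooth_on :: "'a::real_normed_vector set \<Rightarrow> ('a \<Rightarrow> 'b::real_normed_vector) \<Rightarrow> bool" where
  "smooth_on S f \<longleftrightarrow> (\<forall>k. Ck_on k S f)"

text \<open>A chart is a domain together with a coordinate map; the values of the coordinate map
  outside of the domain are irrelevant.\<close>

type_synonym 'a chart = "'a set \<times> ('a \<Rightarrow> real^2)"

abbreviation cdom :: "'a chart \<Rightarrow> 'a set" where "cdom c \<equiv> fst c"

abbreviation coord :: "'a chart \<Rightarrow> 'a \<Rightarrow> real^2" where "coord c \<equiv> snd c"

definition param :: "'a chart \<Rightarrow> real^2 \<Rightarrow> 'a" where
  "param c = inv_into (cdom c) (coord c)"

text \<open>Jacobian matrix of the change of coordinates from \<open>c\<close> to \<open>c'\<close>: column \<open>i\<close> of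
  \<open>jac c c' p\<close> consists of the \<open>c'\<close>-components of the \<open>i\<close>-th coordinate vector of \<open>c\<close> at \<open>p\<close>.\<close>

definition jac :: "'a chart \<Rightarrow> 'a chart \<Rightarrow> 'a \<Rightarrow> real^2^2" where
  "jac c c' p = matrix (frechet_derivative (coord c' \<circ> param c) (at (coord c p)))"

text \<open>The atlas \<open>\<A>\<close> need not be maximal; it determines the smooth structure and the orientation.\<close>

definition oriented_surface :: "'a topology \<Rightarrow> 'a chart set \<Rightarrow> bool" where
  "oriented_surface X \<A> \<longleftrightarrow>
     Hausdorff_space X \<and> second_countable X \<and>
     (\<forall>c\<in>\<A>. openin X (cdom c) \<and> open (coord c ` cdom c) \<and>
        homeomorphic_map (subtopology X (cdom c)) (top_of_set (coord c ` cdom c)) (coord c)) \<and>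
     (\<Union>c\<in>\<A>. cdom c) = topspace X \<and>
     (\<forall>c\<in>\<A>. \<forall>c'\<in>\<A>. smooth_on (coord c ` (cdom c \<inter> cdom c')) (coord c' \<circ> param c) \<and>
        (\<forall>p \<in> cdom c \<inter> cdom c'. det (jac c c' p) > 0))"

definition in_chart :: "'a chart set \<Rightarrow> 'a chart \<Rightarrow> 'a \<Rightarrow> bool" where
  "in_chart \<A> c p \<longleftrightarrow> c \<in> \<A> \<and> p \<in> cdom c"

definition in_overlap :: "'a chart set \<Rightarrow> 'a chart \<Rightarrow> 'a chart \<Rightarrow> 'a \<Rightarrow> bool" where
  "in_overlap \<A> c c' p \<longleftrightarrow> in_chart \<A> c p \<and> in_chart \<A> c' p"

definition smooth_in :: "'a chart \<Rightarrow> ('a \<Rightarrow> 'b::real_normed_vector) \<Rightarrow> bool" where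
  "smooth_in c f \<longleftrightarrow> smooth_on (coord c ` cdom c) (f \<circ> param c)"

definition smooth_fun :: "'a chart set \<Rightarrow> ('a \<Rightarrow> 'b::real_normed_vector) \<Rightarrow> bool" where
  "smooth_fun \<A> f \<longleftrightarrow> (\<forall>c\<in>\<A>. smooth_in c f)"

text \<open>Partial derivative with respect to the \<open>i\<close>-th coordinate of the chart \<open>c\<close>.\<close>

definition pd :: "'a chart \<Rightarrow> 2 \<Rightarrow> ('a \<Rightarrow> 'b::real_normed_vector) \<Rightarrow> 'a \<Rightarrow> 'b" where
  "pd c i f p = frechet_derivative (f \<circ> param c) (at (coord c p)) (axis i 1)"


section \<open>Tensor fields, metrics and connections\<close>

text \<open>A tensor field (or connection) is given by its components \<open>T c p\<close> in each chart \<open>c\<close> at each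
  point \<open>p\<close> of that chart, subject to the transformation law on overlaps. Components outside of the
  chart domain are set to 0, so that equality of such families is equality of fields.\<close>

definition supported :: "'a chart set \<Rightarrow> ('a chart \<Rightarrow> 'a \<Rightarrow> 'b::zero) \<Rightarrow> bool" where
  "supported \<A> T \<longleftrightarrow> (\<forall>c p. \<not> in_chart \<A> c p \<longrightarrow> T c p = 0)"

type_synonym 'a one_form = "'a chart \<Rightarrow> 'a \<Rightarrow> real^2"
type_synonym 'a tensor02 = "'a chart \<Rightarrow> 'a \<Rightarrow> real^2^2"
type_synonym 'a endo = "'a chart \<Rightarrow> 'a \<Rightarrow> real^2^2"

definition is_one_form :: "'a chart set \<Rightarrow> 'a one_form \<Rightarrow> bool" where
  "is_one_form \<A> \<theta> \<longleftrightarrow> supported \<A> \<theta> \<and> (\<forall>c\<in>\<A>. smooth_in c (\<theta> c)) \<and>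
     (\<forall>c c' p. in_overlap \<A> c c' p \<longrightarrow> \<theta> c p = \<theta> c' p v* jac c c' p)"

definition is_metric :: "'a chart set \<Rightarrow> 'a tensor02 \<Rightarrow> bool" where
  "is_metric \<A> g \<longleftrightarrow> supported \<A> g \<and> (\<forall>c\<in>\<A>. smooth_in c (g c)) \<and>
     (\<forall>c c' p. in_overlap \<A> c c' p \<longrightarrow>
        g c p = transpose (jac c c' p) ** g c' p ** jac c c' p) \<and>
     (\<forall>c p. in_chart \<A> c p \<longrightarrow> transpose (g c p) = g c p \<and>
        (\<forall>v. v \<noteq> 0 \<longrightarrow> v \<bullet> (g c p *v v) > 0))"

definition conformal_class :: "'a chart set \<Rightarrow> 'a tensor02 \<Rightarrow> 'a tensor02 set" where
  "conformal_class \<A> g = {g'. is_metric \<A> g' \<and>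
     (\<exists>u :: 'a \<Rightarrow> real. smooth_fun \<A> u \<and>
        (\<forall>c p. in_chart \<A> c p \<longrightarrow> g' c p = exp (2 * u p) *\<^sub>R g c p))}"

definition is_conformal_structure :: "'a chart set \<Rightarrow> 'a tensor02 set \<Rightarrow> bool" where
  "is_conformal_structure \<A> C \<longleftrightarrow> (\<exists>g. is_metric \<A> g \<and> C = conformal_class \<A> g)"

text \<open>Some metric in the conformal class, used to define objects that depend on the class only.\<close>

definition rep :: "'a tensor02 set \<Rightarrow> 'a tensor02" where
  "rep C = (SOME g. g \<in> C)"

text \<open>Almost complex structure: rotation by the angle \<open>\<pi>/2\<close> in positive direction. It maps the first
  coordinate vector to \<open>(- g\<^sub>1\<^sub>2, g\<^sub>1\<^sub>1)/sqrt (det g)\<close> and the second to \<open>(- g\<^sub>2\<^sub>2, g\<^sub>1\<^sub>2)/sqrt (det g)\<close>.\<close>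

definition rot :: "'a tensor02 \<Rightarrow> 'a endo" where
  "rot g c p = (1 / sqrt (det (g c p))) *\<^sub>R
     vector [vector [- g c p $ 1 $ 2, - g c p $ 2 $ 2], vector [g c p $ 1 $ 1, g c p $ 1 $ 2]]"

text \<open>Hodge star on 1-forms, \<open>\<star>\<theta> = - \<theta> \<circ> J\<close>, so that \<open>\<star>\<omega>\<^sub>1 = \<omega>\<^sub>2\<close> and \<open>\<star>\<omega>\<^sub>2 = - \<omega>\<^sub>1\<close> for a positively
  oriented orthonormal coframe.\<close>

definition hodge :: "'a tensor02 \<Rightarrow> 'a one_form \<Rightarrow> 'a one_form" where
  "hodge g \<theta> c p = - (\<theta> c p v* rot g c p)"

text \<open>\<open>\<delta> = - \<star> d \<star>\<close> on 1-forms, where \<open>\<star>(dx\<^sup>1 \<and> dx\<^sup>2) = 1/sqrt (det g)\<close>.\<close>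

definition codifferential :: "'a tensor02 \<Rightarrow> 'a one_form \<Rightarrow> 'a chart \<Rightarrow> 'a \<Rightarrow> real" where
  "codifferential g \<theta> c p =
     - (pd c 1 (\<lambda>q. hodge g \<theta> c q $ 2) p - pd c 2 (\<lambda>q. hodge g \<theta> c q $ 1) p) / sqrt (det (g c p))"

text \<open>The component \<open>\<nabla> c p $ k $ i $ j\<close> is the coefficient \<open>\<Gamma>\<^sup>k\<^sub>i\<^sub>j\<close> of the \<open>k\<close>-th coordinate vector
  in the covariant derivative, in the \<open>i\<close>-th direction, of the \<open>j\<close>-th coordinate vector.\<close>

type_synonym 'a connection = "'a chart \<Rightarrow> 'a \<Rightarrow> real^2^2^2"

definition is_torsion_free_connection :: "'a chart set \<Rightarrow> 'a connection \<Rightarrow> bool" where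
  "is_torsion_free_connection \<A> \<Gamma> \<longleftrightarrow> supported \<A> \<Gamma> \<and> (\<forall>c\<in>\<A>. smooth_in c (\<Gamma> c)) \<and>
     (\<forall>c c' p. in_overlap \<A> c c' p \<longrightarrow> (\<forall>l i j.
        (\<Sum>k\<in>UNIV. jac c c' p $ l $ k * \<Gamma> c p $ k $ i $ j) =
        pd c i (\<lambda>q. jac c c' q $ l $ j) p +
        (\<Sum>a\<in>UNIV. \<Sum>b\<in>UNIV. \<Gamma> c' p $ l $ a $ b * jac c c' p $ a $ i * jac c c' p $ b $ j))) \<and>
     (\<forall>c p k i j. \<Gamma> c p $ k $ i $ j = \<Gamma> c p $ k $ j $ i)"

text \<open>The connection satisfies \<open>\<nabla>g = 2 \<theta> \<otimes> g\<close> for some metric in the class and some 1-form.\<close>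

definition is_conformal_connection :: "'a chart set \<Rightarrow> 'a tensor02 set \<Rightarrow> 'a connection \<Rightarrow> bool" where
  "is_conformal_connection \<A> C \<Gamma> \<longleftrightarrow> is_torsion_free_connection \<A> \<Gamma> \<and>
     (\<exists>g\<in>C. \<exists>\<theta>. is_one_form \<A> \<theta> \<and> (\<forall>c p. in_chart \<A> c p \<longrightarrow> (\<forall>i j k.
        pd c i (\<lambda>q. g c q $ j $ k) p
          - (\<Sum>l\<in>UNIV. \<Gamma> c p $ l $ i $ j * g c p $ l $ k)
          - (\<Sum>l\<in>UNIV. \<Gamma> c p $ l $ i $ k * g c p $ j $ l)
        = 2 * \<theta> c p $ i * g c p $ j $ k)))"

definition levi_civita :: "'a chart set \<Rightarrow> 'a tensor02 \<Rightarrow> 'a connection" where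
  "levi_civita \<A> g c p = (if in_chart \<A> c p then
     (\<chi> k i j. (\<Sum>l\<in>UNIV. matrix_inv (g c p) $ k $ l *
        (pd c i (\<lambda>q. g c q $ j $ l) p + pd c j (\<lambda>q. g c q $ i $ l) p
          - pd c l (\<lambda>q. g c q $ i $ j) p)) / 2) else 0)"

text \<open>\<open>\<^sup>g\<nabla> + g \<otimes> \<theta>\<^sup>\<sharp> - \<theta> \<otimes> Id - Id \<otimes> \<theta>\<close>\<close>

definition weyl_connection :: "'a chart set \<Rightarrow> 'a tensor02 \<Rightarrow> 'a one_form \<Rightarrow> 'a connection" where
  "weyl_connection \<A> g \<theta> c p = (if in_chart \<A> c p then
     (\<chi> k i j. levi_civita \<A> g c p $ k $ i $ j
        + g c p $ i $ j * (matrix_inv (g c p) *v \<theta> c p) $ k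
        - \<theta> c p $ i * (if k = j then 1 else 0) - (if k = i then 1 else 0) * \<theta> c p $ j) else 0)"

text \<open>\<open>curvature \<nabla> c p l k i j\<close> is the \<open>l\<close>-th component of \<open>R(\<partial>\<^sub>i,\<partial>\<^sub>j)\<partial>\<^sub>k\<close>, where
  \<open>R(X,Y) = [\<nabla>\<^sub>X,\<nabla>\<^sub>Y] - \<nabla>\<^sub>[\<^sub>X\<^sub>,\<^sub>Y\<^sub>]\<close>.\<close>

definition curvature :: "'a connection \<Rightarrow> 'a chart \<Rightarrow> 'a \<Rightarrow> 2 \<Rightarrow> 2 \<Rightarrow> 2 \<Rightarrow> 2 \<Rightarrow> real" where
  "curvature \<Gamma> c p l k i j =
     pd c i (\<lambda>q. \<Gamma> c q $ l $ j $ k) p - pd c j (\<lambda>q. \<Gamma> c q $ l $ i $ k) p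
     + (\<Sum>a\<in>UNIV. \<Gamma> c p $ l $ i $ a * \<Gamma> c p $ a $ j $ k - \<Gamma> c p $ l $ j $ a * \<Gamma> c p $ a $ i $ k)"

text \<open>\<open>Ric(Y,Z)\<close> is the trace of \<open>X \<mapsto> R(X,Y)Z\<close>.\<close>

definition ricci :: "'a connection \<Rightarrow> 'a tensor02" where
  "ricci \<Gamma> c p = (\<chi> j k. \<Sum>i\<in>UNIV. curvature \<Gamma> c p i k i j)"

definition sym_ricci :: "'a connection \<Rightarrow> 'a tensor02" where
  "sym_ricci \<Gamma> c p = (1/2) *\<^sub>R (ricci \<Gamma> c p + transpose (ricci \<Gamma> c p))"

text \<open>\<open>g(R(\<partial>\<^sub>1,\<partial>\<^sub>2)\<partial>\<^sub>2,\<partial>\<^sub>1) / det g\<close> for the Levi-Civita connection\<close>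

definition gauss_curvature :: "'a chart set \<Rightarrow> 'a tensor02 \<Rightarrow> 'a chart \<Rightarrow> 'a \<Rightarrow> real" where
  "gauss_curvature \<A> g c p =
     (\<Sum>l\<in>UNIV. g c p $ l $ 1 * curvature (levi_civita \<A> g) c p l 2 1 2) / det (g c p)"

definition negative_definite :: "'a chart set \<Rightarrow> 'a tensor02 \<Rightarrow> bool" where
  "negative_definite \<A> T \<longleftrightarrow> (\<forall>c p v. in_chart \<A> c p \<and> v \<noteq> 0 \<longrightarrow> v \<bullet> (T c p *v v) < 0)"


section \<open>Differentials of degree \<open>m\<close>\<close>

text \<open>In this and the next section \<open>j\<close> is the almost complex structure of a conformal class.
  Complex valued covectors are represented by elements of \<open>complex^2\<close>.\<close>

definition cpair :: "complex^2 \<Rightarrow> real^2 \<Rightarrow> complex" where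
  "cpair \<eta> v = (\<Sum>i\<in>UNIV. \<eta> $ i * of_real (v $ i))"

definition cpull :: "complex^2 \<Rightarrow> real^2^2 \<Rightarrow> complex^2" where
  "cpull \<eta> B = (\<chi> i. \<Sum>l\<in>UNIV. \<eta> $ l * of_real (B $ l $ i))"

definition type10 :: "real^2^2 \<Rightarrow> complex^2 \<Rightarrow> bool" where
  "type10 J \<kappa> \<longleftrightarrow> cpull \<kappa> J = \<i> *s \<kappa>"

definition type01 :: "real^2^2 \<Rightarrow> complex^2 \<Rightarrow> bool" where
  "type01 J \<eta> \<longleftrightarrow> cpull \<eta> J = (- \<i>) *s \<eta>"

definition part01 :: "real^2^2 \<Rightarrow> complex^2 \<Rightarrow> complex^2" where
  "part01 J \<eta> = (1/2) *s (\<eta> + \<i> *s cpull \<eta> J)"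

definition dbar_fun :: "'a endo \<Rightarrow> 'a chart \<Rightarrow> ('a \<Rightarrow> complex) \<Rightarrow> 'a \<Rightarrow> complex^2" where
  "dbar_fun j c f p = part01 (j c p) (\<chi> i. pd c i f p)"

text \<open>The fibre of \<open>K\<^sub>M\<^sup>m\<close>: the tensor power \<open>z \<kappa>\<^sup>m\<close> of the (1,0)-covector \<open>\<kappa>\<close> is represented by its
  values \<open>v \<mapsto> z \<kappa>(v)\<^sup>m\<close> on \<open>(v,\<dots>,v)\<close>, which determine it since \<open>K\<^sub>M\<close> is a complex line bundle.\<close>

definition canonical_power :: "nat \<Rightarrow> real^2^2 \<Rightarrow> (real^2 \<Rightarrow> complex) set" where
  "canonical_power m J = {\<lambda>v. z * cpair \<kappa> v ^ m | z \<kappa>. type10 J \<kappa>}"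

type_synonym 'a differential = "'a chart \<Rightarrow> 'a \<Rightarrow> real^2 \<Rightarrow> complex"

text \<open>\<open>weighted_differential \<A> m w j P\<close>: \<open>P\<close> is a section of \<open>\<Lambda>\<^sup>2(TM)\<^sup>w \<otimes> K\<^sub>M\<^sup>m\<close>, with components
  taken with respect to the local frame \<open>(\<partial>\<^sub>1 \<and> \<partial>\<^sub>2)\<^sup>w\<close> of the first factor.\<close>

definition weighted_differential ::
    "'a chart set \<Rightarrow> nat \<Rightarrow> real \<Rightarrow> 'a endo \<Rightarrow> 'a differential \<Rightarrow> bool" where
  "weighted_differential \<A> m w j P \<longleftrightarrow>
     (\<forall>c p v. \<not> in_chart \<A> c p \<longrightarrow> P c p v = 0) \<and>
     (\<forall>c\<in>\<A>. \<forall>v. smooth_in c (\<lambda>p. P c p v)) \<and>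
     (\<forall>c p. in_chart \<A> c p \<longrightarrow> P c p \<in> canonical_power m (j c p)) \<and>
     (\<forall>c c' p v. in_overlap \<A> c c' p \<longrightarrow>
        of_real (det (jac c c' p) powr w) * P c p v = P c' p (jac c c' p *v v))"

definition is_differential :: "'a chart set \<Rightarrow> nat \<Rightarrow> 'a endo \<Rightarrow> 'a differential \<Rightarrow> bool" where
  "is_differential \<A> m j A \<longleftrightarrow> weighted_differential \<A> m 0 j A"

definition oriented_orthonormal_coframe :: "real^2^2 \<Rightarrow> real^2 \<Rightarrow> real^2 \<Rightarrow> bool" where
  "oriented_orthonormal_coframe G \<omega>1 \<omega>2 \<longleftrightarrow>
     (\<forall>v w. v \<bullet> (G *v w) = (\<omega>1 \<bullet> v) * (\<omega>1 \<bullet> w) + (\<omega>2 \<bullet> v) * (\<omega>2 \<bullet> w)) \<and>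
     \<omega>1 $ 1 * \<omega>2 $ 2 - \<omega>1 $ 2 * \<omega>2 $ 1 > 0"

text \<open>\<open>|A|\<^sup>2 = |z|\<^sup>2\<close> for \<open>A = z (\<omega>\<^sub>1 + i \<omega>\<^sub>2)\<^sup>m\<close>\<close>

definition norm_sq :: "nat \<Rightarrow> real^2^2 \<Rightarrow> (real^2 \<Rightarrow> complex) \<Rightarrow> real" where
  "norm_sq m G a = (THE r. \<forall>\<omega>1 \<omega>2 z. oriented_orthonormal_coframe G \<omega>1 \<omega>2 \<and>
     (\<forall>v. a v = z * Complex (\<omega>1 \<bullet> v) (\<omega>2 \<bullet> v) ^ m) \<longrightarrow> r = (cmod z)\<^sup>2)"

text \<open>The Dolbeault operator of \<open>K\<^sub>M\<^sup>m\<close> is the exterior derivative on (1,0)-forms, extended to tensor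
  powers by the Leibniz rule: if \<open>\<kappa>\<close> is a local (1,0)-coframe, \<open>d\<kappa> = \<beta> \<and> \<kappa>\<close> with \<open>\<beta>\<close> of type (0,1),
  and \<open>A = a \<kappa>\<^sup>m\<close>, then it maps \<open>A\<close> to \<open>(\<partial>a + m a \<beta>) \<otimes> \<kappa>\<^sup>m\<close>, where \<open>\<partial>a\<close> denotes the (0,1)-part
  of \<open>da\<close>. The result does not depend on the coframe; for \<open>\<kappa> = dz\<close> with a local holomorphic
  coordinate \<open>z\<close> one has \<open>\<beta> = 0\<close>. Here the coframe with value 1 on the first coordinate vector is
  used, so that \<open>a = A(\<partial>\<^sub>1,\<dots>,\<partial>\<^sub>1)\<close>.\<close>

definition coframe10 :: "'a endo \<Rightarrow> 'a chart \<Rightarrow> 'a \<Rightarrow> complex^2" where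
  "coframe10 j c p = (THE \<kappa>. type10 (j c p) \<kappa> \<and> \<kappa> $ 1 = 1)"

definition coframe10_conn :: "'a endo \<Rightarrow> 'a chart \<Rightarrow> 'a \<Rightarrow> complex^2" where
  "coframe10_conn j c p = (let \<kappa> = coframe10 j c in
     (THE \<beta>. type01 (j c p) \<beta> \<and>
        pd c 1 (\<lambda>q. \<kappa> q $ 2) p - pd c 2 (\<lambda>q. \<kappa> q $ 1) p = \<beta> $ 1 * \<kappa> p $ 2 - \<beta> $ 2 * \<kappa> p $ 1))"

text \<open>The first vector argument belongs to the (0,1)-form, the second one to \<open>K\<^sub>M\<^sup>m\<close>.\<close>

definition dbar_differential ::
    "nat \<Rightarrow> 'a endo \<Rightarrow> 'a differential \<Rightarrow> 'a chart \<Rightarrow> 'a \<Rightarrow> real^2 \<Rightarrow> real^2 \<Rightarrow> complex" where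
  "dbar_differential m j A c p u v = (let a = (\<lambda>q. A c q (axis 1 1)) in
     cpair (dbar_fun j c a p + (of_nat m * a p) *s coframe10_conn j c p) u
       * cpair (coframe10 j c p) v ^ m)"

text \<open>The components of \<open>(det g)\<^sup>w \<otimes> A\<close>; note that \<open>(det g)\<^sup>w\<close> has weight \<open>-2 w\<close> as a section of a
  power of \<open>\<Lambda>\<^sup>2(TM)\<close>.\<close>

definition det_scale :: "real \<Rightarrow> 'a tensor02 \<Rightarrow> 'a differential \<Rightarrow> 'a differential" where
  "det_scale w g A c p v = of_real (det (g c p) powr w) * A c p v"


section \<open>The line bundle \<open>L\<^sub>m\<close>\<close>

definition weight :: "nat \<Rightarrow> real" where
  "weight m = (real m - 1) / 2"

type_synonym 'a L_section = "'a chart \<Rightarrow> 'a \<Rightarrow> complex"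
type_synonym 'a L_form = "'a chart \<Rightarrow> 'a \<Rightarrow> complex^2"

text \<open>Components are taken with respect to the local frame \<open>(\<partial>\<^sub>1 \<and> \<partial>\<^sub>2)\<^sup>(\<^sup>m\<^sup>-\<^sup>1\<^sup>)\<^sup>/\<^sup>2\<close>.\<close>

definition L_sections :: "'a chart set \<Rightarrow> nat \<Rightarrow> 'a L_section set" where
  "L_sections \<A> m = {s. supported \<A> s \<and> (\<forall>c\<in>\<A>. smooth_in c (s c)) \<and>
     (\<forall>c c' p. in_overlap \<A> c c' p \<longrightarrow> of_real (det (jac c c' p) powr weight m) * s c p = s c' p)}"

definition L_forms01 :: "'a chart set \<Rightarrow> nat \<Rightarrow> 'a endo \<Rightarrow> 'a L_form set" where
  "L_forms01 \<A> m j = {\<eta>. supported \<A> \<eta> \<and> (\<forall>c\<in>\<A>. smooth_in c (\<eta> c)) \<and>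
     (\<forall>c p. in_chart \<A> c p \<longrightarrow> type01 (j c p) (\<eta> c p)) \<and>
     (\<forall>c c' p. in_overlap \<A> c c' p \<longrightarrow>
        of_real (det (jac c c' p) powr weight m) *s \<eta> c p = cpull (\<eta> c' p) (jac c c' p))}"

text \<open>Complex linearity is additivity together with the Leibniz rule for constant functions.\<close>

definition is_dolbeault_operator ::
    "'a chart set \<Rightarrow> nat \<Rightarrow> 'a endo \<Rightarrow> ('a L_section \<Rightarrow> 'a L_form) \<Rightarrow> bool" where
  "is_dolbeault_operator \<A> m j D \<longleftrightarrow>
     D \<in> L_sections \<A> m \<rightarrow>\<^sub>E L_forms01 \<A> m j \<and>
     (\<forall>s\<in>L_sections \<A> m. \<forall>t\<in>L_sections \<A> m. D (\<lambda>c p. s c p + t c p) = (\<lambda>c p. D s c p + D t c p)) \<and>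
     (\<forall>s\<in>L_sections \<A> m. \<forall>f. smooth_fun \<A> f \<longrightarrow> (\<forall>c p. in_chart \<A> c p \<longrightarrow>
        D (\<lambda>c p. f p * s c p) c p = s c p *s dbar_fun j c f p + f p *s D s c p))"

text \<open>The connection induced on \<open>L\<^sub>m\<close>: the covariant derivative of \<open>(\<partial>\<^sub>1 \<and> \<partial>\<^sub>2)\<^sup>w\<close> in the \<open>i\<close>-th
  direction is \<open>w (\<Sum>l. \<Gamma>\<^sup>l\<^sub>i\<^sub>l) (\<partial>\<^sub>1 \<and> \<partial>\<^sub>2)\<^sup>w\<close>.\<close>

definition induced_connection :: "nat \<Rightarrow> 'a connection \<Rightarrow> 'a L_section \<Rightarrow> 'a L_form" where
  "induced_connection m \<Gamma> s c p =
     (\<chi> i. pd c i (s c) p + of_real (weight m * (\<Sum>l\<in>UNIV. \<Gamma> c p $ l $ i $ l)) * s c p)"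

definition connection01 ::
    "'a chart set \<Rightarrow> nat \<Rightarrow> 'a endo \<Rightarrow> 'a connection \<Rightarrow> 'a L_section \<Rightarrow> 'a L_form" where
  "connection01 \<A> m j \<Gamma> = (\<lambda>s\<in>L_sections \<A> m. \<lambda>c p.
     if in_chart \<A> c p then part01 (j c p) (induced_connection m \<Gamma> s c p) else 0)"

definition associated_connection ::
    "'a chart set \<Rightarrow> nat \<Rightarrow> 'a tensor02 set \<Rightarrow> ('a L_section \<Rightarrow> 'a L_form) \<Rightarrow> 'a connection" where
  "associated_connection \<A> m C D =
     (THE \<Gamma>. is_conformal_connection \<A> C \<Gamma> \<and> connection01 \<A> m (rot (rep C)) \<Gamma> = D)"

text \<open>The Dolbeault operator of \<open>L\<^sub>m \<otimes> K\<^sub>M\<^sup>m\<close>, characterised by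
  \<open>s \<otimes> A \<mapsto> D s \<otimes> A + s \<otimes> dbar A\<close>. Every section is of the form \<open>s \<otimes> A\<close>, since \<open>L\<^sub>m\<close> has a nowhere
  vanishing section.\<close>

definition dbar_tensor :: "'a chart set \<Rightarrow> nat \<Rightarrow> 'a endo \<Rightarrow> ('a L_section \<Rightarrow> 'a L_form) \<Rightarrow>
    'a differential \<Rightarrow> 'a chart \<Rightarrow> 'a \<Rightarrow> real^2 \<Rightarrow> real^2 \<Rightarrow> complex" where
  "dbar_tensor \<A> m j D P c p u v = (THE z. \<forall>s A.
     s \<in> L_sections \<A> m \<and> is_differential \<A> m j A \<and> P = (\<lambda>c p v. s c p * A c p v) \<longrightarrow>
     z = cpair (D s c p) u * A c p v + s c p * dbar_differential m j A c p u v)"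

definition is_holomorphic_section :: "'a chart set \<Rightarrow> nat \<Rightarrow> 'a endo \<Rightarrow>
    ('a L_section \<Rightarrow> 'a L_form) \<Rightarrow> 'a differential \<Rightarrow> bool" where
  "is_holomorphic_section \<A> m j D P \<longleftrightarrow> weighted_differential \<A> m (weight m) j P \<and>
     (\<forall>c p u v. in_chart \<A> c p \<longrightarrow> dbar_tensor \<A> m j D P c p u v = 0)"

text \<open>The quadratic form \<open>|P|\<^sup>2 g\<close>, for any metric \<open>g\<close> in the class\<close>

definition quadratic_form :: "nat \<Rightarrow> 'a tensor02 set \<Rightarrow> 'a differential \<Rightarrow> 'a tensor02" where
  "quadratic_form m C P c p = (let g = rep C in
     norm_sq m (g c p) (det_scale ((real m - 1) / 4) g P c p) *\<^sub>R g c p)"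


section \<open>The two sets of triples and the correspondence\<close>

definition vortex_triples ::
    "'a chart set \<Rightarrow> nat \<Rightarrow> ('a tensor02 \<times> 'a differential \<times> 'a one_form) set" where
  "vortex_triples \<A> m = {(g, A, \<theta>).
     is_metric \<A> g \<and> is_differential \<A> m (rot g) A \<and> is_one_form \<A> \<theta> \<and>
     (\<forall>c p. in_chart \<A> c p \<longrightarrow>
        gauss_curvature \<A> g c p
          = -1 + codifferential g \<theta> c p + (real m - 1) * norm_sq m (g c p) (A c p)) \<and>
     (\<forall>c p u v. in_chart \<A> c p \<longrightarrow>
        dbar_differential m (rot g) A c p u v
          = (of_nat m - 1) / 2 * (of_real (\<theta> c p \<bullet> u) - \<i> * of_real (hodge g \<theta> c p \<bullet> u)) * A c p v)}"

definition holomorphic_triples :: "'a chart set \<Rightarrow> nat \<Rightarrow>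
    ('a tensor02 set \<times> ('a L_section \<Rightarrow> 'a L_form) \<times> 'a differential) set" where
  "holomorphic_triples \<A> m = {(C, D, P).
     is_conformal_structure \<A> C \<and> is_dolbeault_operator \<A> m (rot (rep C)) D \<and>
     is_holomorphic_section \<A> m (rot (rep C)) D P \<and>
     negative_definite \<A> (\<lambda>c p. sym_ricci (associated_connection \<A> m C D) c p
       + (1 - real m) *\<^sub>R quadratic_form m C P c p)}"

text \<open>\<open>(g, A, \<theta>) \<mapsto> ([g], \<^sup>(\<^sup>g\<^sup>,\<^sup>\<theta>\<^sup>)\<nabla>\<^sup>(\<^sup>0\<^sup>,\<^sup>1\<^sup>), (det g)\<^sup>-\<^sup>(\<^sup>m\<^sup>-\<^sup>1\<^sup>)\<^sup>/\<^sup>4 \<otimes> A)\<close>\<close>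

definition correspondence :: "'a chart set \<Rightarrow> nat \<Rightarrow> 'a tensor02 \<times> 'a differential \<times> 'a one_form \<Rightarrow>
    'a tensor02 set \<times> ('a L_section \<Rightarrow> 'a L_form) \<times> 'a differential" where
  "correspondence \<A> m = (\<lambda>(g, A, \<theta>).
     (conformal_class \<A> g,
      connection01 \<A> m (rot g) (weyl_connection \<A> g \<theta>),
      det_scale (- ((real m - 1) / 4)) g A))"

end

theory Submission
  imports Defs
begin

text \<open>
  Write \<open>s = (det g)\<^sup>-\<^sup>(\<^sup>m\<^sup>-\<^sup>1\<^sup>)\<^sup>/\<^sup>4\<close> for the nowhere vanishing section of \<open>L\<^sub>m\<close> given by a metric \<open>g\<close>
  (\<open>det_frame\<close>). It turns the data of a triple in (ii) into the data of a triple in (i).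

  A Dolbeault operator is determined by its value on \<open>s\<close>, because every section is \<open>f s\<close> and the
  Leibniz rule applies. That value is a (0,1)-form, hence it is \<open>-(m-1)/2 (\<theta> - i\<star>\<theta>) s\<close> for a unique real
  1-form \<open>\<theta>\<close>; since \<open>m \<noteq> 1\<close>, nothing is lost. This is also the value of the (0,1)-part of the Weyl
  connection of \<open>(g,\<theta>)\<close> (\<open>connection01_det_frame\<close>), and the conformal connections are exactly the Weyl
  connections of \<open>g\<close> and some 1-form (\<open>conformal_connection_iff\<close>). So the conformal connection associated to
  the operator is that of \<open>(g,\<theta>)\<close> (\<open>associated_connection_weyl\<close>). Similarly \<open>P = s \<otimes> A\<close> for a unique
  differential \<open>A\<close>, and by the Leibniz rule \<open>P\<close> is holomorphic if and only if the second equation of (i)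
  holds (\<open>holomorphic_section_iff\<close>).

  It remains to see what the choice of \<open>g\<close> within its conformal class means. The symmetric part of the Ricci
  curvature of the Weyl connection is \<open>(K\<^sub>g - \<delta>\<^sub>g\<theta>) g\<close> (\<open>sym_ricci_weyl\<close>), so the form in the definiteness
  condition of (ii) is \<open>(K\<^sub>g - \<delta>\<^sub>g\<theta> - (m-1)|A|\<^sup>2) g\<close> (\<open>curvature_form\<close>), and the first equation of (i) says
  that this form is \<open>-g\<close>. Thus a solution of (i) gives a negative definite form, and \<open>g\<close> is recovered from
  the triple in (ii) as minus this form, which proves injectivity. Conversely the form depends only on the
  triple in (ii), not on the metric that is used to express it. If it is negative definite, then its
  negative is a metric of the form \<open>e\<^sup>2\<^sup>u g\<close>, and with respect to this metric and the 1-form \<open>\<theta> + du\<close>, which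
  define the same Weyl connection (\<open>weyl_conformal\<close>), the first equation holds.

  All objects are families of components in charts. Two facts about them carry the differential geometry. A
  torsion-free connection with \<open>\<nabla>g = 2\<theta> \<otimes> g\<close> is unique already at a single point
  (\<open>compatible_unique\<close>); this gives the transformation law of Weyl connections and their conformal
  invariance without computing Christoffel symbols. And in dimension two the Weyl connection differs from the
  Levi-Civita connection by \<open>- \<theta> \<otimes> Id - \<star>\<theta> \<otimes> J\<close> (\<open>weyl_levi_civita\<close>), where \<open>J\<close> is parallel; the two
  endomorphisms commute, so the curvature changes only by \<open>- d\<theta> \<otimes> Id - d\<star>\<theta> \<otimes> J\<close>.
\<close>

section \<open>Calculus of smooth functions on open sets\<close>

lemma Ck_on_cong:
  assumes "open S" "\<And>x. x \<in> S \<Longrightarrow> f x = g x" "Ck_on k S f"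
  shows "Ck_on k S g"
  using assms(2,3)
proof (induction k arbitrary: f g)
  case 0
  then show ?case by (auto intro: continuous_on_eq)
next
  case (Suc k)
  have "(g has_derivative frechet_derivative f (at x)) (at x)" if "x \<in> S" for x
  proof (rule has_derivative_transform_within_open[OF _ assms(1) that])
    show "(f has_derivative frechet_derivative f (at x)) (at x)"
      using Suc.prems(2) that by (simp add: frechet_derivative_works)
  qed (use Suc.prems(1) in auto)
  then have "g differentiable (at x)" "frechet_derivative f (at x) = frechet_derivative g (at x)"
    if "x \<in> S" for x
    using that frechet_derivative_at by (blast intro: differentiableI)+
  note g = this
  have "Ck_on k S (\<lambda>x. frechet_derivative g (at x) v)" for v
  proof (rule Suc.IH)
    show "Ck_on k S (\<lambda>x. frechet_derivative f (at x) v)" using Suc.prems(2) by simp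
  qed (simp add: g(2))
  then show ?case using g(1) by simp
qed

text \<open>An introduction rule with an explicit derivative, so that the choice made by
\<open>frechet_derivative\<close> need not be mentioned in the closure properties below.\<close>

lemma Ck_on_SucI:
  assumes "\<And>x. x \<in> S \<Longrightarrow> (f has_derivative f' x) (at x)"
    and "\<And>v. Ck_on k S (\<lambda>x. f' x v)" and "open S"
  shows "Ck_on (Suc k) S f"
proof -
  have "f' x = frechet_derivative f (at x)" if "x \<in> S" for x
    using frechet_derivative_at[OF assms(1)[OF that]] .
  then have "Ck_on k S (\<lambda>x. frechet_derivative f (at x) v)" for v
    by (intro Ck_on_cong[OF assms(3) _ assms(2)[of v]]) simp
  then show ?thesis
    using assms(1) by (auto intro: differentiableI)
qed

lemma Ck_on_SucD:
  fixes f :: "'a::real_normed_vector \<Rightarrow> 'b::real_normed_vector"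
  assumes "Ck_on (Suc k) S f"
  shows "Ck_on k S f"
  using assms
proof (induction k arbitrary: f)
  case (0 f)
  then have "isCont f x" if "x \<in> S" for x
    using that by (simp add: differentiable_imp_continuous_within)
  then show ?case by (simp add: continuous_at_imp_continuous_on)
next
  case (Suc k f)
  have "Ck_on k S (\<lambda>x. frechet_derivative f (at x) v)" for v
    by (rule Suc.IH) (use Suc.prems in simp)
  then show ?case using Suc.prems by simp
qed

lemma Ck_on_subset:
  assumes "T \<subseteq> S" "Ck_on k S f"
  shows "Ck_on k T f"
  using assms(2)
  by (induction k arbitrary: f) (use assms(1) in \<open>auto intro: continuous_on_subset\<close>)

lemma Ck_on_local:
  assumes "\<And>x. x \<in> S \<Longrightarrow> \<exists>T. open T \<and> x \<in> T \<and> Ck_on k T f"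
  shows "Ck_on k S f"
  using assms
proof (induction k arbitrary: f)
  case 0
  then have "isCont f x" if "x \<in> S" for x
    using that continuous_on_eq_continuous_at by (metis Ck_on.simps(1))
  then show ?case by (simp add: continuous_at_imp_continuous_on)
next
  case (Suc k)
  have "f differentiable (at x)" if "x \<in> S" for x
    using Suc.prems[OF that] by auto
  moreover have "Ck_on k S (\<lambda>x. frechet_derivative f (at x) v)" for v
    by (rule Suc.IH) (use Suc.prems in fastforce)
  ultimately show ?case by simp
qed

lemma Ck_on_const: "Ck_on k S (\<lambda>x. a)"
  by (induction k arbitrary: a) auto

lemma Ck_on_add:
  assumes "open S" "Ck_on k S f" "Ck_on k S g"
  shows "Ck_on k S (\<lambda>x. f x + g x)"
  using assms(2,3)
proof (induction k arbitrary: f g)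
  case 0
  then show ?case by (auto intro: continuous_on_add)
next
  case (Suc k)
  show ?case
    by (rule Ck_on_SucI[where f' = "\<lambda>x v. frechet_derivative f (at x) v + frechet_derivative g (at x) v"])
       (use Suc.prems in \<open>auto intro!: has_derivative_add Suc.IH assms(1) simp: frechet_derivative_works\<close>)
qed

lemma Ck_on_linear:
  assumes "open S" "bounded_linear h" "Ck_on k S f"
  shows "Ck_on k S (\<lambda>x. h (f x))"
  using assms(3)
proof (induction k arbitrary: f)
  case 0
  then show ?case using assms(2) by (auto intro: bounded_linear.continuous_on)
next
  case (Suc k)
  show ?case
    by (rule Ck_on_SucI[where f' = "\<lambda>x v. h (frechet_derivative f (at x) v)"])
       (use Suc.prems in \<open>auto intro!: bounded_linear.has_derivative[OF assms(2)] Suc.IH assms(1)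
          simp: frechet_derivative_works\<close>)
qed

text \<open>The product rule expresses the derivative of \<open>b (f x) (g x)\<close> by the same \<open>b\<close>, applied to functions that are
\<open>C\<^sup>k\<close> when \<open>f\<close> and \<open>g\<close> are \<open>C\<^sup>k\<^sup>+\<^sup>1\<close>. All products that occur below are instances.\<close>

lemma Ck_on_bilinear:
  assumes "open S" "bounded_bilinear b" "Ck_on k S f" "Ck_on k S g"
  shows "Ck_on k S (\<lambda>x. b (f x) (g x))"
  using assms(3,4)
proof (induction k arbitrary: f g)
  case 0
  then show ?case using assms(2) by (auto intro: bounded_bilinear.continuous_on)
next
  case (Suc k)
  have k: "Ck_on k S f" "Ck_on k S g" using Suc.prems by (auto intro: Ck_on_SucD)
  show ?case
  proof (rule Ck_on_SucI[where f' = "\<lambda>x v. b (f x) (frechet_derivative g (at x) v) + b (frechet_derivative f (at x) v) (g x)"])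
    show "((\<lambda>x. b (f x) (g x)) has_derivative
        (\<lambda>v. b (f x) (frechet_derivative g (at x) v) + b (frechet_derivative f (at x) v) (g x))) (at x)"
      if "x \<in> S" for x
      using bounded_bilinear.FDERIV[OF assms(2)] Suc.prems that
      by (fastforce simp: frechet_derivative_works)
    show "Ck_on k S (\<lambda>x. b (f x) (frechet_derivative g (at x) v) + b (frechet_derivative f (at x) v) (g x))" for v
      using Suc.prems by (auto intro!: Ck_on_add assms(1) Suc.IH k)
  qed (rule assms(1))
qed

text \<open>The chain rule involves the derivative of \<open>h\<close> in a direction that varies with the point, whereas the definition
of \<open>C\<^sup>k\<^sup>+\<^sup>1\<close> speaks of fixed directions. Expanding this direction in a basis makes the derivative a sum of
products, to which the induction hypothesis applies; this is where the middle space has to be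
finite dimensional.\<close>

lemma Ck_on_compose:
  fixes f :: "'a::real_normed_vector \<Rightarrow> 'b::euclidean_space" and h :: "'b \<Rightarrow> 'c::real_normed_vector"
  assumes "open S" "open T" "f ` S \<subseteq> T" "Ck_on k S f" "Ck_on k T h"
  shows "Ck_on k S (\<lambda>x. h (f x))"
  using assms(4,5)
proof (induction k arbitrary: h)
  case 0
  then show ?case using assms(3) by (auto intro: continuous_on_compose2)
next
  case (Suc k)
  let ?f' = "\<lambda>x. frechet_derivative f (at x)" and ?h' = "\<lambda>x. frechet_derivative h (at x)"
  have h: "(h has_derivative ?h' y) (at y)" if "y \<in> T" for y
    using Suc.prems that by (simp add: frechet_derivative_works)
  have "?h' (f x) w = (\<Sum>b\<in>Basis. (w \<bullet> b) *\<^sub>R ?h' (f x) b)" if "x \<in> S" for x w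
  proof -
    have "linear (?h' (f x))" using h that assms(3) has_derivative_linear by blast
    from linear_sum[OF this, of "\<lambda>b. (w \<bullet> b) *\<^sub>R b" Basis] show ?thesis
      by (simp add: euclidean_representation linear_cmul[OF \<open>linear (?h' (f x))\<close>])
  qed
  note expand = this
  have sum: "Ck_on k S (\<lambda>x. \<Sum>b\<in>B. F b x)" if "finite B" "\<And>b. b \<in> B \<Longrightarrow> Ck_on k S (F b)"
    for B :: "'b set" and F :: "'b \<Rightarrow> 'a \<Rightarrow> 'c"
    using that by (induction B) (auto intro!: Ck_on_add assms(1) Ck_on_const)
  show ?case
  proof (rule Ck_on_SucI[where f' = "\<lambda>x v. \<Sum>b\<in>Basis. (?f' x v \<bullet> b) *\<^sub>R ?h' (f x) b"])
    fix x assume x: "x \<in> S"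
    have "(f has_derivative ?f' x) (at x)"
      using Suc.prems x by (simp add: frechet_derivative_works)
    from has_derivative_compose[OF this h]
    show "((\<lambda>x. h (f x)) has_derivative (\<lambda>v. \<Sum>b\<in>Basis. (?f' x v \<bullet> b) *\<^sub>R ?h' (f x) b)) (at x)"
      using x assms(3) expand by auto
  next
    show "Ck_on k S (\<lambda>x. \<Sum>b\<in>Basis. (?f' x v \<bullet> b) *\<^sub>R ?h' (f x) b)" for v
      using Suc.prems Ck_on_SucD[OF Suc.prems(1)]
      by (intro sum Ck_on_bilinear[OF assms(1) bounded_bilinear_scaleR] Suc.IH
          Ck_on_linear[OF assms(1) bounded_linear_inner_left]) auto
  qed (rule assms(1))
qed

lemma Ck_on_real:
  fixes h :: "real \<Rightarrow> real"
  assumes "open S" "\<And>x. x \<in> S \<Longrightarrow> (h has_real_derivative h' x) (at x)" "Ck_on k S h'"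
  shows "Ck_on (Suc k) S h"
proof (rule Ck_on_SucI[where f' = "\<lambda>x v. v * h' x"])
  show "Ck_on k S (\<lambda>x. v * h' x)" for v
    using Ck_on_linear[OF assms(1) bounded_linear_mult_right assms(3)] .
qed (use assms(1,2) in \<open>auto simp: has_field_derivative_def mult_commute_abs\<close>)

text \<open>Real powers are closed under differentiation up to constants. They contain the inverse and the square root, which
is how these are shown to be smooth later.\<close>

lemma smooth_on_powr: "smooth_on {0<..} (\<lambda>x::real. x powr a)"
proof -
  have "Ck_on k {0<..} (\<lambda>x::real. x powr a)" for k
  proof (induction k arbitrary: a)
    case 0
    then show ?case by (auto intro!: continuous_intros)
  next
    case (Suc k)
    show ?case
      by (rule Ck_on_real[where h' = "\<lambda>x. a * x powr (a - 1)"])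
         (simp_all add: has_real_derivative_powr Ck_on_linear[OF _ bounded_linear_mult_right Suc.IH])
  qed
  then show ?thesis by (simp add: smooth_on_def)
qed

lemma smooth_on_ln: "smooth_on {0<..} (ln :: real \<Rightarrow> real)"
proof -
  have "Ck_on (Suc k) {0<..} (ln :: real \<Rightarrow> real)" for k
    using smooth_on_powr[of "-1"]
    by (intro Ck_on_real[where h' = "\<lambda>x. x powr (-1)"])
       (auto intro!: derivative_eq_intros simp: smooth_on_def powr_minus divide_inverse)
  then show ?thesis using Ck_on_SucD unfolding smooth_on_def by blast
qed

lemma smooth_on_exp: "smooth_on UNIV (exp :: real \<Rightarrow> real)"
proof -
  have "Ck_on k UNIV (exp :: real \<Rightarrow> real)" for k
  proof (induction k)
    case 0
    then show ?case by (auto intro!: continuous_intros)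
  next
    case (Suc k)
    then show ?case by (rule Ck_on_real[rotated 2]) auto
  qed
  then show ?thesis by (simp add: smooth_on_def)
qed

section \<open>Symmetry of second derivatives\<close>

text \<open>The mixed second difference on a parallelogram is a value of the iterated derivative, by the mean value theorem
in the direction \<open>v\<close>, followed by that in the direction \<open>w\<close>.\<close>

lemma second_difference:
  fixes f :: "'a::real_normed_vector \<Rightarrow> real"
  defines "fv \<equiv> \<lambda>v y. frechet_derivative f (at y) v"
  assumes "Ck_on 2 S f" "t > 0"
    and S: "\<And>a b. \<lbrakk>0 \<le> a; a \<le> t; 0 \<le> b; b \<le> t\<rbrakk> \<Longrightarrow> x + a *\<^sub>R v + b *\<^sub>R w \<in> S"
  shows "\<exists>a b. 0 \<le> a \<and> a \<le> t \<and> 0 \<le> b \<and> b \<le> t \<and>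
    f (x + t *\<^sub>R v + t *\<^sub>R w) - f (x + t *\<^sub>R v) - f (x + t *\<^sub>R w) + f x
      = t * t * frechet_derivative (fv v) (at (x + a *\<^sub>R v + b *\<^sub>R w)) w"
proof -
  have df: "(f has_derivative frechet_derivative f (at y)) (at y)" if "y \<in> S" for y
    using assms(2) that by (simp add: numeral_2_eq_2 frechet_derivative_works)
  have dfv: "(fv v has_derivative frechet_derivative (fv v) (at y)) (at y)" if "y \<in> S" for y
    using assms(2) that unfolding fv_def by (simp add: numeral_2_eq_2 frechet_derivative_works)
  have line: "((\<lambda>r. h (y + r *\<^sub>R u)) has_derivative (\<lambda>s. s * h' u)) (at r)"
    if "(h has_derivative h') (at (y + r *\<^sub>R u))"
    for h :: "'a \<Rightarrow> real" and h' y u and r :: real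
  proof -
    have "((\<lambda>r. y + r *\<^sub>R u) has_derivative (\<lambda>s. s *\<^sub>R u)) (at r)"
      by (auto intro!: derivative_eq_intros)
    from has_derivative_compose[OF this that]
    have "((\<lambda>r. h (y + r *\<^sub>R u)) has_derivative (\<lambda>s. h' (s *\<^sub>R u))) (at r)" by simp
    moreover have "linear h'" using that has_derivative_linear by blast
    ultimately show ?thesis by (simp add: linear_cmul)
  qed
  obtain a where a: "0 < a" "a < t" and a_eq:
    "(f ((x + t *\<^sub>R w) + t *\<^sub>R v) - f (x + t *\<^sub>R v)) - (f ((x + t *\<^sub>R w) + 0 *\<^sub>R v) - f (x + 0 *\<^sub>R v))
      = (t - 0) * fv v ((x + t *\<^sub>R w) + a *\<^sub>R v) - (t - 0) * fv v (x + a *\<^sub>R v)"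
  proof -
    have "\<exists>a\<in>{0<..<t}. (\<lambda>r. f ((x + t *\<^sub>R w) + r *\<^sub>R v) - f (x + r *\<^sub>R v)) t
        - (\<lambda>r. f ((x + t *\<^sub>R w) + r *\<^sub>R v) - f (x + r *\<^sub>R v)) 0
      = (\<lambda>s. s * fv v ((x + t *\<^sub>R w) + a *\<^sub>R v) - s * fv v (x + a *\<^sub>R v)) (t - 0)"
    proof (rule mvt_simple[OF \<open>t > 0\<close>])
      fix r assume r: "0 \<le> r" "r \<le> t"
      then have "(x + t *\<^sub>R w) + r *\<^sub>R v \<in> S" "x + r *\<^sub>R v \<in> S"
        using S[of r t] S[of r 0] \<open>t > 0\<close> by (auto simp: algebra_simps)
      then show "((\<lambda>r. f ((x + t *\<^sub>R w) + r *\<^sub>R v) - f (x + r *\<^sub>R v)) has_derivative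
          (\<lambda>s. s * fv v ((x + t *\<^sub>R w) + r *\<^sub>R v) - s * fv v (x + r *\<^sub>R v))) (at r within {0..t})"
        unfolding fv_def
        by (intro has_derivative_at_withinI[OF has_derivative_diff] line[where h = f, OF df])
    qed
    then show ?thesis using that by auto
  qed
  obtain b where b: "0 < b" "b < t" and b_eq:
    "fv v ((x + a *\<^sub>R v) + t *\<^sub>R w) - fv v ((x + a *\<^sub>R v) + 0 *\<^sub>R w)
      = (t - 0) * frechet_derivative (fv v) (at ((x + a *\<^sub>R v) + b *\<^sub>R w)) w"
  proof -
    have "\<exists>b\<in>{0<..<t}. (\<lambda>r. fv v ((x + a *\<^sub>R v) + r *\<^sub>R w)) t - (\<lambda>r. fv v ((x + a *\<^sub>R v) + r *\<^sub>R w)) 0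
      = (\<lambda>s. s * frechet_derivative (fv v) (at ((x + a *\<^sub>R v) + b *\<^sub>R w)) w) (t - 0)"
      by (rule mvt_simple[OF \<open>t > 0\<close>], rule has_derivative_at_withinI, rule line, rule dfv)
         (use a S in auto)
    then show ?thesis using that by auto
  qed
  have "f (x + t *\<^sub>R v + t *\<^sub>R w) - f (x + t *\<^sub>R v) - f (x + t *\<^sub>R w) + f x
      = t * (fv v ((x + a *\<^sub>R v) + t *\<^sub>R w) - fv v (x + a *\<^sub>R v))"
    using a_eq by (simp add: algebra_simps)
  also have "\<dots> = t * t * frechet_derivative (fv v) (at (x + a *\<^sub>R v + b *\<^sub>R w)) w"
    using b_eq by simp
  finally show ?thesis using a b by (intro exI[of _ a] exI[of _ b]) auto
qed

text \<open>The second difference is symmetric in \<open>v\<close> and \<open>w\<close>. Hence in every small parallelogram at \<open>x\<close> each of the iterated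
derivatives takes a value that the other one takes as well, perhaps at another point; and both are continuous.\<close>

lemma second_derivative_commute:
  fixes f :: "'a::real_normed_vector \<Rightarrow> real"
  assumes "open S" "Ck_on 2 S f" "x \<in> S"
  shows "frechet_derivative (\<lambda>y. frechet_derivative f (at y) v) (at x) w
       = frechet_derivative (\<lambda>y. frechet_derivative f (at y) w) (at x) v"
proof (rule ccontr)
  define F where "F v w y = frechet_derivative (\<lambda>y. frechet_derivative f (at y) v) (at y) w" for v w y
  assume "\<not> ?thesis"
  then have ne: "F v w x \<noteq> F w v x" by (simp add: F_def)
  define e where "e = \<bar>F v w x - F w v x\<bar> / 2"
  have "e > 0" using ne by (simp add: e_def)
  have "continuous_on S (F v w)" "continuous_on S (F w v)"
    using assms(2) by (auto simp: numeral_2_eq_2 F_def)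
  then have "isCont (F v w) x" "isCont (F w v) x"
    using assms(1,3) continuous_on_eq_continuous_at by blast+
  note cont = this[unfolded isCont_def tendsto_at_iff_tendsto_nhds]
  have "\<forall>\<^sub>F y in nhds x. dist (F v w y) (F v w x) < e" "\<forall>\<^sub>F y in nhds x. dist (F w v y) (F w v x) < e"
    using tendstoD[OF cont(1) \<open>e > 0\<close>] tendstoD[OF cont(2) \<open>e > 0\<close>] .
  moreover have "\<forall>\<^sub>F y in nhds x. y \<in> S" using assms(1,3) eventually_nhds by blast
  ultimately have "\<forall>\<^sub>F y in nhds x. y \<in> S \<and> dist (F v w y) (F v w x) < e \<and> dist (F w v y) (F w v x) < e"
    by eventually_elim auto
  then obtain d where "d > 0" and d: "\<And>y. dist y x < d \<Longrightarrow>
      y \<in> S \<and> dist (F v w y) (F v w x) < e \<and> dist (F w v y) (F w v x) < e"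
    unfolding eventually_nhds_metric by auto
  \<comment> \<open>the parallelogram with sides \<open>t v\<close> and \<open>t w\<close> lies in the ball of radius \<open>d\<close>\<close>
  define t where "t = d / (norm v + norm w + 1)"
  have pos: "norm v + norm w + 1 > 0" by (simp add: add_nonneg_pos)
  then have "t > 0" using \<open>d > 0\<close> by (simp add: t_def)
  have near: "dist (x + a *\<^sub>R v + b *\<^sub>R w) x < d" if "0 \<le> a" "a \<le> t" "0 \<le> b" "b \<le> t" for a b
  proof -
    have "dist (x + a *\<^sub>R v + b *\<^sub>R w) x \<le> a * norm v + b * norm w"
      using that norm_triangle_ineq[of "a *\<^sub>R v" "b *\<^sub>R w"] by (simp add: dist_norm add.assoc)
    also have "\<dots> \<le> t * (norm v + norm w)"
      using that by (simp add: distrib_left add_mono mult_right_mono)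
    also have "\<dots> < t * (norm v + norm w + 1)" using \<open>t > 0\<close> by simp
    also have "\<dots> = d" using pos by (simp add: t_def)
    finally show ?thesis .
  qed
  have near': "dist (x + a *\<^sub>R w + b *\<^sub>R v) x < d" if "0 \<le> a" "a \<le> t" "0 \<le> b" "b \<le> t" for a b
    using near[of b a] that by (simp add: algebra_simps)
  obtain a b where ab: "0 \<le> a" "a \<le> t" "0 \<le> b" "b \<le> t"
    and 1: "f (x + t *\<^sub>R v + t *\<^sub>R w) - f (x + t *\<^sub>R v) - f (x + t *\<^sub>R w) + f x
      = t * t * F v w (x + a *\<^sub>R v + b *\<^sub>R w)"
    using second_difference[OF assms(2) \<open>t > 0\<close>, of x v w] near d by (auto simp: F_def)
  obtain a' b' where ab': "0 \<le> a'" "a' \<le> t" "0 \<le> b'" "b' \<le> t"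
    and 2: "f (x + t *\<^sub>R w + t *\<^sub>R v) - f (x + t *\<^sub>R w) - f (x + t *\<^sub>R v) + f x
      = t * t * F w v (x + a' *\<^sub>R w + b' *\<^sub>R v)"
    using second_difference[OF assms(2) \<open>t > 0\<close>, of x w v] near' d by (auto simp: F_def)
  have "F v w (x + a *\<^sub>R v + b *\<^sub>R w) = F w v (x + a' *\<^sub>R w + b' *\<^sub>R v)"
    using 1 2 \<open>t > 0\<close> by (simp add: algebra_simps)
  moreover have "dist (F v w (x + a *\<^sub>R v + b *\<^sub>R w)) (F v w x) < e"
    using near[OF ab] d by blast
  moreover have "dist (F w v (x + a' *\<^sub>R w + b' *\<^sub>R v)) (F w v x) < e"
    using near'[OF ab'] d by blast
  ultimately show False by (simp add: e_def dist_real_def abs_if split: if_splits)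
qed

section \<open>Germs of functions in a chart\<close>

text \<open>Smoothness of the germ at \<open>p\<close>, in the coordinates of \<open>c\<close>. Components on the overlap of two charts are not
smooth on the whole of either chart, but their germs are; so the calculus with partial derivatives
is done for germs.\<close>

definition smooth_near :: "'a chart \<Rightarrow> 'a \<Rightarrow> ('a \<Rightarrow> 'b::real_normed_vector) \<Rightarrow> bool" where
  "smooth_near c p f \<longleftrightarrow> (\<exists>S. open S \<and> coord c p \<in> S \<and> smooth_on S (f \<circ> param c))"

lemma smooth_near_const : "smooth_near c p (\<lambda>q. a)"
  unfolding smooth_near_def smooth_on_def o_def by (intro exI[of _ UNIV] conjI allI Ck_on_const) auto

lemma smooth_near_linear:
  assumes "bounded_linear h" "smooth_near c p f"
  shows "smooth_near c p (\<lambda>q. h (f q))"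
  using assms(2) Ck_on_linear[OF _ assms(1)] unfolding smooth_near_def smooth_on_def o_def by blast

lemma smooth_near_bilinear:
  assumes "bounded_bilinear b" "smooth_near c p f" "smooth_near c p h"
  shows "smooth_near c p (\<lambda>q. b (f q) (h q))"
proof -
  obtain S T where "open S" "coord c p \<in> S" and f: "\<And>k. Ck_on k S (\<lambda>x. f (param c x))"
    and "open T" "coord c p \<in> T" and h: "\<And>k. Ck_on k T (\<lambda>x. h (param c x))"
    using assms(2,3) unfolding smooth_near_def smooth_on_def o_def by blast
  have "Ck_on k (S \<inter> T) (\<lambda>x. b (f (param c x)) (h (param c x)))" for k
    by (rule Ck_on_bilinear[OF _ assms(1) Ck_on_subset[OF _ f] Ck_on_subset[OF _ h]])
       (use \<open>open S\<close> \<open>open T\<close> in auto)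
  then show ?thesis
    unfolding smooth_near_def smooth_on_def o_def
    using \<open>open S\<close> \<open>open T\<close> \<open>coord c p \<in> S\<close> \<open>coord c p \<in> T\<close> by (intro exI[of _ "S \<inter> T"]) auto
qed

lemma smooth_near_add:
  assumes "smooth_near c p f" "smooth_near c p h"
  shows "smooth_near c p (\<lambda>q. f q + h q)"
proof -
  obtain S T where "open S" "coord c p \<in> S" and f: "\<And>k. Ck_on k S (\<lambda>x. f (param c x))"
    and "open T" "coord c p \<in> T" and h: "\<And>k. Ck_on k T (\<lambda>x. h (param c x))"
    using assms unfolding smooth_near_def smooth_on_def o_def by blast
  have "Ck_on k (S \<inter> T) (\<lambda>x. f (param c x) + h (param c x))" for k
    by (rule Ck_on_add[OF _ Ck_on_subset[OF _ f] Ck_on_subset[OF _ h]])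
       (use \<open>open S\<close> \<open>open T\<close> in auto)
  then show ?thesis
    unfolding smooth_near_def smooth_on_def o_def
    using \<open>open S\<close> \<open>open T\<close> \<open>coord c p \<in> S\<close> \<open>coord c p \<in> T\<close> by (intro exI[of _ "S \<inter> T"]) auto
qed

lemmas smooth_near_scaleR = smooth_near_bilinear[OF bounded_bilinear_scaleR]
lemmas smooth_near_mult = smooth_near_bilinear[OF bounded_bilinear_mult]
lemmas smooth_near_minus = smooth_near_linear[OF bounded_linear_minus[OF bounded_linear_ident]]
lemmas smooth_near_of_real = smooth_near_linear[OF bounded_linear_of_real]
lemmas smooth_near_Re = smooth_near_linear[OF bounded_linear_Re]
lemmas smooth_near_Im = smooth_near_linear[OF bounded_linear_Im]
lemmas smooth_near_nth = smooth_near_linear[OF bounded_linear_vec_nth]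

lemma smooth_near_diff:
  "smooth_near c p f \<Longrightarrow> smooth_near c p h \<Longrightarrow> smooth_near c p (\<lambda>q. f q - h q)"
  using smooth_near_add[of c p f "\<lambda>q. - h q"] smooth_near_minus[of c p h] by simp

lemma smooth_near_power:
  fixes f :: "'a \<Rightarrow> 'b::real_normed_algebra_1"
  shows "smooth_near c p f \<Longrightarrow> smooth_near c p (\<lambda>q. f q ^ n)"
  by (induction n) (simp_all add: smooth_near_const smooth_near_mult)

lemma smooth_near_sum_2:
  assumes "\<And>i. smooth_near c p (\<lambda>q. F i q)"
  shows "smooth_near c p (\<lambda>q. \<Sum>i\<in>(UNIV::2 set). F i q)"
  unfolding sum_2 by (rule smooth_near_add[OF assms assms])

lemmas smooth_near_intros = smooth_near_const smooth_near_add smooth_near_diff smooth_near_minus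
  smooth_near_mult smooth_near_scaleR smooth_near_power smooth_near_of_real smooth_near_Re
  smooth_near_Im smooth_near_sum_2

lemma smooth_near_vec:
  fixes f :: "'a \<Rightarrow> 'b::real_normed_vector^2"
  assumes "\<And>i. smooth_near c p (\<lambda>q. f q $ i)"
  shows "smooth_near c p f"
proof -
  have linear: "bounded_linear (axis i :: 'b \<Rightarrow> 'b^2)" for i
  proof (rule bounded_linear_intro[where K = 1])
    show "norm (axis i x :: 'b^2) \<le> norm x * 1" for x
      using exhaust_2[of i] by (auto simp: norm_vec_def L2_set_def sum_2 axis_def)
  qed (simp_all add: vec_eq_iff axis_def)
  have "smooth_near c p (\<lambda>q. \<Sum>i\<in>UNIV. axis i (f q $ i))"
    by (rule smooth_near_sum_2) (rule smooth_near_linear[OF linear assms])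
  moreover have "(\<Sum>i\<in>UNIV. axis i (f q $ i)) = f q" for q
    by (simp add: vec_eq_iff forall_2 sum_2 axis_def)
  ultimately show ?thesis by simp
qed

lemma smooth_near_compose:
  fixes f :: "'a \<Rightarrow> 'b::euclidean_space"
  assumes "open T" "smooth_on T h" "smooth_near c p f" "f (param c (coord c p)) \<in> T"
  shows "smooth_near c p (\<lambda>q. h (f q))"
proof -
  obtain S where S: "open S" "coord c p \<in> S" and f: "\<And>k. Ck_on k S (\<lambda>x. f (param c x))"
    using assms(3) unfolding smooth_near_def smooth_on_def o_def by blast
  define S' where "S' = S \<inter> (\<lambda>x. f (param c x)) -` T"
  have "open S'"
    unfolding S'_def using f[of 0] assms(1) S(1) by (auto intro: continuous_open_preimage)
  moreover have "Ck_on k S' (\<lambda>x. h (f (param c x)))" for k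
    by (rule Ck_on_compose[OF \<open>open S'\<close> assms(1) _ Ck_on_subset[OF _ f]])
       (use assms(2) in \<open>auto simp: S'_def smooth_on_def\<close>)
  ultimately show ?thesis
    using S assms(4) unfolding smooth_near_def smooth_on_def o_def
    by (intro exI[of _ S']) (auto simp: S'_def)
qed

lemma pd_has_derivative:
  assumes "((\<lambda>x. f (param c x)) has_derivative f') (at (coord c p))"
  shows "pd c i f p = f' (axis i 1)"
  unfolding pd_def o_def using frechet_derivative_at[OF assms] by simp

lemma smooth_near_has_derivative:
  assumes "smooth_near c p f"
  shows "((\<lambda>x. f (param c x)) has_derivative
    frechet_derivative (\<lambda>x. f (param c x)) (at (coord c p))) (at (coord c p))"
proof -
  obtain S where "coord c p \<in> S" "Ck_on (Suc 0) S (\<lambda>x. f (param c x))"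
    using assms unfolding smooth_near_def smooth_on_def o_def by blast
  then show ?thesis by (simp add: frechet_derivative_works)
qed

lemma pd_const [simp]: "pd c i (\<lambda>q. a) p = 0"
  by (simp add: pd_def o_def)

lemma pd_linear:
  assumes "bounded_linear h" "smooth_near c p f"
  shows "pd c i (\<lambda>q. h (f q)) p = h (pd c i f p)"
  unfolding pd_has_derivative[OF bounded_linear.has_derivative[OF assms(1) smooth_near_has_derivative[OF assms(2)]]]
    pd_has_derivative[OF smooth_near_has_derivative[OF assms(2)]] ..

lemma pd_add:
  assumes "smooth_near c p f" "smooth_near c p h"
  shows "pd c i (\<lambda>q. f q + h q) p = pd c i f p + pd c i h p"
  unfolding pd_has_derivative[OF has_derivative_add[OF assms[THEN smooth_near_has_derivative]]]
    assms[THEN smooth_near_has_derivative, THEN pd_has_derivative] ..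

lemma pd_bilinear:
  assumes "bounded_bilinear b" "smooth_near c p f" "smooth_near c p h" "param c (coord c p) = p"
  shows "pd c i (\<lambda>q. b (f q) (h q)) p = b (f p) (pd c i h p) + b (pd c i f p) (h p)"
  unfolding pd_has_derivative[OF bounded_bilinear.FDERIV[OF assms(1)
        assms(2,3)[THEN smooth_near_has_derivative]]]
    assms(2,3)[THEN smooth_near_has_derivative, THEN pd_has_derivative] assms(4) ..

lemma pd_compose:
  fixes f :: "'a \<Rightarrow> real" and h :: "real \<Rightarrow> real"
  assumes "smooth_near c p f" "param c (coord c p) = p" "(h has_real_derivative h') (at (f p))"
  shows "pd c i (\<lambda>q. h (f q)) p = h' * pd c i f p"
proof -
  have "((\<lambda>x. h (f (param c x))) has_derivative
      (\<lambda>v. h' * frechet_derivative (\<lambda>x. f (param c x)) (at (coord c p)) v)) (at (coord c p))"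
    by (rule has_derivative_compose[OF smooth_near_has_derivative[OF assms(1)]])
       (use assms(2,3) in \<open>simp add: has_field_derivative_def\<close>)
  from pd_has_derivative[OF this] pd_has_derivative[OF smooth_near_has_derivative[OF assms(1)]]
  show ?thesis by simp
qed

locale surface =
  fixes X :: "'a topology" and \<A> :: "'a chart set"
  assumes oriented_surface: "oriented_surface X \<A>"
begin

lemma open_coord_image: "c \<in> \<A> \<Longrightarrow> open (coord c ` cdom c)"
  using oriented_surface unfolding oriented_surface_def by blast

lemma homeo: "c \<in> \<A> \<Longrightarrow> homeomorphic_map (subtopology X (cdom c)) (top_of_set (coord c ` cdom c)) (coord c)"
  using oriented_surface unfolding oriented_surface_def by blast

lemma openin_cdom: "c \<in> \<A> \<Longrightarrow> openin X (cdom c)"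
  using oriented_surface unfolding oriented_surface_def by blast

lemma param_coord: "in_chart \<A> c p \<Longrightarrow> param c (coord c p) = p"
proof -
  assume "in_chart \<A> c p"
  then have c: "c \<in> \<A>" "p \<in> cdom c" by (auto simp: in_chart_def)
  have "topspace (subtopology X (cdom c)) = cdom c"
    using openin_subset[OF openin_cdom[OF c(1)]] by auto
  then have "inj_on (coord c) (cdom c)"
    using homeo[OF c(1)] homeomorphic_imp_injective_map by fastforce
  then show ?thesis using c by (simp add: param_def)
qed

lemma coord_param:
  assumes "x \<in> coord c ` cdom c"
  shows "coord c (param c x) = x" "param c x \<in> cdom c"
  using assms by (auto simp: param_def f_inv_into_f inv_into_into)

lemma open_overlap:
  assumes "c \<in> \<A>" "c' \<in> \<A>"
  shows "open (coord c ` (cdom c \<inter> cdom c'))"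
proof -
  have "openin (subtopology X (cdom c)) (cdom c \<inter> cdom c')"
    using openin_cdom[OF assms(2)] by (simp add: openin_subtopology_Int2)
  then have "openin (top_of_set (coord c ` cdom c)) (coord c ` (cdom c \<inter> cdom c'))"
    using homeomorphic_imp_open_map[OF homeo[OF assms(1)]] by (auto simp: open_map_def)
  then show ?thesis
    using open_coord_image[OF assms(1)] openin_open_trans by blast
qed

lemma overlap_nbhd:
  assumes "in_overlap \<A> c c' p"
  shows "coord c p \<in> coord c ` (cdom c \<inter> cdom c')" "open (coord c ` (cdom c \<inter> cdom c'))"
    and "x \<in> coord c ` (cdom c \<inter> cdom c') \<Longrightarrow> in_overlap \<A> c c' (param c x) \<and> coord c (param c x) = x"
proof -
  have c: "c \<in> \<A>" "p \<in> cdom c" "c' \<in> \<A>" "p \<in> cdom c'"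
    using assms by (auto simp: in_overlap_def in_chart_def)
  show "coord c p \<in> coord c ` (cdom c \<inter> cdom c')" "open (coord c ` (cdom c \<inter> cdom c'))"
    using c open_overlap by auto
  assume "x \<in> coord c ` (cdom c \<inter> cdom c')"
  then obtain q where "q \<in> cdom c" "q \<in> cdom c'" "x = coord c q" by blast
  then show "in_overlap \<A> c c' (param c x) \<and> coord c (param c x) = x"
    using c param_coord[of c q] by (simp add: in_overlap_def in_chart_def)
qed

lemma in_overlap_refl: "in_chart \<A> c p \<Longrightarrow> in_overlap \<A> c c p"
  by (simp add: in_overlap_def)

lemma smooth_near_cong:
  assumes "in_overlap \<A> c c' p" "\<And>q. in_overlap \<A> c c' q \<Longrightarrow> f q = h q" "smooth_near c p f"
  shows "smooth_near c p h"
proof -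
  let ?U = "coord c ` (cdom c \<inter> cdom c')"
  obtain S where S: "open S" "coord c p \<in> S" "smooth_on S (f \<circ> param c)"
    using assms(3) unfolding smooth_near_def by blast
  have "Ck_on k (S \<inter> ?U) (h \<circ> param c)" for k
  proof (rule Ck_on_cong[of _ "f \<circ> param c"])
    show "Ck_on k (S \<inter> ?U) (f \<circ> param c)"
      using S(3) unfolding smooth_on_def by (intro Ck_on_subset[of "S \<inter> ?U" S]) auto
    show "(f \<circ> param c) x = (h \<circ> param c) x" if "x \<in> S \<inter> ?U" for x
      using overlap_nbhd(3)[OF assms(1), of x] that assms(2)[of "param c x"] by simp
  qed (use S overlap_nbhd(2)[OF assms(1)] in auto)
  then show ?thesis
    unfolding smooth_near_def smooth_on_def using S overlap_nbhd[OF assms(1)]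
    by (intro exI[of _ "S \<inter> ?U"]) auto
qed

text \<open>Two functions with the same germ have the same derivatives, so \<open>frechet_derivative\<close> chooses from the same set for
both, even if this set is empty.\<close>

lemma pd_eqI:
  assumes "open U" "coord c p \<in> U" "\<And>x. x \<in> U \<Longrightarrow> f (param c x) = k x"
  shows "pd c i f p = frechet_derivative k (at (coord c p)) (axis i 1)"
proof -
  have "((f \<circ> param c) has_derivative D) (at (coord c p)) = (k has_derivative D) (at (coord c p))" for D
  proof
    show "(k has_derivative D) (at (coord c p))" if "((f \<circ> param c) has_derivative D) (at (coord c p))"
      by (rule has_derivative_transform_within_open[OF that assms(1,2)]) (simp add: assms(3))
    show "((f \<circ> param c) has_derivative D) (at (coord c p))" if "(k has_derivative D) (at (coord c p))"
      by (rule has_derivative_transform_within_open[OF that assms(1,2)]) (simp add: assms(3))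
  qed
  then show ?thesis unfolding pd_def frechet_derivative_def by simp
qed

lemma pd_cong:
  assumes "in_overlap \<A> c c' p" "\<And>q. in_overlap \<A> c c' q \<Longrightarrow> f q = h q"
  shows "pd c i f p = pd c i h p"
  unfolding pd_def[of c i h]
  by (rule pd_eqI[OF overlap_nbhd(2,1)[OF assms(1)]])
     (use overlap_nbhd(3)[OF assms(1)] assms(2) in simp)

lemma pd_cong_chart:
  assumes "in_chart \<A> c p" "\<And>q. in_chart \<A> c q \<Longrightarrow> f q = h q"
  shows "pd c i f p = pd c i h p"
  by (rule pd_cong[OF in_overlap_refl]) (use assms in \<open>auto simp: in_overlap_def\<close>)

lemma smooth_in_iff:
  assumes "c \<in> \<A>"
  shows "smooth_in c f \<longleftrightarrow> (\<forall>p\<in>cdom c. smooth_near c p f)"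
proof
  assume "smooth_in c f"
  then show "\<forall>p\<in>cdom c. smooth_near c p f"
    using open_coord_image[OF assms] unfolding smooth_in_def smooth_near_def by blast
next
  assume "\<forall>p\<in>cdom c. smooth_near c p f"
  then show "smooth_in c f"
    unfolding smooth_in_def smooth_near_def smooth_on_def
    by (intro allI Ck_on_local) blast
qed

lemma smooth_in_near: "smooth_in c f \<Longrightarrow> in_chart \<A> c p \<Longrightarrow> smooth_near c p f"
  by (simp add: in_chart_def smooth_in_iff)

lemma smooth_inI: "c \<in> \<A> \<Longrightarrow> (\<And>p. in_chart \<A> c p \<Longrightarrow> smooth_near c p f) \<Longrightarrow> smooth_in c f"
  by (simp add: in_chart_def smooth_in_iff)

lemma smooth_near_pd:
  assumes "smooth_near c p f" "in_chart \<A> c p"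
  shows "smooth_near c p (pd c i f)"
proof -
  let ?U = "coord c ` cdom c"
  obtain S where S: "open S" "coord c p \<in> S" "smooth_on S (f \<circ> param c)"
    using assms(1) unfolding smooth_near_def by blast
  have U: "open ?U" "coord c p \<in> ?U"
    using assms(2) open_coord_image by (auto simp: in_chart_def)
  have "Ck_on k (S \<inter> ?U) (pd c i f \<circ> param c)" for k
  proof (rule Ck_on_cong)
    show "Ck_on k (S \<inter> ?U) (\<lambda>x. frechet_derivative (f \<circ> param c) (at x) (axis i 1))"
    proof (rule Ck_on_subset[of "S \<inter> ?U" S])
      have "Ck_on (Suc k) S (f \<circ> param c)" using S(3) unfolding smooth_on_def by blast
      then show "Ck_on k S (\<lambda>x. frechet_derivative (f \<circ> param c) (at x) (axis i 1))" by simp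
    qed simp
    show "frechet_derivative (f \<circ> param c) (at x) (axis i 1) = (pd c i f \<circ> param c) x"
      if "x \<in> S \<inter> ?U" for x
      using that coord_param(1)[of x c] by (simp add: pd_def)
  qed (use S U in auto)
  then show ?thesis
    unfolding smooth_near_def smooth_on_def using S U by (intro exI[of _ "S \<inter> ?U"]) auto
qed

lemma pd_commute:
  fixes f :: "'a \<Rightarrow> real"
  assumes "smooth_near c p f" "in_chart \<A> c p"
  shows "pd c i (pd c j f) p = pd c j (pd c i f) p"
proof -
  let ?U = "coord c ` cdom c" and ?f = "f \<circ> param c"
  obtain S where S: "open S" "coord c p \<in> S" "smooth_on S ?f"
    using assms(1) unfolding smooth_near_def by blast
  have U: "open ?U" "coord c p \<in> ?U"
    using assms(2) open_coord_image by (auto simp: in_chart_def)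
  have second: "pd c i (pd c j f) p
      = frechet_derivative (\<lambda>x. frechet_derivative ?f (at x) (axis j 1)) (at (coord c p)) (axis i 1)" for i j
    by (rule pd_eqI[OF U]) (simp add: pd_def coord_param(1))
  have "Ck_on 2 S ?f" using S(3) by (simp add: smooth_on_def del: o_apply)
  from second_derivative_commute[OF S(1) this S(2)] show ?thesis unfolding second .
qed

text \<open>The entries of the Jacobian matrix are partial derivatives of coordinate functions, so the rules for
partial derivatives apply to them.\<close>

lemma transition:
  assumes "in_overlap \<A> c c' p"
  shows "smooth_near c p (coord c')" "det (jac c c' p) > 0"
    and "jac c c' p $ a $ i = pd c i (\<lambda>q. coord c' q $ a) p"
proof -
  have c: "c \<in> \<A>" "p \<in> cdom c" "c' \<in> \<A>" "p \<in> cdom c'"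
    using assms by (auto simp: in_overlap_def in_chart_def)
  show "det (jac c c' p) > 0"
    using oriented_surface c unfolding oriented_surface_def by blast
  have "smooth_on (coord c ` (cdom c \<inter> cdom c')) (coord c' \<circ> param c)"
    using oriented_surface c unfolding oriented_surface_def by blast
  then show near: "smooth_near c p (coord c')"
    unfolding smooth_near_def using overlap_nbhd[OF assms] by blast
  show "jac c c' p $ a $ i = pd c i (\<lambda>q. coord c' q $ a) p"
    using pd_linear[OF bounded_linear_vec_nth near, of i a] by (simp add: jac_def matrix_def pd_def)
qed

lemma smooth_near_pd_coord:
  assumes "in_overlap \<A> c c' p"
  shows "smooth_near c p (pd c i (\<lambda>q. coord c' q $ a))"
  apply (rule smooth_near_pd)
  apply (rule smooth_near_nth)
   apply (rule transition(1)[OF assms])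
  using assms by (simp add: in_overlap_def)
lemma smooth_near_jac:
  assumes "in_overlap \<A> c c' p"
  shows "smooth_near c p (\<lambda>q. jac c c' q $ a $ i)"
  apply (rule smooth_near_cong[where f="pd c i (\<lambda>q. coord c' q $ a)", OF assms])
   apply (rule transition(3)[symmetric])
   apply assumption
  by (rule smooth_near_pd_coord[OF assms])
text \<open>Partial derivatives of the Jacobian matrix are second derivatives of the change of coordinates.\<close>

lemma pd_jac_commute:
  assumes "in_overlap \<A> c c' p"
  shows "pd c j (\<lambda>q. jac c c' q $ a $ i) p = pd c i (\<lambda>q. jac c c' q $ a $ j) p"
proof -
  have *: "pd c j (\<lambda>q. jac c c' q $ a $ i) p = pd c j (pd c i (\<lambda>q. coord c' q $ a)) p" for i j
    by (rule pd_cong[OF assms]) (rule transition(3))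
  have i: "in_chart \<A> c p" using assms by (simp add: in_overlap_def)
  show ?thesis unfolding *
    by (rule pd_commute[OF smooth_near_nth[OF transition(1)[OF assms]] i])
qed

lemma chain_rule:
  fixes f :: "'a \<Rightarrow> 'b::real_normed_vector"
  assumes "in_overlap \<A> c c' p" "smooth_near c' p f"
  shows "smooth_near c p f" "pd c i f p = (\<Sum>a\<in>UNIV. jac c c' p $ a $ i *\<^sub>R pd c' a f p)"
proof -
  have in_charts: "in_chart \<A> c p" "in_chart \<A> c' p" using assms(1) by (auto simp: in_overlap_def)
  let ?F = "\<lambda>q. (f \<circ> param c') (coord c' q)"
  have eq: "?F q = f q" if "in_overlap \<A> c c' q" for q
    using that param_coord by (simp add: in_overlap_def)
  have at: "coord c' (param c (coord c p)) = coord c' p" using param_coord in_charts by simp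
  obtain S where S: "open S" "coord c' p \<in> S" "smooth_on S (f \<circ> param c')"
    using assms(2) unfolding smooth_near_def by blast
  have F: "smooth_near c p ?F"
    by (rule smooth_near_compose[OF S(1,3) transition(1)[OF assms(1)]]) (simp add: at S)
  show "smooth_near c p f" by (rule smooth_near_cong[OF assms(1) eq F])
  let ?D = "frechet_derivative (\<lambda>x. f (param c' x)) (at (coord c' p))"
  let ?E = "frechet_derivative (\<lambda>x. coord c' (param c x)) (at (coord c p))"
  have D: "((\<lambda>x. f (param c' x)) has_derivative ?D) (at (coord c' (param c (coord c p))))"
    using smooth_near_has_derivative[OF assms(2)] at by simp
  have "((\<lambda>x. ?F (param c x)) has_derivative (\<lambda>v. ?D (?E v))) (at (coord c p))"
    using has_derivative_compose[OF smooth_near_has_derivative[OF transition(1)[OF assms(1)]] D]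
    by simp
  then have "pd c i ?F p = ?D (?E (axis i 1))" by (rule pd_has_derivative)
  also have "?E (axis i 1) = (\<Sum>a\<in>UNIV. jac c c' p $ a $ i *\<^sub>R axis a 1)"
    by (simp add: jac_def matrix_def vec_eq_iff forall_2 sum_2 axis_def o_def)
  also have "?D \<dots> = (\<Sum>a\<in>UNIV. jac c c' p $ a $ i *\<^sub>R pd c' a f p)"
    using has_derivative_linear[OF D] by (simp add: linear_sum linear_cmul pd_def o_def)
  finally show "pd c i f p = (\<Sum>a\<in>UNIV. jac c c' p $ a $ i *\<^sub>R pd c' a f p)"
    using pd_cong[OF assms(1) eq] by simp
qed

end

section \<open>Metrics in a chart\<close>

lemma matrix_inv_2:
  fixes A :: "real^2^2"
  assumes "det A \<noteq> 0"
  shows "matrix_inv A = (1 / det A) *\<^sub>R vector [vector [A$2$2, - A$1$2], vector [- A$2$1, A$1$1]]"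
    and "A ** matrix_inv A = mat 1"
proof -
  define d where "d = det A"
  define B :: "real^2^2" where "B = (1 / d) *\<^sub>R vector [vector [A$2$2, - A$1$2], vector [- A$2$1, A$1$1]]"
  have d: "A$1$1 * A$2$2 = d + A$1$2 * A$2$1" by (simp add: d_def det_2)
  have AB: "A ** B = mat 1"
    using assms d unfolding B_def d_def[symmetric]
    by (simp add: vec_eq_iff forall_2 matrix_matrix_mult_def sum_2 mat_def vector_2 field_simps)
  then have BA: "B ** A = mat 1" by (simp add: matrix_left_right_inverse)
  have "A ** B = mat 1 \<and> B ** A = mat 1" using AB BA by blast
  then have inv: "A ** matrix_inv A = mat 1 \<and> matrix_inv A ** A = mat 1"
    unfolding matrix_inv_def by (rule someI)
  then show "A ** matrix_inv A = mat 1" ..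
  have "matrix_inv A = (B ** A) ** matrix_inv A" using BA by simp
  also have "\<dots> = B" using inv by (simp add: matrix_mul_assoc[symmetric])
  finally show "matrix_inv A = (1 / det A) *\<^sub>R vector [vector [A$2$2, - A$1$2], vector [- A$2$1, A$1$1]]"
    by (simp add: B_def d_def)
qed

context surface
begin

lemma pd_mult:
  fixes f :: "'a \<Rightarrow> 'b::real_normed_algebra"
  assumes "in_chart \<A> c p" "smooth_near c p f" "smooth_near c p h"
  shows "pd c i (\<lambda>q. f q * h q) p = f p * pd c i h p + pd c i f p * h p"
  by (rule pd_bilinear[OF bounded_bilinear_mult assms(2,3) param_coord[OF assms(1)]])

end

lemma pd_minus: "smooth_near c p f \<Longrightarrow> pd c i (\<lambda>q. - f q) p = - pd c i f p"
  by (rule pd_linear[OF bounded_linear_minus[OF bounded_linear_ident]])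

lemma pd_diff:
  "smooth_near c p f \<Longrightarrow> smooth_near c p h \<Longrightarrow> pd c i (\<lambda>q. f q - h q) p = pd c i f p - pd c i h p"
  using pd_add[of c p f "\<lambda>q. - h q" i] smooth_near_minus[of c p h] pd_minus[of c p h i] by simp

lemmas pd_of_real = pd_linear[OF bounded_linear_of_real]

context surface
begin

lemma metric_at:
  assumes "is_metric \<A> g" "in_chart \<A> c p"
  shows metric_sym: "g c p $ 2 $ 1 = g c p $ 1 $ 2"
    and metric_11_pos: "g c p $ 1 $ 1 > 0"
    and metric_det_pos: "det (g c p) > 0"
proof -
  have "transpose (g c p) = g c p" and pos: "\<And>v. v \<noteq> 0 \<Longrightarrow> v \<bullet> (g c p *v v) > 0"
    using assms unfolding is_metric_def by blast+
  then show sym: "g c p $ 2 $ 1 = g c p $ 1 $ 2"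
    unfolding transpose_def vec_eq_iff by simp
  show 11: "g c p $ 1 $ 1 > 0"
    using pos[of "axis 1 1"] by (simp add: inner_vec_def matrix_vector_mult_def sum_2 axis_def vec_eq_iff forall_2)
  define v :: "real^2" where "v = vector [- g c p $ 1 $ 2, g c p $ 1 $ 1]"
  have "v \<noteq> 0" using 11 by (auto simp: v_def vec_eq_iff forall_2 vector_2)
  from pos[OF this] have "g c p $ 1 $ 1 * det (g c p) > 0"
    by (simp add: v_def inner_vec_def matrix_vector_mult_def sum_2 vector_2 det_2 sym algebra_simps)
  then show "det (g c p) > 0" using 11 by (simp add: zero_less_mult_iff)
qed

lemma metric_smooth:
  assumes "is_metric \<A> g" "in_chart \<A> c p"
  shows "smooth_near c p (\<lambda>q. g c q $ i $ j)"
proof -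
  have "smooth_near c p (g c)"
    using assms by (simp add: is_metric_def in_chart_def smooth_in_iff)
  then show ?thesis by (intro smooth_near_nth)
qed

lemma one_form_smooth:
  assumes "is_one_form \<A> \<theta>" "in_chart \<A> c p"
  shows "smooth_near c p (\<lambda>q. \<theta> c q $ i)"
proof -
  have "smooth_near c p (\<theta> c)"
    using assms by (simp add: is_one_form_def in_chart_def smooth_in_iff)
  then show ?thesis by (intro smooth_near_nth)
qed

lemma smooth_near_powr:
  assumes "smooth_near c p f" "in_chart \<A> c p" "f p > 0"
  shows "smooth_near c p (\<lambda>q. f q powr a :: real)"
  by (rule smooth_near_compose[OF _ smooth_on_powr assms(1)])
     (use assms(2,3) param_coord in auto)

lemma smooth_near_ln:
  assumes "smooth_near c p f" "in_chart \<A> c p" "f p > 0"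
  shows "smooth_near c p (\<lambda>q. ln (f q :: real))"
  by (rule smooth_near_compose[OF _ smooth_on_ln assms(1)])
     (use assms(2,3) param_coord in auto)

lemma smooth_near_exp:
  assumes "smooth_near c p f"
  shows "smooth_near c p (\<lambda>q. exp (f q :: real))"
  by (rule smooth_near_compose[OF _ smooth_on_exp assms]) auto

lemma smooth_near_inverse:
  assumes "smooth_near c p f" "in_chart \<A> c p" "f p > 0"
  shows "smooth_near c p (\<lambda>q. inverse (f q :: real))"
proof -
  have "Ck_on k {0<..} (inverse :: real \<Rightarrow> real)" for k
  proof (rule Ck_on_cong)
    show "Ck_on k {0<..} (\<lambda>x::real. x powr (-1))"
      using smooth_on_powr[of "-1"] unfolding smooth_on_def by blast
  qed (auto simp: powr_minus)
  then have "smooth_on {0<..} (inverse :: real \<Rightarrow> real)" by (simp add: smooth_on_def)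
  from smooth_near_compose[OF _ this assms(1)] show ?thesis
    using assms(2,3) param_coord by auto
qed

lemma smooth_near_sqrt:
  assumes "smooth_near c p f" "in_chart \<A> c p" "f p > 0"
  shows "smooth_near c p (\<lambda>q. sqrt (f q))"
proof -
  have "Ck_on k {0<..} sqrt" for k
    by (rule Ck_on_cong[where f = "\<lambda>x. x powr (1/2)"])
       (use smooth_on_powr in \<open>auto simp: smooth_on_def powr_half_sqrt\<close>)
  then have "smooth_on {0<..} sqrt" by (simp add: smooth_on_def)
  from smooth_near_compose[OF _ this assms(1)] show ?thesis
    using assms(2,3) param_coord by auto
qed

lemma metric_det_smooth:
  assumes "is_metric \<A> g" "in_chart \<A> c p"
  shows "smooth_near c p (\<lambda>q. det (g c q))"
  unfolding det_2 by (intro smooth_near_intros metric_smooth[OF assms])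

lemma metric_inverse:
  assumes "is_metric \<A> g" "in_chart \<A> c p"
  shows "matrix_inv (g c p) $ 1 $ 1 = g c p $ 2 $ 2 / det (g c p)"
    and "matrix_inv (g c p) $ 1 $ 2 = - g c p $ 1 $ 2 / det (g c p)"
    and "matrix_inv (g c p) $ 2 $ 1 = - g c p $ 1 $ 2 / det (g c p)"
    and "matrix_inv (g c p) $ 2 $ 2 = g c p $ 1 $ 1 / det (g c p)"
  using metric_det_pos[OF assms] by (simp_all add: matrix_inv_2 vector_2 metric_sym[OF assms])

lemma metric_inverse_smooth:
  assumes "is_metric \<A> g" "in_chart \<A> c p"
  shows "smooth_near c p (\<lambda>q. matrix_inv (g c q) $ k $ l)"
proof -
  have inv: "smooth_near c p (\<lambda>q. inverse (det (g c q)))"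
    by (rule smooth_near_inverse[OF metric_det_smooth[OF assms] assms(2) metric_det_pos[OF assms]])
  have "smooth_near c p (\<lambda>q. g c q $ i $ j * inverse (det (g c q)))"
    "smooth_near c p (\<lambda>q. - g c q $ i $ j * inverse (det (g c q)))" for i j
    by (intro smooth_near_intros metric_smooth[OF assms] inv)+
  note smooth = this
  have cong: "smooth_near c p f \<Longrightarrow> (\<And>q. in_chart \<A> c q \<Longrightarrow> f q = h q) \<Longrightarrow> smooth_near c p h"
    for f h :: "'a \<Rightarrow> real"
    by (rule smooth_near_cong[OF in_overlap_refl[OF assms(2)]]) (auto simp: in_overlap_def)
  have "smooth_near c p (\<lambda>q. matrix_inv (g c q) $ 1 $ 1)"
    by (rule cong[OF smooth(1)[of 2 2]]) (simp add: metric_inverse[OF assms(1)] divide_inverse)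
  moreover have "smooth_near c p (\<lambda>q. matrix_inv (g c q) $ 1 $ 2)"
    by (rule cong[OF smooth(2)[of 1 2]]) (simp add: metric_inverse[OF assms(1)] divide_inverse)
  moreover have "smooth_near c p (\<lambda>q. matrix_inv (g c q) $ 2 $ 1)"
    by (rule cong[OF smooth(2)[of 1 2]]) (simp add: metric_inverse[OF assms(1)] divide_inverse)
  moreover have "smooth_near c p (\<lambda>q. matrix_inv (g c q) $ 2 $ 2)"
    by (rule cong[OF smooth(1)[of 1 1]]) (simp add: metric_inverse[OF assms(1)] divide_inverse)
  ultimately show ?thesis
    using exhaust_2[of k] exhaust_2[of l] by auto
qed

section \<open>Weyl connections\<close>

text \<open>The coefficients \<open>\<Gamma>\<close> are torsion-free and satisfy \<open>\<nabla>g = 2 t \<otimes> g\<close> at the point \<open>p\<close>. The condition is algebraic in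
\<open>\<Gamma>\<close> and refers to a single point, so that it also makes sense for coefficients carried over from another
chart or another metric.\<close>

definition compatible_at :: "'a chart \<Rightarrow> 'a \<Rightarrow> 'a tensor02 \<Rightarrow> real^2 \<Rightarrow> real^2^2^2 \<Rightarrow> bool" where
  "compatible_at c p g t \<Gamma> \<longleftrightarrow> (\<forall>k i j. \<Gamma> $ k $ i $ j = \<Gamma> $ k $ j $ i) \<and>
     (\<forall>i j k. pd c i (\<lambda>q. g c q $ j $ k) p =
       (\<Sum>l\<in>UNIV. \<Gamma> $ l $ i $ j * g c p $ l $ k) + (\<Sum>l\<in>UNIV. \<Gamma> $ l $ i $ k * g c p $ j $ l)
       + 2 * t $ i * g c p $ j $ k)"

text \<open>The difference of two solutions, with its upper index lowered, is symmetric in the first two indices and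
skew in the last two, and such an array vanishes.\<close>

lemma compatible_unique:
  assumes "is_metric \<A> g" "in_chart \<A> c p" "compatible_at c p g t \<Gamma>" "compatible_at c p g t \<Gamma>'"
  shows "\<Gamma> = \<Gamma>'"
proof -
  define L where "L i j k = (\<Sum>l\<in>UNIV. (\<Gamma> $ l $ i $ j - \<Gamma>' $ l $ i $ j) * g c p $ l $ k)" for i j k
  have gsym: "g c p $ i $ j = g c p $ j $ i" for i j
    using metric_sym[OF assms(1,2)] exhaust_2[of i] exhaust_2[of j] by auto
  have sym: "L i j k = L j i k" for i j k
    using assms(3,4) by (simp add: L_def compatible_at_def)
  have skew: "L i j k = - L i k j" for i j k
    using assms(3,4) gsym[of j] unfolding L_def compatible_at_def
    by (simp add: sum_2 algebra_simps) (smt (verit))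
  have "L i j k = 0" for i j k
    using sym[of i j k] sym[of j k i] sym[of k i j] skew[of i j k] skew[of j k i] skew[of k i j] by linarith
  then have zero: "(\<Gamma> $ 1 $ i $ j - \<Gamma>' $ 1 $ i $ j) * g c p $ 1 $ k
      + (\<Gamma> $ 2 $ i $ j - \<Gamma>' $ 2 $ i $ j) * g c p $ 2 $ k = 0" for i j k
    unfolding L_def sum_2 .
  have "\<Gamma> $ l $ i $ j = \<Gamma>' $ l $ i $ j" for l i j
  proof -
    define x y where "x = \<Gamma> $ 1 $ i $ j - \<Gamma>' $ 1 $ i $ j" and "y = \<Gamma> $ 2 $ i $ j - \<Gamma>' $ 2 $ i $ j"
    have e: "x * g c p $ 1 $ 1 + y * g c p $ 2 $ 1 = 0" "x * g c p $ 1 $ 2 + y * g c p $ 2 $ 2 = 0"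
      using zero[of i j 1] zero[of i j 2] by (simp_all add: x_def y_def)
    have "det (g c p) * x = (x * g c p $ 1 $ 1 + y * g c p $ 2 $ 1) * g c p $ 2 $ 2
        - (x * g c p $ 1 $ 2 + y * g c p $ 2 $ 2) * g c p $ 2 $ 1"
      "det (g c p) * y = (x * g c p $ 1 $ 2 + y * g c p $ 2 $ 2) * g c p $ 1 $ 1
        - (x * g c p $ 1 $ 1 + y * g c p $ 2 $ 1) * g c p $ 1 $ 2"
      by (simp_all add: det_2 algebra_simps)
    then have "det (g c p) * x = 0" "det (g c p) * y = 0" unfolding e by simp_all
    then have "x = 0" "y = 0" using metric_det_pos[OF assms(1,2)] by auto
    then show ?thesis using exhaust_2[of l] by (auto simp: x_def y_def)
  qed
  then show ?thesis by (simp add: vec_eq_iff)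
qed

lemma metric_sym_everywhere:
  assumes "is_metric \<A> g"
  shows "g c p $ i $ j = g c p $ j $ i"
proof (cases "in_chart \<A> c p")
  case True
  then show ?thesis
    using metric_sym[OF assms True] exhaust_2[of i] exhaust_2[of j] by auto
next
  case False
  then have "g c p = 0" using assms unfolding is_metric_def supported_def by blast
  then show ?thesis by simp
qed

lemma weyl_sym:
  assumes "is_metric \<A> g"
  shows "weyl_connection \<A> g \<theta> c p $ k $ i $ j = weyl_connection \<A> g \<theta> c p $ k $ j $ i"
  using metric_sym_everywhere[OF assms, of _ _ i j]
  by (auto simp: weyl_connection_def levi_civita_def algebra_simps)

lemma weyl_compatible:
  assumes "is_metric \<A> g" "in_chart \<A> c p"
  shows "compatible_at c p g (\<theta> c p) (weyl_connection \<A> g \<theta> c p)"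
proof -
  define G where "G = g c p"
  define h where "h = matrix_inv G"
  define W where "W = weyl_connection \<A> g \<theta> c p"
  define dg where "dg i j k = pd c i (\<lambda>q. g c q $ j $ k) p" for i j k
  have dgsym: "dg i j k = dg i k j" for i j k
    unfolding dg_def by (simp add: metric_sym_everywhere[OF assms(1), of _ _ j k])
  have Gsym: "G $ i $ j = G $ j $ i" for i j
    using metric_sym_everywhere[OF assms(1)] by (simp add: G_def)
  have hG: "(\<Sum>l\<in>UNIV. (\<Sum>m\<in>UNIV. h $ l $ m * x m) * G $ l $ k) = x k" for x k
  proof -
    have "det G \<noteq> 0" using metric_det_pos[OF assms] by (simp add: G_def)
    then have "G ** h = mat 1" unfolding h_def by (rule matrix_inv_2)
    then have Gh: "G $ k $ 1 * h $ 1 $ m + G $ k $ 2 * h $ 2 $ m = (if k = m then 1 else 0)" for m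
      by (simp add: vec_eq_iff matrix_matrix_mult_def sum_2 mat_def)
    have "(\<Sum>l\<in>UNIV. (\<Sum>m\<in>UNIV. h $ l $ m * x m) * G $ l $ k)
      = x 1 * (G $ k $ 1 * h $ 1 $ 1 + G $ k $ 2 * h $ 2 $ 1)
        + x 2 * (G $ k $ 1 * h $ 1 $ 2 + G $ k $ 2 * h $ 2 $ 2)"
      by (simp add: sum_2 algebra_simps Gsym[of k])
    then show ?thesis unfolding Gh using exhaust_2[of k] by auto
  qed
  have W: "W $ l $ i $ j = (\<Sum>m\<in>UNIV. h $ l $ m * (dg i j m + dg j i m - dg m i j)) / 2
      + G $ i $ j * (\<Sum>m\<in>UNIV. h $ l $ m * \<theta> c p $ m)
      - \<theta> c p $ i * (if l = j then 1 else 0) - (if l = i then 1 else 0) * \<theta> c p $ j" for l i j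
    using assms(2)
    by (simp add: W_def weyl_connection_def levi_civita_def matrix_vector_mult_def G_def h_def dg_def)
  have delta: "(\<Sum>l\<in>UNIV. (if l = j then 1 else 0) * G $ l $ k) = G $ j $ k" for j k
    using exhaust_2[of j] by (auto simp: sum_2)
  have lower: "(\<Sum>l\<in>UNIV. W $ l $ i $ j * G $ l $ k) = (dg i j k + dg j i k - dg k i j) / 2
      + G $ i $ j * \<theta> c p $ k - \<theta> c p $ i * G $ j $ k - \<theta> c p $ j * G $ i $ k" for i j k
  proof -
    have "(\<Sum>l\<in>UNIV. W $ l $ i $ j * G $ l $ k)
      = (\<Sum>l\<in>UNIV. (\<Sum>m\<in>UNIV. h $ l $ m * (dg i j m + dg j i m - dg m i j)) * G $ l $ k) / 2
        + G $ i $ j * (\<Sum>l\<in>UNIV. (\<Sum>m\<in>UNIV. h $ l $ m * \<theta> c p $ m) * G $ l $ k)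
        - \<theta> c p $ i * (\<Sum>l\<in>UNIV. (if l = j then 1 else 0) * G $ l $ k)
        - \<theta> c p $ j * (\<Sum>l\<in>UNIV. (if l = i then 1 else 0) * G $ l $ k)"
      unfolding W
      by (simp only: sum_2[of "\<lambda>l. F l * G $ l $ k" for F]) (simp add: field_simps)
    then show ?thesis unfolding hG delta .
  qed
  have "dg i j k = (\<Sum>l\<in>UNIV. W $ l $ i $ j * G $ l $ k) + (\<Sum>l\<in>UNIV. W $ l $ i $ k * G $ j $ l)
       + 2 * \<theta> c p $ i * G $ j $ k" for i j k
    unfolding Gsym[of j] lower using dgsym[of i k j] Gsym[of j k] by (simp add: field_simps)
  then show ?thesis
    using weyl_sym[OF assms(1)] unfolding compatible_at_def dg_def G_def W_def by blast
qed

lemma weyl_zero: "weyl_connection \<A> g (\<lambda>c p. 0) = levi_civita \<A> g"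
  by (auto simp: fun_eq_iff weyl_connection_def levi_civita_def vec_eq_iff matrix_vector_mult_def)

lemma levi_civita_smooth:
  assumes "is_metric \<A> g" "in_chart \<A> c p"
  shows "smooth_near c p (\<lambda>q. levi_civita \<A> g c q $ k $ i $ j)"
proof (rule smooth_near_cong[OF in_overlap_refl[OF assms(2)]])
  show "smooth_near c p (\<lambda>q. (\<Sum>l\<in>UNIV. matrix_inv (g c q) $ k $ l *
        (pd c i (\<lambda>q. g c q $ j $ l) q + pd c j (\<lambda>q. g c q $ i $ l) q
          - pd c l (\<lambda>q. g c q $ i $ j) q)) * (1/2))"
    by (intro smooth_near_intros metric_inverse_smooth smooth_near_pd metric_smooth assms)
qed (auto simp: levi_civita_def in_overlap_def)

lemma weyl_smooth:
  assumes "is_metric \<A> g" "is_one_form \<A> \<theta>" "in_chart \<A> c p"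
  shows "smooth_near c p (\<lambda>q. weyl_connection \<A> g \<theta> c q $ k $ i $ j)"
proof (rule smooth_near_cong[OF in_overlap_refl[OF assms(3)]])
  show "smooth_near c p (\<lambda>q. levi_civita \<A> g c q $ k $ i $ j
        + g c q $ i $ j * (\<Sum>l\<in>UNIV. matrix_inv (g c q) $ k $ l * \<theta> c q $ l)
        - \<theta> c q $ i * (if k = j then 1 else 0) - (if k = i then 1 else 0) * \<theta> c q $ j)"
    by (intro smooth_near_intros metric_inverse_smooth metric_smooth levi_civita_smooth
        one_form_smooth assms)
qed (auto simp: weyl_connection_def in_overlap_def matrix_vector_mult_def)

end

lemma pd_sum_2:
  assumes "\<And>a. smooth_near c p (F a)"
  shows "pd c i (\<lambda>q. \<Sum>a\<in>(UNIV::2 set). F a q) p = (\<Sum>a\<in>UNIV. pd c i (F a) p)"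
  unfolding sum_2 by (rule pd_add[OF assms assms])

context surface
begin

lemma metric_transform:
  assumes "is_metric \<A> g" "in_overlap \<A> c c' p"
  shows "g c p $ j $ k = (\<Sum>a\<in>UNIV. \<Sum>b\<in>UNIV. jac c c' p $ a $ j * g c' p $ a $ b * jac c c' p $ b $ k)"
proof -
  have "g c p = transpose (jac c c' p) ** g c' p ** jac c c' p"
    using assms unfolding is_metric_def by blast
  then show ?thesis
    by (simp add: matrix_matrix_mult_def transpose_def sum_2 algebra_simps)
qed

lemma pd_metric_transform:
  assumes "is_metric \<A> g" "in_overlap \<A> c c' p"
  shows "pd c i (\<lambda>q. g c q $ j $ k) p = (\<Sum>a\<in>UNIV. \<Sum>b\<in>UNIV.
      pd c i (\<lambda>q. jac c c' q $ a $ j) p * g c' p $ a $ b * jac c c' p $ b $ k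
      + jac c c' p $ a $ j * (\<Sum>d\<in>UNIV. jac c c' p $ d $ i * pd c' d (\<lambda>q. g c' q $ a $ b) p) * jac c c' p $ b $ k
      + jac c c' p $ a $ j * g c' p $ a $ b * pd c i (\<lambda>q. jac c c' q $ b $ k) p)" (is "_ = ?R")
proof -
  have p: "in_chart \<A> c p" "in_chart \<A> c' p" using assms(2) by (auto simp: in_overlap_def)
  note J = smooth_near_jac[OF assms(2)]
  note G = chain_rule(1)[OF assms(2) metric_smooth[OF assms(1) p(2)]]
  have product: "pd c i (\<lambda>q. jac c c' q $ a $ j * g c' q $ a $ b * jac c c' q $ b $ k) p
      = pd c i (\<lambda>q. jac c c' q $ a $ j) p * g c' p $ a $ b * jac c c' p $ b $ k
      + jac c c' p $ a $ j * (\<Sum>d\<in>UNIV. jac c c' p $ d $ i * pd c' d (\<lambda>q. g c' q $ a $ b) p) * jac c c' p $ b $ k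
      + jac c c' p $ a $ j * g c' p $ a $ b * pd c i (\<lambda>q. jac c c' q $ b $ k) p" for a b
    by (simp only: pd_mult[OF p(1)] smooth_near_mult J G
        chain_rule(2)[OF assms(2) metric_smooth[OF assms(1) p(2)], of i a b] real_scaleR_def)
       (simp add: algebra_simps)
  have "pd c i (\<lambda>q. g c q $ j $ k) p
      = pd c i (\<lambda>q. \<Sum>a\<in>UNIV. \<Sum>b\<in>UNIV. jac c c' q $ a $ j * g c' q $ a $ b * jac c c' q $ b $ k) p"
    by (rule pd_cong[OF assms(2)]) (rule metric_transform[OF assms(1)])
  also have "\<dots> = (\<Sum>a\<in>UNIV. \<Sum>b\<in>UNIV. pd c i (\<lambda>q. jac c c' q $ a $ j * g c' q $ a $ b * jac c c' q $ b $ k) p)"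
    by (simp only: pd_sum_2 smooth_near_sum_2 smooth_near_mult J G)
  also have "\<dots> = ?R" by (simp only: product)
  finally show ?thesis .
qed

lemma one_form_transform:
  assumes "is_one_form \<A> \<theta>" "in_overlap \<A> c c' p"
  shows "\<theta> c p $ i = (\<Sum>d\<in>UNIV. \<theta> c' p $ d * jac c c' p $ d $ i)"
proof -
  have "\<theta> c p = \<theta> c' p v* jac c c' p" using assms unfolding is_one_form_def by blast
  then show ?thesis by (simp add: vector_matrix_mult_def mult.commute)
qed

text \<open>Carrying the coefficients of the chart \<open>c'\<close> over to the chart \<open>c\<close> by the transformation law gives coefficients
\<open>\<Gamma>\<close> that satisfy the compatibility condition in \<open>c\<close>, because \<open>g\<close> and \<open>\<theta>\<close> are tensors. By uniqueness they are
those of the Weyl connection in \<open>c\<close>.\<close>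

lemma weyl_transform:
  assumes g: "is_metric \<A> g" and \<theta>: "is_one_form \<A> \<theta>" and ov: "in_overlap \<A> c c' p"
  shows "(\<Sum>k\<in>UNIV. jac c c' p $ l $ k * weyl_connection \<A> g \<theta> c p $ k $ i $ j) =
        pd c i (\<lambda>q. jac c c' q $ l $ j) p +
        (\<Sum>a\<in>UNIV. \<Sum>b\<in>UNIV. weyl_connection \<A> g \<theta> c' p $ l $ a $ b * jac c c' p $ a $ i * jac c c' p $ b $ j)"
proof -
  define J where "J = jac c c' p"
  define dJ where "dJ i a j = pd c i (\<lambda>q. jac c c' q $ a $ j) p" for i a j
  define W where "W = weyl_connection \<A> g \<theta> c' p"
  define G where "G = g c' p"
  define t where "t = \<theta> c' p"
  define R where "R l i j = dJ i l j + (\<Sum>a\<in>UNIV. \<Sum>b\<in>UNIV. W $ l $ a $ b * J $ a $ i * J $ b $ j)" for l i j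
  have p: "in_chart \<A> c p" "in_chart \<A> c' p" using ov by (auto simp: in_overlap_def)
  have "det J \<noteq> 0" using transition(2)[OF ov] by (simp add: J_def)
  from matrix_inv_2(2)[OF this]
  have JK: "(\<Sum>k\<in>UNIV. J $ l $ k * matrix_inv J $ k $ m) = (if l = m then 1 else 0)" for l m
    by (simp add: vec_eq_iff matrix_matrix_mult_def mat_def)
  \<comment> \<open>the solution of the transformation law for the coefficients in \<open>c\<close>\<close>
  define \<Gamma> :: "real^2^2^2" where "\<Gamma> = (\<chi> k i j. \<Sum>m\<in>UNIV. matrix_inv J $ k $ m * R m i j)"
  have JG: "(\<Sum>k\<in>UNIV. J $ l $ k * \<Gamma> $ k $ i $ j) = R l i j" for l i j
  proof -
    have "(\<Sum>k\<in>UNIV. J $ l $ k * \<Gamma> $ k $ i $ j)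
        = (\<Sum>m\<in>UNIV. (\<Sum>k\<in>UNIV. J $ l $ k * matrix_inv J $ k $ m) * R m i j)"
      by (simp add: \<Gamma>_def sum_2 algebra_simps)
    then show ?thesis unfolding JK using exhaust_2[of l] by (auto simp: sum_2)
  qed
  have dJ: "dJ i l j = dJ j l i" for i l j
    unfolding dJ_def by (rule pd_jac_commute[OF ov])
  have Wsym: "W $ l $ i $ j = W $ l $ j $ i" for l i j
    unfolding W_def by (rule weyl_sym[OF g])
  have Gsym: "G $ i $ j = G $ j $ i" for i j
    unfolding G_def by (rule metric_sym_everywhere[OF g])
  have Rsym: "R l i j = R l j i" for l i j
    unfolding R_def dJ[of i l j] by (simp add: sum_2 algebra_simps Wsym[of l 2 1])
  have dG: "pd c' d (\<lambda>q. g c' q $ a $ b) p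
      = (\<Sum>l\<in>UNIV. W $ l $ d $ a * G $ l $ b) + (\<Sum>l\<in>UNIV. W $ l $ d $ b * G $ a $ l) + 2 * t $ d * G $ a $ b"
    for d a b
    using weyl_compatible[OF g p(2), of \<theta>] unfolding compatible_at_def W_def G_def t_def by blast
  have lower: "(\<Sum>l\<in>UNIV. \<Gamma> $ l $ i $ j * g c p $ l $ k) = (\<Sum>a\<in>UNIV. \<Sum>b\<in>UNIV. R a i j * G $ a $ b * J $ b $ k)"
    for i j k
    unfolding metric_transform[OF g ov] JG[symmetric] G_def[symmetric] J_def[symmetric]
    by (simp add: sum_2 algebra_simps)
  have lower': "(\<Sum>l\<in>UNIV. \<Gamma> $ l $ i $ j * g c p $ k $ l) = (\<Sum>a\<in>UNIV. \<Sum>b\<in>UNIV. R a i j * G $ a $ b * J $ b $ k)"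
    for i j k
    using lower[of i j k] by (simp add: metric_sym_everywhere[OF g, of c p k])
  have "pd c i (\<lambda>q. g c q $ j $ k) p
      = (\<Sum>a\<in>UNIV. \<Sum>b\<in>UNIV. R a i j * G $ a $ b * J $ b $ k)
        + (\<Sum>a\<in>UNIV. \<Sum>b\<in>UNIV. R a i k * G $ a $ b * J $ b $ j)
        + 2 * (\<Sum>d\<in>UNIV. t $ d * J $ d $ i) * (\<Sum>a\<in>UNIV. \<Sum>b\<in>UNIV. J $ a $ j * G $ a $ b * J $ b $ k)" for i j k
    unfolding pd_metric_transform[OF g ov] dG R_def J_def[symmetric] G_def[symmetric] dJ_def[symmetric]
    using Gsym[of 2 1] by (simp add: sum_2 algebra_simps)
  then have "pd c i (\<lambda>q. g c q $ j $ k) p =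
       (\<Sum>l\<in>UNIV. \<Gamma> $ l $ i $ j * g c p $ l $ k) + (\<Sum>l\<in>UNIV. \<Gamma> $ l $ i $ k * g c p $ j $ l)
       + 2 * \<theta> c p $ i * g c p $ j $ k" for i j k
    unfolding lower lower'
    unfolding one_form_transform[OF \<theta> ov] metric_transform[OF g ov]
    unfolding J_def[symmetric] G_def[symmetric] t_def[symmetric] .
  moreover have "\<Gamma> $ k $ i $ j = \<Gamma> $ k $ j $ i" for k i j
    using Rsym by (simp add: \<Gamma>_def)
  ultimately have "compatible_at c p g (\<theta> c p) \<Gamma>"
    unfolding compatible_at_def by blast
  then have "\<Gamma> = weyl_connection \<A> g \<theta> c p"
    by (rule compatible_unique[OF g p(1) _ weyl_compatible[OF g p(1)]])
  with JG[of l i j] show ?thesis unfolding R_def J_def W_def dJ_def by simp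
qed

lemma weyl_torsion_free:
  assumes g: "is_metric \<A> g" and \<theta>: "is_one_form \<A> \<theta>"
  shows "is_torsion_free_connection \<A> (weyl_connection \<A> g \<theta>)"
  unfolding is_torsion_free_connection_def
proof (intro conjI allI impI ballI)
  show "supported \<A> (weyl_connection \<A> g \<theta>)"
    by (simp add: supported_def weyl_connection_def)
  show "smooth_in c (weyl_connection \<A> g \<theta> c)" if "c \<in> \<A>" for c
    by (rule smooth_inI[OF that]) (intro smooth_near_vec weyl_smooth[OF g \<theta>])
qed (rule weyl_transform[OF g \<theta>] weyl_sym[OF g]; assumption)+

lemma conformal_self:
  assumes "is_metric \<A> g"
  shows "g \<in> conformal_class \<A> g"
proof -
  have "smooth_fun \<A> (\<lambda>p. 0 :: real)"
    unfolding smooth_fun_def by (intro ballI smooth_inI smooth_near_const)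
  then show ?thesis
    unfolding conformal_class_def using assms by (auto intro!: exI[of _ "\<lambda>p. 0"])
qed

lemma smooth_fun_near: "smooth_fun \<A> f \<Longrightarrow> in_chart \<A> c p \<Longrightarrow> smooth_near c p f"
  unfolding smooth_fun_def by (rule smooth_in_near) (auto simp: in_chart_def)

lemma smooth_funI: "(\<And>c p. in_chart \<A> c p \<Longrightarrow> smooth_near c p f) \<Longrightarrow> smooth_fun \<A> f"
  unfolding smooth_fun_def by (blast intro: smooth_inI)

definition exact_form :: "('a \<Rightarrow> real) \<Rightarrow> 'a one_form" where
  "exact_form u c p = (if in_chart \<A> c p then (\<chi> i. pd c i u p) else 0)"

lemma is_one_form_exact:
  assumes "smooth_fun \<A> u"
  shows "is_one_form \<A> (exact_form u)"
  unfolding is_one_form_def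
proof (intro conjI allI impI ballI)
  show "supported \<A> (exact_form u)" by (simp add: supported_def exact_form_def)
  show "smooth_in c (exact_form u c)" if "c \<in> \<A>" for c
  proof (rule smooth_inI[OF that smooth_near_vec])
    fix p i assume p: "in_chart \<A> c p"
    show "smooth_near c p (\<lambda>q. exact_form u c q $ i)"
      by (rule smooth_near_cong[OF in_overlap_refl[OF p] _ smooth_near_pd[OF smooth_fun_near[OF assms p] p]])
         (simp add: exact_form_def in_overlap_def)
  qed
  show "exact_form u c p = exact_form u c' p v* jac c c' p" if "in_overlap \<A> c c' p" for c c' p
  proof -
    have "in_chart \<A> c p" "in_chart \<A> c' p" using that by (auto simp: in_overlap_def)
    then show ?thesis
      using chain_rule(2)[OF that smooth_fun_near[OF assms]]
      by (simp add: exact_form_def vec_eq_iff vector_matrix_mult_def mult.commute)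
  qed
qed

lemma is_one_form_add:
  assumes "is_one_form \<A> \<theta>" "is_one_form \<A> \<eta>"
  shows "is_one_form \<A> (\<lambda>c p. \<theta> c p + \<eta> c p)"
  unfolding is_one_form_def
proof (intro conjI allI impI ballI)
  show "supported \<A> (\<lambda>c p. \<theta> c p + \<eta> c p)"
    using assms by (simp add: is_one_form_def supported_def)
  show "smooth_in c (\<lambda>p. \<theta> c p + \<eta> c p)" if "c \<in> \<A>" for c
  proof (rule smooth_inI[OF that smooth_near_vec])
    fix p i assume p: "in_chart \<A> c p"
    show "smooth_near c p (\<lambda>q. (\<theta> c q + \<eta> c q) $ i)"
      unfolding vector_add_component
      by (intro smooth_near_add one_form_smooth[OF assms(1) p] one_form_smooth[OF assms(2) p])
  qed
  show "\<theta> c p + \<eta> c p = (\<theta> c' p + \<eta> c' p) v* jac c c' p" if "in_overlap \<A> c c' p" for c c' p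
    using one_form_transform[OF assms(1) that] one_form_transform[OF assms(2) that]
    by (simp add: vec_eq_iff vector_matrix_mult_def sum_2 algebra_simps)
qed

text \<open>Differentiating \<open>e\<^sup>2\<^sup>u g\<close> produces the additional term \<open>2 du \<otimes> e\<^sup>2\<^sup>u g\<close>, so the Weyl connection of \<open>(g,\<theta>)\<close> is
compatible with the new metric and \<open>\<theta> + du\<close>.\<close>

lemma weyl_conformal:
  assumes g: "is_metric \<A> g" and g': "is_metric \<A> g'" and u: "smooth_fun \<A> u"
    and conf: "\<And>c p. in_chart \<A> c p \<Longrightarrow> g' c p = exp (2 * u p) *\<^sub>R g c p"
  shows "weyl_connection \<A> g' (\<lambda>c p. \<theta> c p + exact_form u c p) = weyl_connection \<A> g \<theta>"
proof (intro ext)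
  fix c p
  show "weyl_connection \<A> g' (\<lambda>c p. \<theta> c p + exact_form u c p) c p = weyl_connection \<A> g \<theta> c p"
  proof (cases "in_chart \<A> c p")
    case p: True
    define W where "W = weyl_connection \<A> g \<theta> c p"
    have W: "pd c i (\<lambda>q. g c q $ j $ k) p =
       (\<Sum>l\<in>UNIV. W $ l $ i $ j * g c p $ l $ k) + (\<Sum>l\<in>UNIV. W $ l $ i $ k * g c p $ j $ l)
       + 2 * \<theta> c p $ i * g c p $ j $ k" for i j k
      using weyl_compatible[OF g p, of \<theta>] unfolding compatible_at_def W_def by blast
    have su: "smooth_near c p u" by (rule smooth_fun_near[OF u p])
    have se: "smooth_near c p (\<lambda>q. exp (2 * u q))"
      by (intro smooth_near_exp smooth_near_mult smooth_near_const su)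
    have "pd c i (\<lambda>q. exp (2 * u q)) p = 2 * exp (2 * u p) * pd c i u p" for i
      by (rule pd_compose[OF su param_coord[OF p], where h = "\<lambda>x. exp (2 * x)"])
         (auto intro!: derivative_eq_intros)
    moreover have "pd c i (\<lambda>q. g' c q $ j $ k) p = pd c i (\<lambda>q. exp (2 * u q) * g c q $ j $ k) p" for i j k
      by (rule pd_cong_chart[OF p]) (simp add: conf)
    ultimately have dg': "pd c i (\<lambda>q. g' c q $ j $ k) p = exp (2 * u p) * pd c i (\<lambda>q. g c q $ j $ k) p
        + 2 * exp (2 * u p) * pd c i u p * g c p $ j $ k" for i j k
      using pd_mult[OF p se metric_smooth[OF g p]] by simp
    have "compatible_at c p g' (\<theta> c p + exact_form u c p) W"
      unfolding compatible_at_def dg' W conf[OF p]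
      using weyl_sym[OF g, of \<theta> c p] p by (simp add: W_def exact_form_def sum_2 algebra_simps)
    then show ?thesis
      unfolding W_def
      using compatible_unique[OF g' p weyl_compatible[OF g' p, of "\<lambda>c p. \<theta> c p + exact_form u c p"]]
      by blast
  qed (simp add: weyl_connection_def)
qed

text \<open>A conformal connection is compatible with some metric of the class; passing from this metric to \<open>g\<close> changes only the
1-form.\<close>

lemma conformal_connection_iff:
  assumes g: "is_metric \<A> g"
  shows "is_conformal_connection \<A> (conformal_class \<A> g) \<Gamma> \<longleftrightarrow>
    (\<exists>\<theta>. is_one_form \<A> \<theta> \<and> \<Gamma> = weyl_connection \<A> g \<theta>)"
proof
  assume "is_conformal_connection \<A> (conformal_class \<A> g) \<Gamma>"
  then obtain g' \<theta> where tf: "is_torsion_free_connection \<A> \<Gamma>" and g': "g' \<in> conformal_class \<A> g"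
    and \<theta>: "is_one_form \<A> \<theta>" and comp: "\<And>c p i j k. in_chart \<A> c p \<Longrightarrow>
        pd c i (\<lambda>q. g' c q $ j $ k) p
          - (\<Sum>l\<in>UNIV. \<Gamma> c p $ l $ i $ j * g' c p $ l $ k)
          - (\<Sum>l\<in>UNIV. \<Gamma> c p $ l $ i $ k * g' c p $ j $ l)
        = 2 * \<theta> c p $ i * g' c p $ j $ k"
    unfolding is_conformal_connection_def by blast
  from g' obtain u where m': "is_metric \<A> g'" and u: "smooth_fun \<A> u"
    and conf: "\<And>c p. in_chart \<A> c p \<Longrightarrow> g' c p = exp (2 * u p) *\<^sub>R g c p"
    unfolding conformal_class_def by blast
  have "\<Gamma> c p = weyl_connection \<A> g' \<theta> c p" for c p
  proof (cases "in_chart \<A> c p")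
    case True
    have "compatible_at c p g' (\<theta> c p) (\<Gamma> c p)"
      unfolding compatible_at_def
    proof (intro conjI allI)
      show "\<Gamma> c p $ k $ i $ j = \<Gamma> c p $ k $ j $ i" for k i j
        using tf unfolding is_torsion_free_connection_def by blast
    qed (use comp[OF True] in \<open>simp add: field_simps\<close>)
    then show ?thesis
      by (rule compatible_unique[OF m' True _ weyl_compatible[OF m' True]])
  next
    case False
    then have "\<Gamma> c p = 0"
      using tf unfolding is_torsion_free_connection_def supported_def by blast
    with False show ?thesis by (simp add: weyl_connection_def)
  qed
  then have \<Gamma>: "\<Gamma> = weyl_connection \<A> g' \<theta>" by blast
  define v where "v = (\<lambda>p. - u p)"
  have v: "smooth_fun \<A> v"
    unfolding v_def by (intro smooth_funI smooth_near_minus smooth_fun_near[OF u])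
  have conf': "g c p = exp (2 * v p) *\<^sub>R g' c p" if "in_chart \<A> c p" for c p
    using conf[OF that] by (simp add: v_def exp_minus)
  from weyl_conformal[OF m' g v conf'] have "\<Gamma> = weyl_connection \<A> g (\<lambda>c p. \<theta> c p + exact_form v c p)"
    unfolding \<Gamma> by simp
  then show "\<exists>\<theta>. is_one_form \<A> \<theta> \<and> \<Gamma> = weyl_connection \<A> g \<theta>"
    using is_one_form_add[OF \<theta> is_one_form_exact[OF v]] by blast
next
  assume "\<exists>\<theta>. is_one_form \<A> \<theta> \<and> \<Gamma> = weyl_connection \<A> g \<theta>"
  then obtain \<theta> where \<theta>: "is_one_form \<A> \<theta>" and \<Gamma>: "\<Gamma> = weyl_connection \<A> g \<theta>" by blast
  have "pd c i (\<lambda>q. g c q $ j $ k) p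
          - (\<Sum>l\<in>UNIV. \<Gamma> c p $ l $ i $ j * g c p $ l $ k)
          - (\<Sum>l\<in>UNIV. \<Gamma> c p $ l $ i $ k * g c p $ j $ l)
        = 2 * \<theta> c p $ i * g c p $ j $ k" if "in_chart \<A> c p" for c p i j k
    using weyl_compatible[OF g that, of \<theta>] unfolding compatible_at_def \<Gamma> by simp
  then show "is_conformal_connection \<A> (conformal_class \<A> g) \<Gamma>"
    using weyl_torsion_free[OF g \<theta>] conformal_self[OF g] \<theta>
    unfolding is_conformal_connection_def \<Gamma> by blast
qed

end

section \<open>Ricci curvature of Weyl connections\<close>

text \<open>In dimension two the whole curvature is the endomorphism \<open>R(\<partial>\<^sub>1,\<partial>\<^sub>2)\<close>, and the Ricci tensor consists of its rows,
interchanged and with one sign.\<close>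

lemma ricci_2:
  "ricci \<Gamma> c p $ 1 $ k = - curvature \<Gamma> c p 2 k 1 2"
  "ricci \<Gamma> c p $ 2 $ k = curvature \<Gamma> c p 1 k 1 2"
  by (simp_all add: ricci_def curvature_def sum_2)

context surface
begin

lemma rot_entries:
  assumes "is_metric \<A> g"
  shows "rot g c p $ 1 $ 1 = - g c p $ 1 $ 2 / sqrt (det (g c p))"
    and "rot g c p $ 1 $ 2 = - g c p $ 2 $ 2 / sqrt (det (g c p))"
    and "rot g c p $ 2 $ 1 = g c p $ 1 $ 1 / sqrt (det (g c p))"
    and "rot g c p $ 2 $ 2 = g c p $ 1 $ 2 / sqrt (det (g c p))"
  by (simp_all add: rot_def vector_2)

lemma sqrt_det:
  assumes "is_metric \<A> g" "in_chart \<A> c p"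
  shows "sqrt (det (g c p)) > 0"
    and "sqrt (det (g c p)) * sqrt (det (g c p)) = g c p $ 1 $ 1 * g c p $ 2 $ 2 - g c p $ 1 $ 2 * g c p $ 1 $ 2"
  using metric_det_pos[OF assms] by (simp_all add: det_2 metric_sym[OF assms])

lemma rot_smooth:
  assumes "is_metric \<A> g" "in_chart \<A> c p"
  shows "smooth_near c p (\<lambda>q. rot g c q $ k $ j)"
proof -
  have inv: "smooth_near c p (\<lambda>q. inverse (sqrt (det (g c q))))"
    by (intro smooth_near_inverse smooth_near_sqrt metric_det_smooth metric_det_pos assms sqrt_det)
  have "smooth_near c p (\<lambda>q. g c q $ i $ j * inverse (sqrt (det (g c q))))"
    "smooth_near c p (\<lambda>q. - g c q $ i $ j * inverse (sqrt (det (g c q))))" for i j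
    by (intro smooth_near_intros metric_smooth[OF assms] inv)+
  then have "smooth_near c p (\<lambda>q. rot g c q $ 1 $ 1)" "smooth_near c p (\<lambda>q. rot g c q $ 1 $ 2)"
    "smooth_near c p (\<lambda>q. rot g c q $ 2 $ 1)" "smooth_near c p (\<lambda>q. rot g c q $ 2 $ 2)"
    unfolding rot_entries[OF assms(1)] divide_inverse by blast+
  then show ?thesis
    using exhaust_2[of k] exhaust_2[of j] by auto
qed

lemma hodge_entry: "hodge g \<theta> c p $ i = - (\<Sum>l\<in>UNIV. \<theta> c p $ l * rot g c p $ l $ i)"
  by (simp add: hodge_def vector_matrix_mult_def mult.commute)

lemma hodge_smooth:
  assumes "is_metric \<A> g" "is_one_form \<A> \<theta>" "in_chart \<A> c p"
  shows "smooth_near c p (\<lambda>q. hodge g \<theta> c q $ i)"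
  unfolding hodge_entry
  by (intro smooth_near_intros rot_smooth one_form_smooth assms)

lemma levi_civita_compatible:
  assumes "is_metric \<A> g" "in_chart \<A> c p"
  shows "pd c i (\<lambda>q. g c q $ j $ k) p =
       (\<Sum>l\<in>UNIV. levi_civita \<A> g c p $ l $ i $ j * g c p $ l $ k)
       + (\<Sum>l\<in>UNIV. levi_civita \<A> g c p $ l $ i $ k * g c p $ j $ l)"
  using weyl_compatible[OF assms, of "\<lambda>c p. 0"] unfolding compatible_at_def weyl_zero by simp

text \<open>\<open>J\<close> is parallel for the Levi-Civita connection: \<open>sqrt (det g) J\<close> has the entries of \<open>g\<close> up to sign and order,
and the logarithmic derivative of \<open>sqrt (det g)\<close> is the trace of the connection.\<close>

lemma rot_parallel:
  assumes g: "is_metric \<A> g" and p: "in_chart \<A> c p"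
  shows "pd c i (\<lambda>q. rot g c q $ k $ j) p =
    (\<Sum>l\<in>UNIV. rot g c p $ k $ l * levi_civita \<A> g c p $ l $ i $ j)
    - (\<Sum>l\<in>UNIV. levi_civita \<A> g c p $ k $ i $ l * rot g c p $ l $ j)"
proof -
  define s where "s q = sqrt (det (g c q))" for q
  define L where "L = levi_civita \<A> g c p"
  define J where "J = rot g c p"
  have s: "s p > 0" using sqrt_det(1)[OF g p] by (simp add: s_def)
  have ss: "smooth_near c p s"
    unfolding s_def by (intro smooth_near_sqrt metric_det_smooth metric_det_pos g p)
  note sg = metric_smooth[OF g p] and sJ = rot_smooth[OF g p]
  \<comment> \<open>the metric in terms of \<open>J\<close>, whose derivatives are to be found from those of the metric\<close>
  have G: "g c q $ 1 $ 1 = rot g c q $ 2 $ 1 * s q" "g c q $ 1 $ 2 = rot g c q $ 2 $ 2 * s q"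
     "g c q $ 2 $ 1 = - (rot g c q $ 1 $ 1 * s q)" "g c q $ 2 $ 2 = - (rot g c q $ 1 $ 2 * s q)"
     "rot g c q $ 1 $ 1 = - (rot g c q $ 2 $ 2)"
    if "in_chart \<A> c q" for q
    using sqrt_det(1)[OF g that] by (simp_all add: rot_entries[OF g] s_def metric_sym[OF g that])
  have dg: "pd c i (\<lambda>q. g c q $ j $ k) p =
       (\<Sum>l\<in>UNIV. L $ l $ i $ j * g c p $ l $ k) + (\<Sum>l\<in>UNIV. L $ l $ i $ k * g c p $ j $ l)" for j k
    unfolding L_def by (rule levi_civita_compatible[OF g p])
  have JJ: "J $ 1 $ 1 = - (J $ 2 $ 2)" unfolding J_def by (rule G(5)[OF p])
  have ds: "pd c i s p = (L $ 1 $ i $ 1 + L $ 2 $ i $ 2) * s p"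
  proof -
    have "pd c i (\<lambda>q. s q * s q) p
        = pd c i (\<lambda>q. g c q $ 1 $ 1 * g c q $ 2 $ 2 - g c q $ 1 $ 2 * g c q $ 1 $ 2) p"
      by (rule pd_cong_chart[OF p]) (simp only: s_def sqrt_det(2)[OF g])
    then have "2 * s p * pd c i s p = g c p $ 1 $ 1 * pd c i (\<lambda>q. g c q $ 2 $ 2) p
        + pd c i (\<lambda>q. g c q $ 1 $ 1) p * g c p $ 2 $ 2 - 2 * g c p $ 1 $ 2 * pd c i (\<lambda>q. g c q $ 1 $ 2) p"
      by (simp add: pd_mult[OF p] pd_diff smooth_near_mult sg ss)
    also have "\<dots> = 2 * (L $ 1 $ i $ 1 + L $ 2 $ i $ 2) * (g c p $ 1 $ 1 * g c p $ 2 $ 2 - g c p $ 1 $ 2 * g c p $ 1 $ 2)"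
      unfolding dg by (simp add: sum_2 metric_sym[OF g p] algebra_simps)
    also have "\<dots> = 2 * (L $ 1 $ i $ 1 + L $ 2 $ i $ 2) * (s p * s p)"
      by (simp only: s_def sqrt_det(2)[OF g p])
    finally have "2 * pd c i s p = 2 * ((L $ 1 $ i $ 1 + L $ 2 $ i $ 2) * s p)" using s by simp
    then show ?thesis by simp
  qed
  have prod: "pd c i (\<lambda>q. rot g c q $ k $ j * s q) p = s p * (pd c i (\<lambda>q. rot g c q $ k $ j) p + J $ k $ j * (L $ 1 $ i $ 1 + L $ 2 $ i $ 2))" for k j
    by (simp add: pd_mult[OF p] sJ ss ds J_def algebra_simps)
  have "s p * (pd c i (\<lambda>q. rot g c q $ k $ j) p + J $ k $ j * (L $ 1 $ i $ 1 + L $ 2 $ i $ 2))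
    = s p * ((\<Sum>l\<in>UNIV. J $ k $ l * L $ l $ i $ j) - (\<Sum>l\<in>UNIV. L $ k $ i $ l * J $ l $ j)
        + J $ k $ j * (L $ 1 $ i $ 1 + L $ 2 $ i $ 2))"
  proof -
    have "pd c i (\<lambda>q. rot g c q $ 2 $ 1 * s q) p = pd c i (\<lambda>q. g c q $ 1 $ 1) p"
      "pd c i (\<lambda>q. rot g c q $ 2 $ 2 * s q) p = pd c i (\<lambda>q. g c q $ 1 $ 2) p"
      by (rule pd_cong_chart[OF p], simp add: G)+
    moreover have "pd c i (\<lambda>q. rot g c q $ 1 $ 1 * s q) p = - pd c i (\<lambda>q. g c q $ 2 $ 1) p"
      "pd c i (\<lambda>q. rot g c q $ 1 $ 2 * s q) p = - pd c i (\<lambda>q. g c q $ 2 $ 2) p"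
      unfolding pd_minus[OF sg, symmetric] by (rule pd_cong_chart[OF p], simp add: G)+
    ultimately show ?thesis
      unfolding prod[symmetric] using exhaust_2[of k] exhaust_2[of j]
      by (auto simp: dg sum_2 G[OF p] J_def[symmetric] JJ algebra_simps)
  qed
  then show ?thesis using s unfolding L_def J_def by simp
qed

text \<open>For fixed \<open>i\<close> the endomorphism \<open>g\<^sub>i \<otimes> \<theta>\<^sup>\<sharp> - \<partial>\<^sub>i \<otimes> \<theta>\<close> is skew with respect to \<open>g\<close>, and in dimension two skew
endomorphisms are multiples of \<open>J\<close>. The multiple is \<open>- \<star>\<theta>(\<partial>\<^sub>i)\<close>.\<close>

lemma weyl_levi_civita:
  assumes g: "is_metric \<A> g" and p: "in_chart \<A> c p"
  shows "weyl_connection \<A> g \<theta> c p $ k $ i $ j = levi_civita \<A> g c p $ k $ i $ j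
    - \<theta> c p $ i * (if k = j then 1 else 0) - hodge g \<theta> c p $ i * rot g c p $ k $ j"
proof -
  define D where "D = det (g c p)"
  have D: "D > 0" "sqrt D * sqrt D = D" using metric_det_pos[OF g p] by (simp_all add: D_def)
  have Dg: "g c p $ 1 $ 1 * g c p $ 2 $ 2 = D + g c p $ 1 $ 2 * g c p $ 1 $ 2"
    by (simp add: D_def det_2 metric_sym[OF g p])
  have "g c p $ i $ j * (matrix_inv (g c p) *v \<theta> c p) $ k - (if k = i then 1 else 0) * \<theta> c p $ j
      = - hodge g \<theta> c p $ i * rot g c p $ k $ j"
  proof -
    define e where "e l m = sqrt D * rot g c p $ l $ m" for l m
    have e: "e 1 1 = - g c p $ 1 $ 2" "e 1 2 = - g c p $ 2 $ 2" "e 2 1 = g c p $ 1 $ 1" "e 2 2 = g c p $ 1 $ 2"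
      using D(1) unfolding D_def e_def by (simp_all add: rot_entries[OF g])
    have ee: "rot g c p $ l $ m * rot g c p $ k $ j = e l m * e k j / D" for l m
    proof -
      have "e l m * e k j = (sqrt D * sqrt D) * (rot g c p $ l $ m * rot g c p $ k $ j)"
        by (simp only: mult_ac e_def)
      note eq = this
      show ?thesis unfolding eq D(2) using D(1) by simp
    qed
    have "- hodge g \<theta> c p $ i * rot g c p $ k $ j
        = \<theta> c p $ 1 * (rot g c p $ 1 $ i * rot g c p $ k $ j) + \<theta> c p $ 2 * (rot g c p $ 2 $ i * rot g c p $ k $ j)"
      by (simp add: hodge_entry sum_2 algebra_simps)
    also have "\<dots> = (\<theta> c p $ 1 * (e 1 i * e k j) + \<theta> c p $ 2 * (e 2 i * e k j)) / D"
      unfolding ee by (simp add: add_divide_distrib)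
    finally have hodge: "- hodge g \<theta> c p $ i * rot g c p $ k $ j
        = (\<theta> c p $ 1 * (e 1 i * e k j) + \<theta> c p $ 2 * (e 2 i * e k j)) / D" .
    have "D * (g c p $ i $ j * (matrix_inv (g c p) *v \<theta> c p) $ k - (if k = i then 1 else 0) * \<theta> c p $ j)
        = \<theta> c p $ 1 * (e 1 i * e k j) + \<theta> c p $ 2 * (e 2 i * e k j)"
      using D(1) Dg exhaust_2[of k] exhaust_2[of i] exhaust_2[of j]
      by (auto simp: matrix_vector_mult_def sum_2 metric_inverse[OF g p] metric_sym[OF g p]
          D_def[symmetric] e) (auto simp: field_simps)
    then show ?thesis unfolding hodge using D(1) by (simp add: field_simps)
  qed
  then show ?thesis using p unfolding weyl_connection_def by simp
qed

text \<open>The correction terms are multiples of the commuting and parallel endomorphisms \<open>Id\<close> and \<open>J\<close>. So their brackets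
vanish and their covariant derivatives only involve the coefficients.\<close>

lemma curvature_weyl:
  assumes g: "is_metric \<A> g" and \<theta>: "is_one_form \<A> \<theta>" and p: "in_chart \<A> c p"
  shows "curvature (weyl_connection \<A> g \<theta>) c p l k 1 2 = curvature (levi_civita \<A> g) c p l k 1 2
    - (pd c 1 (\<lambda>q. \<theta> c q $ 2) p - pd c 2 (\<lambda>q. \<theta> c q $ 1) p) * (if l = k then 1 else 0)
    - (pd c 1 (\<lambda>q. hodge g \<theta> c q $ 2) p - pd c 2 (\<lambda>q. hodge g \<theta> c q $ 1) p) * rot g c p $ l $ k"
proof -
  define L where "L = levi_civita \<A> g c p"
  define J where "J = rot g c p"
  define t h where "t = \<theta> c p" and "h = hodge g \<theta> c p"
  note s = levi_civita_smooth[OF g p] one_form_smooth[OF \<theta> p] hodge_smooth[OF g \<theta> p] rot_smooth[OF g p]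
    smooth_near_const smooth_near_mult smooth_near_diff
  have "pd c i (\<lambda>q. weyl_connection \<A> g \<theta> c q $ l $ j $ k) p
      = pd c i (\<lambda>q. levi_civita \<A> g c q $ l $ j $ k
          - \<theta> c q $ j * (if l = k then 1 else 0) - hodge g \<theta> c q $ j * rot g c q $ l $ k) p" for i j
    by (rule pd_cong_chart[OF p]) (rule weyl_levi_civita[OF g])
  also have "pd c i (\<lambda>q. levi_civita \<A> g c q $ l $ j $ k
          - \<theta> c q $ j * (if l = k then 1 else 0) - hodge g \<theta> c q $ j * rot g c q $ l $ k) p
     = pd c i (\<lambda>q. levi_civita \<A> g c q $ l $ j $ k) p - pd c i (\<lambda>q. \<theta> c q $ j) p * (if l = k then 1 else 0)
        - pd c i (\<lambda>q. hodge g \<theta> c q $ j) p * J $ l $ k - h $ j * pd c i (\<lambda>q. rot g c q $ l $ k) p" for i j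
    by (simp add: pd_diff pd_mult[OF p] s J_def h_def)
  finally have dW: "pd c i (\<lambda>q. weyl_connection \<A> g \<theta> c q $ l $ j $ k) p
     = pd c i (\<lambda>q. levi_civita \<A> g c q $ l $ j $ k) p - pd c i (\<lambda>q. \<theta> c q $ j) p * (if l = k then 1 else 0)
        - pd c i (\<lambda>q. hodge g \<theta> c q $ j) p * J $ l $ k - h $ j * pd c i (\<lambda>q. rot g c q $ l $ k) p" for i j .
  show ?thesis
    unfolding curvature_def dW rot_parallel[OF g p] weyl_levi_civita[OF g p]
    unfolding L_def[symmetric] J_def[symmetric] t_def[symmetric] h_def[symmetric]
    using exhaust_2[of k] exhaust_2[of l] by (auto simp: sum_2 algebra_simps)
qed

text \<open>Differentiate \<open>\<nabla>g = 0\<close> once more and use that the second derivatives of \<open>g\<close> commute.\<close>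

lemma curvature_skew:
  assumes g: "is_metric \<A> g" and p: "in_chart \<A> c p"
  shows "(\<Sum>l\<in>UNIV. g c p $ k $ l * curvature (levi_civita \<A> g) c p l j 1 2)
    = - (\<Sum>l\<in>UNIV. g c p $ j $ l * curvature (levi_civita \<A> g) c p l k 1 2)"
proof -
  define L where "L = levi_civita \<A> g c p"
  define dL where "dL e l i j = pd c e (\<lambda>q. levi_civita \<A> g c q $ l $ i $ j) p" for e l i j
  define G where "G = g c p"
  have dg: "pd c e (\<lambda>q. g c q $ j $ k) p =
       (\<Sum>l\<in>UNIV. L $ l $ e $ j * G $ l $ k) + (\<Sum>l\<in>UNIV. L $ l $ e $ k * G $ j $ l)" for e j k
    unfolding L_def G_def by (rule levi_civita_compatible[OF g p])
  note s = levi_civita_smooth[OF g p] metric_smooth[OF g p] smooth_near_mult smooth_near_sum_2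
  have "pd c e (pd c i (\<lambda>q. g c q $ j $ k)) p
      = pd c e (\<lambda>q. (\<Sum>l\<in>UNIV. levi_civita \<A> g c q $ l $ i $ j * g c q $ l $ k)
       + (\<Sum>l\<in>UNIV. levi_civita \<A> g c q $ l $ i $ k * g c q $ j $ l)) p" for e i
    by (rule pd_cong_chart[OF p]) (rule levi_civita_compatible[OF g])
  also have "pd c e (\<lambda>q. (\<Sum>l\<in>UNIV. levi_civita \<A> g c q $ l $ i $ j * g c q $ l $ k)
       + (\<Sum>l\<in>UNIV. levi_civita \<A> g c q $ l $ i $ k * g c q $ j $ l)) p
     = (\<Sum>l\<in>UNIV. L $ l $ i $ j * pd c e (\<lambda>q. g c q $ l $ k) p + dL e l i j * G $ l $ k)
       + (\<Sum>l\<in>UNIV. L $ l $ i $ k * pd c e (\<lambda>q. g c q $ j $ l) p + dL e l i k * G $ j $ l)" for e i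
    by (simp only: pd_add pd_sum_2 pd_mult[OF p] s) (simp add: L_def dL_def G_def)
  finally have second: "pd c e (pd c i (\<lambda>q. g c q $ j $ k)) p
     = (\<Sum>l\<in>UNIV. L $ l $ i $ j * pd c e (\<lambda>q. g c q $ l $ k) p + dL e l i j * G $ l $ k)
       + (\<Sum>l\<in>UNIV. L $ l $ i $ k * pd c e (\<lambda>q. g c q $ j $ l) p + dL e l i k * G $ j $ l)" for e i .
  have "pd c 1 (pd c 2 (\<lambda>q. g c q $ j $ k)) p = pd c 2 (pd c 1 (\<lambda>q. g c q $ j $ k)) p"
    by (rule pd_commute[OF metric_smooth[OF g p] p])
  then show ?thesis
    unfolding second dg curvature_def dL_def[symmetric] L_def[symmetric] G_def[symmetric]
    using metric_sym_everywhere[OF g, of c p 2 1] exhaust_2[of j] exhaust_2[of k]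
    unfolding G_def[symmetric] by (auto simp: sum_2 algebra_simps)
qed

text \<open>By skewness \<open>R(\<partial>\<^sub>1,\<partial>\<^sub>2)\<close> is \<open>- K sqrt (det g) J\<close> for the Levi-Civita connection. For the Weyl connection the
multiple of \<open>J\<close> changes by \<open>- d\<star>\<theta>\<close>, which is \<open>sqrt (det g) \<delta>\<theta>\<close>, while the multiple \<open>- d\<theta>\<close> of the identity only
contributes to the skew part of the Ricci tensor.\<close>

lemma sym_ricci_weyl:
  assumes g: "is_metric \<A> g" and \<theta>: "is_one_form \<A> \<theta>" and p: "in_chart \<A> c p"
  shows "sym_ricci (weyl_connection \<A> g \<theta>) c p
    = (gauss_curvature \<A> g c p - codifferential g \<theta> c p) *\<^sub>R g c p"
proof -
  define M where "M l k = curvature (levi_civita \<A> g) c p l k 1 2" for l k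
  define E F G where "E = g c p $ 1 $ 1" and "F = g c p $ 1 $ 2" and "G = g c p $ 2 $ 2"
  define D where "D = det (g c p)"
  define K where "K = gauss_curvature \<A> g c p"
  have F': "g c p $ 2 $ 1 = F" using metric_sym[OF g p] by (simp add: F_def)
  have D: "D > 0" "D = E * G - F * F"
    using metric_det_pos[OF g p] by (simp_all add: D_def det_2 E_def F_def G_def metric_sym[OF g p])
  have KD: "E * M 1 2 + F * M 2 2 = K * D"
  proof -
    have "K = (E * M 1 2 + F * M 2 2) / D"
      by (simp add: K_def gauss_curvature_def M_def D_def sum_2 E_def F')
    then show ?thesis using D(1) by simp
  qed
  have N: "E * M 1 1 + F * M 2 1 = 0" "F * M 1 2 + G * M 2 2 = 0" "F * M 1 1 + G * M 2 1 = - (K * D)"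
    using curvature_skew[OF g p, of 1 1] curvature_skew[OF g p, of 2 2] curvature_skew[OF g p, of 2 1] KD
    by (simp_all add: sum_2 M_def[symmetric] E_def[symmetric] F_def[symmetric] G_def[symmetric] F')
  have "D * M 1 1 = (E * M 1 1 + F * M 2 1) * G - (F * M 1 1 + G * M 2 1) * F"
    "D * M 1 2 = (E * M 1 2 + F * M 2 2) * G - (F * M 1 2 + G * M 2 2) * F"
    "D * M 2 1 = (F * M 1 1 + G * M 2 1) * E - (E * M 1 1 + F * M 2 1) * F"
    "D * M 2 2 = (F * M 1 2 + G * M 2 2) * E - (E * M 1 2 + F * M 2 2) * F"
    unfolding D(2) by (simp_all add: algebra_simps)
  then have "D * M 1 1 = D * (K * F)" "D * M 1 2 = D * (K * G)" "D * M 2 1 = D * (- K * E)" "D * M 2 2 = D * (- K * F)"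
    unfolding N KD by simp_all
  moreover have "D \<noteq> 0" using D(1) by simp
  ultimately have M: "M 1 1 = K * F" "M 1 2 = K * G" "M 2 1 = - K * E" "M 2 2 = - K * F"
    unfolding mult_left_cancel[OF \<open>D \<noteq> 0\<close>] by blast+
  have sq: "sqrt D > 0" using D(1) by simp
  note c = curvature_weyl[OF g \<theta> p, folded M_def, unfolded M]
  show ?thesis
    using sq unfolding K_def[symmetric]
    by (simp add: vec_eq_iff forall_2 sym_ricci_def transpose_def ricci_2 c M
        codifferential_def rot_entries[OF g] F' D_def[symmetric] E_def[symmetric] F_def[symmetric]
        G_def[symmetric] field_simps)
qed

section \<open>Invariance of the curvature under change of chart\<close>

text \<open>Differentiate the transformation law in both directions and subtract: the second derivatives of the
Jacobian matrix cancel, and the law itself removes its first derivatives. The determinant appears because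
\<open>R(\<partial>\<^sub>1,\<partial>\<^sub>2)\<close> is skew in the two coordinate vectors.\<close>

lemma curvature_transform:
  assumes \<Gamma>: "is_torsion_free_connection \<A> \<Gamma>" and ov: "in_overlap \<A> c c' p"
  shows "(\<Sum>k\<in>UNIV. jac c c' p $ m $ k * curvature \<Gamma> c p k j 1 2)
    = det (jac c c' p) * (\<Sum>l\<in>UNIV. curvature \<Gamma> c' p m l 1 2 * jac c c' p $ l $ j)"
proof -
  have p: "in_chart \<A> c p" "in_chart \<A> c' p" using ov by (auto simp: in_overlap_def)
  define J where "J = jac c c' p"
  define dJ where "dJ e a i = pd c e (\<lambda>q. jac c c' q $ a $ i) p" for e a i
  define W W' where "W = \<Gamma> c p" and "W' = \<Gamma> c' p"
  define dW where "dW e l i j = pd c e (\<lambda>q. \<Gamma> c q $ l $ i $ j) p" for e l i j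
  define dW' where "dW' e l i j = pd c' e (\<lambda>q. \<Gamma> c' q $ l $ i $ j) p" for e l i j
  have law: "(\<Sum>k\<in>UNIV. jac c c' q $ l $ k * \<Gamma> c q $ k $ i $ j) = pd c i (\<lambda>q. jac c c' q $ l $ j) q +
        (\<Sum>a\<in>UNIV. \<Sum>b\<in>UNIV. \<Gamma> c' q $ l $ a $ b * jac c c' q $ a $ i * jac c c' q $ b $ j)"
    if "in_overlap \<A> c c' q" for q l i j
    using \<Gamma> that unfolding is_torsion_free_connection_def by blast
  have smooth: "smooth_near c p (\<lambda>q. \<Gamma> c q $ l $ i $ j)" if "in_chart \<A> c p" for c p l i j
  proof -
    have "smooth_in c (\<Gamma> c)"
      using \<Gamma> that unfolding is_torsion_free_connection_def in_chart_def by blast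
    then show ?thesis using that by (intro smooth_near_nth smooth_in_near)
  qed
  note s = smooth_near_jac[OF ov] smooth[OF p(1)] chain_rule(1)[OF ov smooth[OF p(2)]]
    smooth_near_pd[OF smooth_near_jac[OF ov] p(1)] smooth_near_mult smooth_near_sum_2
  have "pd c e (\<lambda>q. \<Sum>k\<in>UNIV. jac c c' q $ l $ k * \<Gamma> c q $ k $ i $ j) p
      = pd c e (\<lambda>q. pd c i (\<lambda>q. jac c c' q $ l $ j) q +
        (\<Sum>a\<in>UNIV. \<Sum>b\<in>UNIV. \<Gamma> c' q $ l $ a $ b * jac c c' q $ a $ i * jac c c' q $ b $ j)) p" for e l i j
    by (rule pd_cong[OF ov]) (rule law)
  moreover have "pd c e (\<lambda>q. \<Sum>k\<in>UNIV. jac c c' q $ l $ k * \<Gamma> c q $ k $ i $ j) p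
      = (\<Sum>k\<in>UNIV. J $ l $ k * dW e k i j + dJ e l k * W $ k $ i $ j)" for e l i j
    by (simp only: pd_sum_2 pd_mult[OF p(1)] s J_def W_def dJ_def dW_def)
  moreover have "pd c e (\<lambda>q. pd c i (\<lambda>q. jac c c' q $ l $ j) q +
        (\<Sum>a\<in>UNIV. \<Sum>b\<in>UNIV. \<Gamma> c' q $ l $ a $ b * jac c c' q $ a $ i * jac c c' q $ b $ j)) p
      = pd c e (pd c i (\<lambda>q. jac c c' q $ l $ j)) p
        + (\<Sum>a\<in>UNIV. \<Sum>b\<in>UNIV. W' $ l $ a $ b * J $ a $ i * dJ e b j
          + (W' $ l $ a $ b * dJ e a i + (\<Sum>d\<in>UNIV. J $ d $ e * dW' d l a b) * J $ a $ i) * J $ b $ j)" for e l i j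
    by (simp only: pd_add pd_sum_2 pd_mult[OF p(1)] s J_def W'_def dJ_def dW'_def
        chain_rule(2)[OF ov smooth[OF p(2)]] real_scaleR_def)
  ultimately have E: "(\<Sum>k\<in>UNIV. J $ l $ k * dW e k i j + dJ e l k * W $ k $ i $ j)
      = pd c e (pd c i (\<lambda>q. jac c c' q $ l $ j)) p
        + (\<Sum>a\<in>UNIV. \<Sum>b\<in>UNIV. W' $ l $ a $ b * J $ a $ i * dJ e b j
          + (W' $ l $ a $ b * dJ e a i + (\<Sum>d\<in>UNIV. J $ d $ e * dW' d l a b) * J $ a $ i) * J $ b $ j)" for e l i j
    by simp
  have comm: "pd c 2 (pd c 1 (\<lambda>q. jac c c' q $ l $ j)) p = pd c 1 (pd c 2 (\<lambda>q. jac c c' q $ l $ j)) p" for l j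
    by (rule pd_commute[OF smooth_near_jac[OF ov] p(1)])
  have dJ: "dJ 2 a 1 = dJ 1 a 2" for a
    unfolding dJ_def by (rule pd_jac_commute[OF ov])
  have law_p: "(\<Sum>k\<in>UNIV. J $ l $ k * W $ k $ i $ j)
      = dJ i l j + (\<Sum>a\<in>UNIV. \<Sum>b\<in>UNIV. W' $ l $ a $ b * J $ a $ i * J $ b $ j)" for l i j
    unfolding J_def W_def W'_def dJ_def by (rule law[OF ov])
  have "(\<Sum>k\<in>UNIV. J $ m $ k * curvature \<Gamma> c p k j 1 2)
      = (\<Sum>k\<in>UNIV. J $ m $ k * (dW 1 k 2 j - dW 2 k 1 j))
        + (\<Sum>a\<in>UNIV. (\<Sum>k\<in>UNIV. J $ m $ k * W $ k $ 1 $ a) * W $ a $ 2 $ j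
          - (\<Sum>k\<in>UNIV. J $ m $ k * W $ k $ 2 $ a) * W $ a $ 1 $ j)"
    unfolding curvature_def dW_def[symmetric] W_def[symmetric] by (simp add: sum_2 algebra_simps)
  also have "\<dots> = (\<Sum>k\<in>UNIV. J $ m $ k * (dW 1 k 2 j - dW 2 k 1 j))
        + (\<Sum>a\<in>UNIV. dJ 1 m a * W $ a $ 2 $ j - dJ 2 m a * W $ a $ 1 $ j)
        + (\<Sum>a\<in>UNIV. \<Sum>b\<in>UNIV. W' $ m $ a $ b * J $ a $ 1 * (\<Sum>k\<in>UNIV. J $ b $ k * W $ k $ 2 $ j)
          - W' $ m $ a $ b * J $ a $ 2 * (\<Sum>k\<in>UNIV. J $ b $ k * W $ k $ 1 $ j))"
    unfolding law_p[of m] by (simp add: sum_2 algebra_simps)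
  also have "\<dots> = det J * (\<Sum>l\<in>UNIV. curvature \<Gamma> c' p m l 1 2 * J $ l $ j)"
    unfolding law_p curvature_def dW'_def[symmetric] W'_def[symmetric]
    using E[of m 1 2 j] E[of m 2 1 j] unfolding comm
    by (simp add: sum_2 det_2 dJ algebra_simps)
  finally show ?thesis unfolding J_def .
qed

text \<open>By Cramer's rule the factor \<open>det J\<close> in the transformation of \<open>R(\<partial>\<^sub>1,\<partial>\<^sub>2)\<close> turns the inverse of \<open>J\<close> into its
adjugate, which interchanging the rows turns into the transpose of \<open>J\<close>.\<close>

lemma ricci_transform:
  assumes "is_torsion_free_connection \<A> \<Gamma>" and ov: "in_overlap \<A> c c' p"
  shows "ricci \<Gamma> c p $ j $ k
    = (\<Sum>a\<in>UNIV. \<Sum>b\<in>UNIV. jac c c' p $ a $ j * ricci \<Gamma> c' p $ a $ b * jac c c' p $ b $ k)"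
proof -
  define J where "J = jac c c' p"
  define M where "M l k = curvature \<Gamma> c p l k 1 2" for l k
  define Y where "Y l k = (\<Sum>b\<in>UNIV. curvature \<Gamma> c' p l b 1 2 * J $ b $ k)" for l k
  have D: "det J \<noteq> 0" using transition(2)[OF ov] by (simp add: J_def)
  have JM: "J $ m $ 1 * M 1 k + J $ m $ 2 * M 2 k = det J * Y m k" for m
    using curvature_transform[OF assms, of m k] by (simp add: J_def M_def Y_def sum_2)
  have "det J * M 1 k = J $ 2 $ 2 * (J $ 1 $ 1 * M 1 k + J $ 1 $ 2 * M 2 k)
      - J $ 1 $ 2 * (J $ 2 $ 1 * M 1 k + J $ 2 $ 2 * M 2 k)"
    "det J * M 2 k = J $ 1 $ 1 * (J $ 2 $ 1 * M 1 k + J $ 2 $ 2 * M 2 k)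
      - J $ 2 $ 1 * (J $ 1 $ 1 * M 1 k + J $ 1 $ 2 * M 2 k)"
    by (simp_all add: det_2 algebra_simps)
  then have "det J * M 1 k = det J * (J $ 2 $ 2 * Y 1 k - J $ 1 $ 2 * Y 2 k)"
    "det J * M 2 k = det J * (J $ 1 $ 1 * Y 2 k - J $ 2 $ 1 * Y 1 k)"
    unfolding JM by (simp_all add: algebra_simps)
  then have "M 1 k = J $ 2 $ 2 * Y 1 k - J $ 1 $ 2 * Y 2 k" "M 2 k = J $ 1 $ 1 * Y 2 k - J $ 2 $ 1 * Y 1 k"
    unfolding mult_left_cancel[OF D] by blast+
  then show ?thesis
    using exhaust_2[of j]
    by (auto simp: ricci_2 sum_2 M_def[symmetric] J_def[symmetric] Y_def algebra_simps)
qed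

lemma sym_ricci_transform:
  assumes "is_torsion_free_connection \<A> \<Gamma>" and "in_overlap \<A> c c' p"
  shows "sym_ricci \<Gamma> c p $ j $ k
    = (\<Sum>a\<in>UNIV. \<Sum>b\<in>UNIV. jac c c' p $ a $ j * sym_ricci \<Gamma> c' p $ a $ b * jac c c' p $ b $ k)"
  unfolding sym_ricci_def vector_scaleR_component vector_add_component transpose_def vec_lambda_beta
    ricci_transform[OF assms]
  by (simp add: sum_2 algebra_simps)

text \<open>Both the symmetric part of the Ricci tensor and \<open>g\<close> are tensors, so the factor between them is a function on the
surface.\<close>

lemma curvature_scalar_invariant:
  assumes g: "is_metric \<A> g" and \<theta>: "is_one_form \<A> \<theta>" and ov: "in_overlap \<A> c c' p"
  shows "gauss_curvature \<A> g c p - codifferential g \<theta> c p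
    = gauss_curvature \<A> g c' p - codifferential g \<theta> c' p" (is "?h = ?h'")
proof -
  have p: "in_chart \<A> c p" "in_chart \<A> c' p" using ov by (auto simp: in_overlap_def)
  have "?h * g c p $ 1 $ 1 = ?h' * g c p $ 1 $ 1"
    using sym_ricci_transform[OF weyl_torsion_free[OF g \<theta>] ov, of 1 1]
    unfolding sym_ricci_weyl[OF g \<theta> p(1)] sym_ricci_weyl[OF g \<theta> p(2)] metric_transform[OF g ov]
      vector_scaleR_component
    by (simp add: sum_2 algebra_simps)
  then show ?thesis using metric_11_pos[OF g p(1)] by simp
qed

lemma curvature_smooth:
  assumes g: "is_metric \<A> g" and \<theta>: "is_one_form \<A> \<theta>" and p: "in_chart \<A> c p"
  shows "smooth_near c p (\<lambda>q. gauss_curvature \<A> g c q - codifferential g \<theta> c q)"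
proof -
  have inv: "smooth_near c p (\<lambda>q. inverse (det (g c q)))" "smooth_near c p (\<lambda>q. inverse (sqrt (det (g c q))))"
    by (intro smooth_near_inverse smooth_near_sqrt metric_det_smooth metric_det_pos g p sqrt_det)+
  have "smooth_near c p (\<lambda>q. gauss_curvature \<A> g c q)"
    unfolding gauss_curvature_def curvature_def divide_inverse
    by (intro smooth_near_mult smooth_near_sum_2 smooth_near_add smooth_near_diff inv smooth_near_pd
        levi_civita_smooth metric_smooth g p)
  moreover have "smooth_near c p (\<lambda>q. codifferential g \<theta> c q)"
    unfolding codifferential_def divide_inverse
    by (intro smooth_near_mult smooth_near_minus smooth_near_diff inv smooth_near_pd hodge_smooth g \<theta> p)
  ultimately show ?thesis by (rule smooth_near_diff)
qed

section \<open>Complex structure and conformal classes\<close>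

lemma rot_square:
  assumes g: "is_metric \<A> g" and p: "in_chart \<A> c p"
  shows "(\<Sum>l\<in>UNIV. rot g c p $ k $ l * rot g c p $ l $ j) = (if k = j then -1 else 0)"
proof -
  define s where "s = sqrt (det (g c p))"
  have s: "s > 0" "s * s = g c p $ 1 $ 1 * g c p $ 2 $ 2 - g c p $ 1 $ 2 * g c p $ 1 $ 2"
    using sqrt_det[OF g p] by (simp_all add: s_def)
  then show ?thesis
    using exhaust_2[of k] exhaust_2[of j]
    by (auto simp: sum_2 rot_entries[OF g] s_def[symmetric] divide_simps)
qed

lemma det_metric_transform:
  assumes g: "is_metric \<A> g" and ov: "in_overlap \<A> c c' p"
  shows "det (g c p) = det (jac c c' p) * det (jac c c' p) * det (g c' p)"
    and "sqrt (det (g c p)) = det (jac c c' p) * sqrt (det (g c' p))"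
proof -
  have "g c p = transpose (jac c c' p) ** g c' p ** jac c c' p"
    using g ov unfolding is_metric_def by blast
  then show det: "det (g c p) = det (jac c c' p) * det (jac c c' p) * det (g c' p)"
    by (simp add: det_mul det_transpose)
  show "sqrt (det (g c p)) = det (jac c c' p) * sqrt (det (g c' p))"
    unfolding det using transition(2)[OF ov] by (simp add: real_sqrt_mult)
qed

text \<open>\<open>sqrt (det g) J\<close> is \<open>g\<close> multiplied by the standard rotation, and conjugating the latter by an orientation preserving
Jacobian matrix multiplies it by the determinant.\<close>

lemma rot_transform:
  assumes g: "is_metric \<A> g" and ov: "in_overlap \<A> c c' p"
  shows "(\<Sum>k\<in>UNIV. jac c c' p $ l $ k * rot g c p $ k $ j) = (\<Sum>k\<in>UNIV. rot g c' p $ l $ k * jac c c' p $ k $ j)"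
proof -
  have p: "in_chart \<A> c p" "in_chart \<A> c' p" using ov by (auto simp: in_overlap_def)
  define J where "J = jac c c' p"
  define s s' where "s = sqrt (det (g c p))" and "s' = sqrt (det (g c' p))"
  have s: "s > 0" "s' > 0" "s = det J * s'"
    unfolding s_def s'_def J_def
    using sqrt_det(1)[OF g p(1)] sqrt_det(1)[OF g p(2)] det_metric_transform(2)[OF g ov] by blast+
  define e e' where "e k j = s * rot g c p $ k $ j" and "e' k j = s' * rot g c' p $ k $ j" for k j
  have e: "e 1 1 = - g c p $ 1 $ 2" "e 1 2 = - g c p $ 2 $ 2" "e 2 1 = g c p $ 1 $ 1" "e 2 2 = g c p $ 1 $ 2"
    "e' 1 1 = - g c' p $ 1 $ 2" "e' 1 2 = - g c' p $ 2 $ 2" "e' 2 1 = g c' p $ 1 $ 1" "e' 2 2 = g c' p $ 1 $ 2"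
    using s(1,2) by (simp_all add: e_def e'_def rot_entries[OF g] s_def[symmetric] s'_def[symmetric])
  have "s * (\<Sum>k\<in>UNIV. J $ l $ k * rot g c p $ k $ j) = (\<Sum>k\<in>UNIV. J $ l $ k * e k j)"
    by (simp add: sum_2 e_def algebra_simps)
  also have "\<dots> = det J * (\<Sum>k\<in>UNIV. e' l k * J $ k $ j)"
    using exhaust_2[of l] exhaust_2[of j]
    by (auto simp: sum_2 e metric_transform[OF g ov] J_def[symmetric] det_2
        metric_sym[OF g p(2)] algebra_simps)
  also have "\<dots> = s * (\<Sum>k\<in>UNIV. rot g c' p $ l $ k * J $ k $ j)"
    unfolding s(3) e'_def by (simp add: sum_2 algebra_simps)
  finally show ?thesis using s(1) by (simp add: J_def)
qed

lemma hodge_transform: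
  assumes g: "is_metric \<A> g" and \<theta>: "is_one_form \<A> \<theta>" and ov: "in_overlap \<A> c c' p"
  shows "hodge g \<theta> c p $ i = (\<Sum>d\<in>UNIV. hodge g \<theta> c' p $ d * jac c c' p $ d $ i)"
proof -
  have "hodge g \<theta> c p $ i
      = - (\<Sum>d\<in>UNIV. \<theta> c' p $ d * (\<Sum>l\<in>UNIV. jac c c' p $ d $ l * rot g c p $ l $ i))"
    unfolding hodge_entry one_form_transform[OF \<theta> ov] by (simp add: sum_2 algebra_simps)
  then show ?thesis
    unfolding rot_transform[OF g ov] hodge_entry by (simp add: sum_2 algebra_simps)
qed

lemma conformal_sym:
  assumes "is_metric \<A> g" "g' \<in> conformal_class \<A> g"
  shows "g \<in> conformal_class \<A> g'"
proof -
  from assms(2) obtain u where u: "smooth_fun \<A> u"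
    and conf: "\<And>c p. in_chart \<A> c p \<Longrightarrow> g' c p = exp (2 * u p) *\<^sub>R g c p"
    unfolding conformal_class_def by blast
  have "smooth_fun \<A> (\<lambda>p. - u p)"
    by (intro smooth_funI smooth_near_minus smooth_fun_near[OF u])
  moreover have "g c p = exp (2 * - u p) *\<^sub>R g' c p" if "in_chart \<A> c p" for c p
    using conf[OF that] by (simp add: exp_minus)
  ultimately show ?thesis
    unfolding conformal_class_def using assms(1) by blast
qed

lemma conformal_trans:
  assumes "g' \<in> conformal_class \<A> g" "g'' \<in> conformal_class \<A> g'"
  shows "g'' \<in> conformal_class \<A> g"
proof -
  from assms(1) obtain u where u: "smooth_fun \<A> u"
    and conf: "\<And>c p. in_chart \<A> c p \<Longrightarrow> g' c p = exp (2 * u p) *\<^sub>R g c p"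
    unfolding conformal_class_def by blast
  from assms(2) obtain v where g'': "is_metric \<A> g''" and v: "smooth_fun \<A> v"
    and conf': "\<And>c p. in_chart \<A> c p \<Longrightarrow> g'' c p = exp (2 * v p) *\<^sub>R g' c p"
    unfolding conformal_class_def by blast
  have "smooth_fun \<A> (\<lambda>p. v p + u p)"
    by (intro smooth_funI smooth_near_add smooth_fun_near[OF u] smooth_fun_near[OF v])
  moreover have "g'' c p = exp (2 * (v p + u p)) *\<^sub>R g c p" if "in_chart \<A> c p" for c p
    using conf[OF that] conf'[OF that] by (simp add: exp_add distrib_left)
  ultimately show ?thesis
    unfolding conformal_class_def using g'' by blast
qed

lemma conformal_class_eq:
  assumes "is_metric \<A> g" "g' \<in> conformal_class \<A> g"
  shows "conformal_class \<A> g' = conformal_class \<A> g"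
  using conformal_trans[OF assms(2)] conformal_trans[OF conformal_sym[OF assms]] by blast

lemma rep_conformal:
  assumes "is_metric \<A> g"
  shows "rep (conformal_class \<A> g) \<in> conformal_class \<A> g"
  unfolding rep_def
  using someI[of "\<lambda>h. h \<in> conformal_class \<A> g", OF conformal_self[OF assms]] .

lemma rot_conformal:
  assumes g: "is_metric \<A> g" and g': "g' \<in> conformal_class \<A> g"
  shows "rot g' = rot g"
proof (intro ext)
  fix c p
  from g' obtain u where m: "is_metric \<A> g'"
    and conf: "\<And>c p. in_chart \<A> c p \<Longrightarrow> g' c p = exp (2 * u p) *\<^sub>R g c p"
    unfolding conformal_class_def by blast
  show "rot g' c p = rot g c p"
  proof (cases "in_chart \<A> c p")
    case True
    have "det (g' c p) = (exp (2 * u p))\<^sup>2 * det (g c p)"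
      by (simp add: det_2 conf[OF True] power2_eq_square algebra_simps)
    then have "sqrt (det (g' c p)) = exp (2 * u p) * sqrt (det (g c p))"
      by (simp add: real_sqrt_mult)
    then show ?thesis
      by (simp add: vec_eq_iff forall_2 rot_entries[OF m] rot_entries[OF g] conf[OF True])
  next
    case False
    then have "g c p = 0" "g' c p = 0" using g m unfolding is_metric_def supported_def by blast+
    then show ?thesis by (simp add: rot_def)
  qed
qed

text \<open>Functions on the charts that agree on overlaps come from a function on the surface. It is arbitrary outside of
the charts.\<close>

lemma glue:
  fixes F :: "'a chart \<Rightarrow> 'a \<Rightarrow> 'b::real_normed_vector"
  assumes "\<And>c p. in_chart \<A> c p \<Longrightarrow> smooth_near c p (F c)"
    and "\<And>c c' p. in_overlap \<A> c c' p \<Longrightarrow> F c p = F c' p"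
  obtains f where "smooth_fun \<A> f" "\<And>c p. in_chart \<A> c p \<Longrightarrow> f p = F c p"
proof -
  define f where "f p = F (SOME c. in_chart \<A> c p) p" for p
  have eq: "f p = F c p" if "in_chart \<A> c p" for c p
  proof -
    have "in_chart \<A> (SOME c. in_chart \<A> c p) p" using that by (rule someI)
    with that show ?thesis unfolding f_def by (intro assms(2)) (simp add: in_overlap_def)
  qed
  have "smooth_near c p f" if p: "in_chart \<A> c p" for c p
    by (rule smooth_near_cong[OF in_overlap_refl[OF p] _ assms(1)[OF p]]) (simp add: eq in_overlap_def)
  with eq show thesis by (intro that[of f] smooth_funI) auto
qed

section \<open>The line bundle\<close>

text \<open>The nowhere vanishing section \<open>(det g)\<^sup>-\<^sup>(\<^sup>m\<^sup>-\<^sup>1\<^sup>)\<^sup>/\<^sup>4\<close> of \<open>L\<^sub>m\<close>. It vanishes off the charts, as required of a section,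
since \<open>g\<close> does and \<open>0 powr a = 0\<close>.\<close>

definition det_frame :: "nat \<Rightarrow> 'a tensor02 \<Rightarrow> 'a L_section" where
  "det_frame m g c p = of_real (det (g c p) powr (- ((real m - 1) / 4)))"

lemma det_frame_nonzero:
  assumes "is_metric \<A> g" "in_chart \<A> c p"
  shows "det_frame m g c p \<noteq> 0"
  using metric_det_pos[OF assms] by (simp add: det_frame_def)

lemma det_frame_smooth:
  assumes "is_metric \<A> g" "in_chart \<A> c p"
  shows "smooth_near c p (det_frame m g c)"
  unfolding det_frame_def
  by (intro smooth_near_of_real smooth_near_powr metric_det_smooth metric_det_pos assms)

text \<open>The determinant of \<open>g\<close> has weight \<open>-2\<close>, so its power \<open>-(m-1)/4\<close> has the weight \<open>(m-1)/2\<close> of \<open>L\<^sub>m\<close>.\<close>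

lemma det_frame_transform:
  assumes g: "is_metric \<A> g" and ov: "in_overlap \<A> c c' p"
  shows "of_real (det (jac c c' p) powr weight m) * det_frame m g c p = det_frame m g c' p"
proof -
  have p: "in_chart \<A> c p" "in_chart \<A> c' p" using ov by (auto simp: in_overlap_def)
  have J: "det (jac c c' p) > 0" by (rule transition(2)[OF ov])
  have "(det (jac c c' p) * det (jac c c' p)) powr (- ((real m - 1) / 4)) = det (jac c c' p) powr (- weight m)"
  proof -
    have "- ((real m - 1) / 4) + - ((real m - 1) / 4) = - weight m" by (simp add: weight_def field_simps)
    then show ?thesis using J by (simp add: powr_mult powr_add[symmetric])
  qed
  then have "det (g c p) powr (- ((real m - 1) / 4))
      = det (jac c c' p) powr (- weight m) * det (g c' p) powr (- ((real m - 1) / 4))"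
    using J metric_det_pos[OF g p(2)] unfolding det_metric_transform(1)[OF g ov] by (simp add: powr_mult)
  then have "det (jac c c' p) powr weight m * det (g c p) powr (- ((real m - 1) / 4))
      = det (g c' p) powr (- ((real m - 1) / 4))"
    using J by (simp add: mult.assoc[symmetric] powr_add[symmetric])
  then show ?thesis unfolding det_frame_def of_real_mult[symmetric] by simp
qed

lemma det_frame_section:
  assumes "is_metric \<A> g"
  shows "det_frame m g \<in> L_sections \<A> m"
proof -
  have "det_frame m g c p = 0" if "\<not> in_chart \<A> c p" for c p
  proof -
    have "g c p = 0" using assms that unfolding is_metric_def supported_def by blast
    then show ?thesis by (simp add: det_frame_def det_2)
  qed
  then show ?thesis
    unfolding L_sections_def supported_def
    using det_frame_transform[OF assms] det_frame_smooth[OF assms] by (blast intro: smooth_inI)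
qed

lemma L_section_smooth:
  assumes "s \<in> L_sections \<A> m" "in_chart \<A> c p"
  shows "smooth_near c p (s c)"
  using assms smooth_in_near unfolding L_sections_def in_chart_def by blast

lemma L_section_transform:
  assumes "s \<in> L_sections \<A> m" "in_overlap \<A> c c' p"
  shows "of_real (det (jac c c' p) powr weight m) * s c p = s c' p"
  using assms unfolding L_sections_def by blast

lemma L_section_zero:
  assumes "s \<in> L_sections \<A> m" "\<not> in_chart \<A> c p"
  shows "s c p = 0"
  using assms unfolding L_sections_def supported_def by blast

lemma L_section_mult:
  assumes "smooth_fun \<A> f" "s \<in> L_sections \<A> m"
  shows "(\<lambda>c p. f p * s c p) \<in> L_sections \<A> m"
  unfolding L_sections_def
proof (intro CollectI conjI allI impI ballI)
  show "supported \<A> (\<lambda>c p. f p * s c p)"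
    using L_section_zero[OF assms(2)] by (simp add: supported_def)
  show "smooth_in c (\<lambda>p. f p * s c p)" if "c \<in> \<A>" for c
    by (intro smooth_inI[OF that] smooth_near_mult smooth_fun_near[OF assms(1)] L_section_smooth[OF assms(2)])
  show "of_real (det (jac c c' p) powr weight m) * (f p * s c p) = f p * s c' p"
    if "in_overlap \<A> c c' p" for c c' p
    using L_section_transform[OF assms(2) that] by (metis mult.left_commute)
qed

lemma L_section_add:
  assumes "s \<in> L_sections \<A> m" "t \<in> L_sections \<A> m"
  shows "(\<lambda>c p. s c p + t c p) \<in> L_sections \<A> m"
  unfolding L_sections_def
proof (intro CollectI conjI allI impI ballI)
  show "supported \<A> (\<lambda>c p. s c p + t c p)"
    using L_section_zero[OF assms(1)] L_section_zero[OF assms(2)] by (simp add: supported_def)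
  show "smooth_in c (\<lambda>p. s c p + t c p)" if "c \<in> \<A>" for c
    by (intro smooth_inI[OF that] smooth_near_add L_section_smooth[OF assms(1)] L_section_smooth[OF assms(2)])
  show "of_real (det (jac c c' p) powr weight m) * (s c p + t c p) = s c' p + t c' p"
    if "in_overlap \<A> c c' p" for c c' p
    using L_section_transform[OF assms(1) that] L_section_transform[OF assms(2) that]
    by (simp add: distrib_left)
qed

lemma L_section_det_frame:
  assumes g: "is_metric \<A> g" and s: "s \<in> L_sections \<A> m"
  obtains f where "smooth_fun \<A> f" "s = (\<lambda>c p. f p * det_frame m g c p)"
proof -
  define F where "F c p = complex_of_real (det (g c p) powr ((real m - 1) / 4)) * s c p" for c p
  have inv: "complex_of_real (det (g c p) powr ((real m - 1) / 4)) * det_frame m g c p = 1"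
    if "in_chart \<A> c p" for c p
    using metric_det_pos[OF g that] by (simp add: det_frame_def powr_minus flip: of_real_mult)
  have smooth: "smooth_near c p (F c)" if "in_chart \<A> c p" for c p
      unfolding F_def
      by (intro smooth_near_mult smooth_near_of_real smooth_near_powr metric_det_smooth metric_det_pos
          g that L_section_smooth[OF s])
  have invariant: "F c p = F c' p" if "in_overlap \<A> c c' p" for c c' p
    proof -
      have p: "in_chart \<A> c p" "in_chart \<A> c' p" using that by (auto simp: in_overlap_def)
      have "F c p * det_frame m g c' p
          = (of_real (det (g c p) powr ((real m - 1) / 4)) * det_frame m g c p)
            * (of_real (det (jac c c' p) powr weight m) * s c p)"
        unfolding F_def det_frame_transform[OF g that, symmetric] by (simp add: mult_ac)
      also have "\<dots> = F c' p * det_frame m g c' p"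
        unfolding inv[OF p(1)] L_section_transform[OF s that] F_def
        using inv[OF p(2)] by (metis mult.assoc mult.commute mult.right_neutral)
      finally show ?thesis using det_frame_nonzero[OF g p(2)] by simp
    qed
  obtain f where f: "smooth_fun \<A> f" and fF: "\<And>c p. in_chart \<A> c p \<Longrightarrow> f p = F c p"
    using glue[of F, OF smooth invariant] by blast
  have "s c p = f p * det_frame m g c p" for c p
  proof (cases "in_chart \<A> c p")
    case True
    then show ?thesis
      using inv[OF True] unfolding fF[OF True] F_def by (metis mult.assoc mult.commute mult.right_neutral)
  next
    case False
    then show ?thesis
      using L_section_zero[OF s] L_section_zero[OF det_frame_section[OF g]] by simp
  qed
  then have "s = (\<lambda>c p. f p * det_frame m g c p)" by (intro ext)
  then show thesis by (rule that[OF f])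
qed

lemma part01_entry: "part01 J \<eta> $ i = (\<eta> $ i + \<i> * (\<Sum>l\<in>UNIV. \<eta> $ l * of_real (J $ l $ i))) / 2"
  by (simp add: part01_def cpull_def)

text \<open>This is \<open>J\<^sup>2 = -1\<close>.\<close>

lemma part01_type01:
  assumes g: "is_metric \<A> g" and p: "in_chart \<A> c p"
  shows "type01 (rot g c p) (part01 (rot g c p) \<eta>)"
proof -
  define J where "J = rot g c p"
  have "complex_of_real (\<Sum>l\<in>UNIV. J $ k $ l * J $ l $ j) = of_real (if k = j then -1 else 0)" for k j
    unfolding J_def rot_square[OF g p] ..
  then have JJ: "complex_of_real (J $ k $ 1) * of_real (J $ 1 $ j)
      = of_real (if k = j then -1 else 0) - of_real (J $ k $ 2) * of_real (J $ 2 $ j)" for k j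
    unfolding sum_2 of_real_add of_real_mult by (simp only: eq_diff_eq)
  have "cpull (part01 J \<eta>) J $ i = (- \<i> *s part01 J \<eta>) $ i" for i
  proof -
    have "cpull (part01 J \<eta>) J $ i
      = (\<Sum>l\<in>UNIV. \<eta> $ l * of_real (J $ l $ i)) / 2
        + \<i> / 2 * (\<Sum>k\<in>UNIV. \<eta> $ k * (\<Sum>l\<in>UNIV. complex_of_real (J $ k $ l) * of_real (J $ l $ i)))"
      by (simp add: cpull_def part01_entry sum_2 field_simps)
    note eq = this
    show ?thesis
      unfolding eq using exhaust_2[of i] by (auto simp: part01_entry sum_2 JJ field_simps)
  qed
  then show ?thesis unfolding type01_def J_def[symmetric] vec_eq_iff by blast
qed

lemma dbar_fun_transform:
  assumes g: "is_metric \<A> g" and f: "smooth_fun \<A> f" and ov: "in_overlap \<A> c c' p"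
  shows "dbar_fun (rot g) c f p = cpull (dbar_fun (rot g) c' f p) (jac c c' p)"
proof -
  have p: "in_chart \<A> c p" "in_chart \<A> c' p" using ov by (auto simp: in_overlap_def)
  define J where "J = jac c c' p"
  have chain: "pd c i f p = (\<Sum>a\<in>UNIV. complex_of_real (J $ a $ i) * pd c' a f p)" for i
    using chain_rule(2)[OF ov smooth_fun_near[OF f p(2)]] by (simp add: J_def scaleR_conv_of_real)
  have "complex_of_real (\<Sum>k\<in>UNIV. J $ l $ k * rot g c p $ k $ j)
      = of_real (\<Sum>k\<in>UNIV. rot g c' p $ l $ k * J $ k $ j)" for l j
    unfolding J_def rot_transform[OF g ov] ..
  then have rot: "complex_of_real (J $ l $ 1) * of_real (rot g c p $ 1 $ j)
      = (\<Sum>k\<in>UNIV. complex_of_real (rot g c' p $ l $ k) * of_real (J $ k $ j))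
        - of_real (J $ l $ 2) * of_real (rot g c p $ 2 $ j)" for l j
    by (simp add: sum_2 algebra_simps)
  have "(\<Sum>l\<in>UNIV. pd c l f p * of_real (rot g c p $ l $ i))
      = (\<Sum>a\<in>UNIV. pd c' a f p * (\<Sum>l\<in>UNIV. complex_of_real (J $ a $ l) * of_real (rot g c p $ l $ i)))" for i
    unfolding chain by (simp add: sum_2 algebra_simps)
  also have "\<dots> i = (\<Sum>a\<in>UNIV. pd c' a f p * (\<Sum>k\<in>UNIV. complex_of_real (rot g c' p $ a $ k) * of_real (J $ k $ i)))" for i
    by (simp only: sum_2[of "\<lambda>l. complex_of_real (J $ a $ l) * F l" for a F] rot) simp
  finally have pull: "(\<Sum>l\<in>UNIV. pd c l f p * of_real (rot g c p $ l $ i))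
    = (\<Sum>a\<in>UNIV. pd c' a f p * (\<Sum>k\<in>UNIV. complex_of_real (rot g c' p $ a $ k) * of_real (J $ k $ i)))" for i .
  have "dbar_fun (rot g) c f p $ i = cpull (dbar_fun (rot g) c' f p) J $ i" for i
    unfolding dbar_fun_def part01_entry vec_lambda_beta cpull_def
    unfolding pull unfolding chain
    by (simp add: sum_2 field_simps)
  then show ?thesis by (simp add: vec_eq_iff J_def)
qed

section \<open>Dolbeault operators and Weyl connections\<close>

text \<open>\<open>J\<close> is trace free, so only the identity part of the correction contributes.\<close>

lemma weyl_trace:
  assumes g: "is_metric \<A> g" and p: "in_chart \<A> c p"
  shows "(\<Sum>l\<in>UNIV. weyl_connection \<A> g \<theta> c p $ l $ i $ l)
    = (\<Sum>l\<in>UNIV. levi_civita \<A> g c p $ l $ i $ l) - 2 * \<theta> c p $ i"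
  by (simp add: weyl_levi_civita[OF g p] sum_2 rot_entries[OF g])

lemma pd_det:
  assumes g: "is_metric \<A> g" and p: "in_chart \<A> c p"
  shows "pd c i (\<lambda>q. det (g c q)) p = 2 * (\<Sum>l\<in>UNIV. levi_civita \<A> g c p $ l $ i $ l) * det (g c p)"
proof -
  note s = metric_smooth[OF g p] smooth_near_mult
  have "pd c i (\<lambda>q. det (g c q)) p = g c p $ 1 $ 1 * pd c i (\<lambda>q. g c q $ 2 $ 2) p
      + pd c i (\<lambda>q. g c q $ 1 $ 1) p * g c p $ 2 $ 2
      - (g c p $ 1 $ 2 * pd c i (\<lambda>q. g c q $ 2 $ 1) p + pd c i (\<lambda>q. g c q $ 1 $ 2) p * g c p $ 2 $ 1)"
    unfolding det_2 by (simp add: pd_diff pd_mult[OF p] s)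
  then show ?thesis
    unfolding levi_civita_compatible[OF g p] by (simp add: det_2 sum_2 metric_sym[OF g p] algebra_simps)
qed

lemma pd_det_frame:
  assumes g: "is_metric \<A> g" and p: "in_chart \<A> c p"
  shows "pd c i (det_frame m g c) p
    = - of_real (weight m * (\<Sum>l\<in>UNIV. levi_civita \<A> g c p $ l $ i $ l)) * det_frame m g c p"
proof -
  define a where "a = - ((real m - 1) / 4)"
  define D where "D = det (g c p)"
  have D: "D > 0" using metric_det_pos[OF g p] by (simp add: D_def)
  have "pd c i (\<lambda>q. det (g c q) powr a) p = (a * D powr (a - 1)) * pd c i (\<lambda>q. det (g c q)) p"
    by (rule pd_compose[OF metric_det_smooth[OF g p] param_coord[OF p]])
       (use has_real_derivative_powr[OF D, of a] in \<open>simp add: D_def\<close>)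
  also have "\<dots> = 2 * a * (\<Sum>l\<in>UNIV. levi_civita \<A> g c p $ l $ i $ l) * (D powr (a - 1) * D)"
    unfolding pd_det[OF g p] D_def by simp
  also have "D powr (a - 1) * D = D powr a"
    using D by (simp add: powr_diff)
  also have "2 * a = - weight m" by (simp add: a_def weight_def)
  finally have "pd c i (\<lambda>q. det (g c q) powr a) p
      = - weight m * (\<Sum>l\<in>UNIV. levi_civita \<A> g c p $ l $ i $ l) * D powr a" .
  moreover have "pd c i (det_frame m g c) p = of_real (pd c i (\<lambda>q. det (g c q) powr a) p)"
    unfolding det_frame_def a_def[symmetric]
    by (intro pd_of_real smooth_near_powr metric_det_smooth metric_det_pos g p)
  ultimately show ?thesis by (simp add: det_frame_def a_def[symmetric] D_def)
qed

lemma induced_connection_det_frame: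
  assumes g: "is_metric \<A> g" and p: "in_chart \<A> c p"
  shows "induced_connection m (weyl_connection \<A> g \<theta>) (det_frame m g) c p $ i
    = - 2 * of_real (weight m * \<theta> c p $ i) * det_frame m g c p"
  by (simp add: induced_connection_def weyl_trace[OF g p] pd_det_frame[OF g p] algebra_simps)

text \<open>The metric \<open>g\<close> makes \<open>(det g)\<^sup>-\<^sup>(\<^sup>m\<^sup>-\<^sup>1\<^sup>)\<^sup>/\<^sup>4\<close> parallel for the Levi-Civita connection, so only \<open>- 2 weight m \<theta>\<close>
survives; its (0,1)-part is as stated, since \<open>\<star>\<theta> = - \<theta> \<circ> J\<close>.\<close>

lemma connection01_det_frame:
  assumes g: "is_metric \<A> g" and p: "in_chart \<A> c p"
  shows "connection01 \<A> m (rot g) (weyl_connection \<A> g \<theta>) (det_frame m g) c p $ i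
    = - of_real (weight m) * (of_real (\<theta> c p $ i) - \<i> * of_real (hodge g \<theta> c p $ i)) * det_frame m g c p"
  using p det_frame_section[OF g]
  by (simp add: connection01_def part01_entry induced_connection_det_frame[OF g p] hodge_entry sum_2
      field_simps)

lemma part01_add: "part01 J (\<eta> + \<zeta>) = part01 J \<eta> + part01 J \<zeta>"
  by (simp add: vec_eq_iff part01_entry sum_2 field_simps)

lemma part01_scale: "part01 J (a *s \<eta>) = a *s part01 J \<eta>"
  by (simp add: vec_eq_iff part01_entry sum_2 field_simps)

lemma induced_connection_mult:
  assumes "smooth_near c p f" "smooth_near c p (s c)" and p: "in_chart \<A> c p"
  shows "induced_connection m \<Gamma> (\<lambda>c p. f p * s c p) c p
    = s c p *s (\<chi> i. pd c i f p) + f p *s induced_connection m \<Gamma> s c p"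
  by (simp add: vec_eq_iff induced_connection_def pd_mult[OF p assms(1,2)] algebra_simps)

lemma connection01_mult:
  assumes f: "smooth_fun \<A> f" and s: "s \<in> L_sections \<A> m" and p: "in_chart \<A> c p"
  shows "connection01 \<A> m j \<Gamma> (\<lambda>c p. f p * s c p) c p
    = s c p *s dbar_fun j c f p + f p *s connection01 \<A> m j \<Gamma> s c p"
  using p s L_section_mult[OF f s]
  by (simp add: connection01_def induced_connection_mult[where s = s, OF smooth_fun_near[OF f p] L_section_smooth[OF s p] p]
      part01_add part01_scale dbar_fun_def)

text \<open>Only the transformation law of the values needs an idea: writing the section as \<open>f s\<close> reduces it to those of
\<open>s\<close>, \<open>\<theta>\<close>, \<open>\<star>\<theta>\<close> and the (0,1)-part of \<open>df\<close>, so that the trace of the connection need not be transformed.\<close>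

lemma connection01_is_dolbeault:
  assumes g: "is_metric \<A> g" and \<theta>: "is_one_form \<A> \<theta>"
  shows "is_dolbeault_operator \<A> m (rot g) (connection01 \<A> m (rot g) (weyl_connection \<A> g \<theta>))"
    (is "is_dolbeault_operator _ _ _ ?D")
  unfolding is_dolbeault_operator_def
proof (intro conjI ballI allI impI)
  have "?D s \<in> L_forms01 \<A> m (rot g)" if s: "s \<in> L_sections \<A> m" for s
    unfolding L_forms01_def
  proof (intro CollectI conjI allI impI ballI)
    show "supported \<A> (?D s)" using s by (simp add: supported_def connection01_def)
    show "type01 (rot g c p) (?D s c p)" if "in_chart \<A> c p" for c p
      using that s part01_type01[OF g that] by (simp add: connection01_def)
    show "smooth_in c (?D s c)" if "c \<in> \<A>" for c
    proof (rule smooth_inI[OF that smooth_near_vec])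
      fix p i assume p: "in_chart \<A> c p"
      let ?I = "\<lambda>q i. pd c i (s c) q + of_real (weight m * (\<Sum>l\<in>UNIV. weyl_connection \<A> g \<theta> c q $ l $ i $ l)) * s c q"
      show "smooth_near c p (\<lambda>q. ?D s c q $ i)"
      proof (rule smooth_near_cong[OF in_overlap_refl[OF p]])
        show "smooth_near c p (\<lambda>q. (?I q i + \<i> * (\<Sum>l\<in>UNIV. ?I q l * of_real (rot g c q $ l $ i))) * (1/2))"
          by (intro smooth_near_add smooth_near_mult smooth_near_sum_2 smooth_near_of_real smooth_near_const
              smooth_near_pd L_section_smooth[OF s] weyl_smooth rot_smooth g \<theta> p)
      qed (use s in \<open>simp add: connection01_def in_overlap_def part01_entry induced_connection_def\<close>)
    qed
    show "of_real (det (jac c c' p) powr weight m) *s ?D s c p = cpull (?D s c' p) (jac c c' p)"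
      if ov: "in_overlap \<A> c c' p" for c c' p
    proof -
      have p: "in_chart \<A> c p" "in_chart \<A> c' p" using ov by (auto simp: in_overlap_def)
      from s obtain f where f: "smooth_fun \<A> f" and sf: "s = (\<lambda>c p. f p * det_frame m g c p)"
        by (rule L_section_det_frame[OF g])
      define J where "J = jac c c' p"
      define \<delta> where "\<delta> = complex_of_real (det J powr weight m)"
      have \<delta>: "det_frame m g c' p = \<delta> * det_frame m g c p"
        using det_frame_transform[OF g ov] by (simp add: \<delta>_def J_def)
      have dbar: "dbar_fun (rot g) c f p $ i = (\<Sum>a\<in>UNIV. dbar_fun (rot g) c' f p $ a * of_real (J $ a $ i))" for i
        unfolding dbar_fun_transform[OF g f ov] by (simp add: cpull_def J_def)
      have "(\<delta> *s ?D s c p) $ i = cpull (?D s c' p) J $ i" for i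
        unfolding sf connection01_mult[OF f det_frame_section[OF g] p(1)]
          connection01_mult[OF f det_frame_section[OF g] p(2)]
          cpull_def vec_lambda_beta vector_add_component vector_smult_component
          connection01_det_frame[OF g p(1)] connection01_det_frame[OF g p(2)]
          one_form_transform[OF \<theta> ov] hodge_transform[OF g \<theta> ov] J_def[symmetric] \<delta> dbar
        by (simp add: sum_2 algebra_simps)
      then show ?thesis by (simp add: vec_eq_iff \<delta>_def J_def)
    qed
  qed
  then show "?D \<in> L_sections \<A> m \<rightarrow>\<^sub>E L_forms01 \<A> m (rot g)"
    by (auto simp: PiE_iff connection01_def extensional_def)
next
  fix s t assume s: "s \<in> L_sections \<A> m" and t: "t \<in> L_sections \<A> m"
  have "?D (\<lambda>c p. s c p + t c p) c p = ?D s c p + ?D t c p" for c p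
  proof (cases "in_chart \<A> c p")
    case p: True
    have "induced_connection m (weyl_connection \<A> g \<theta>) (\<lambda>c p. s c p + t c p) c p
      = induced_connection m (weyl_connection \<A> g \<theta>) s c p + induced_connection m (weyl_connection \<A> g \<theta>) t c p"
      by (simp add: vec_eq_iff induced_connection_def algebra_simps
          pd_add[OF L_section_smooth[OF s p] L_section_smooth[OF t p]])
    then show ?thesis
      using p s t L_section_add[OF s t] by (simp add: connection01_def part01_add)
  next
    case False
    then show ?thesis using s t L_section_add[OF s t] by (simp add: connection01_def)
  qed
  then show "?D (\<lambda>c p. s c p + t c p) = (\<lambda>c p. ?D s c p + ?D t c p)" by (intro ext)
next
  show "?D (\<lambda>c p. f p * s c p) c p = s c p *s dbar_fun (rot g) c f p + f p *s ?D s c p"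
    if "s \<in> L_sections \<A> m" "smooth_fun \<A> f" "in_chart \<A> c p" for s f c p
    by (rule connection01_mult[OF that(2,1,3)])
qed

lemma dolbeault_determined:
  assumes g: "is_metric \<A> g"
    and D: "is_dolbeault_operator \<A> m (rot g) D" and D': "is_dolbeault_operator \<A> m (rot g) D'"
    and eq: "\<And>c p. in_chart \<A> c p \<Longrightarrow> D (det_frame m g) c p = D' (det_frame m g) c p"
  shows "D = D'"
proof
  fix s
  show "D s = D' s"
  proof (cases "s \<in> L_sections \<A> m")
    case s: True
    then obtain f where f: "smooth_fun \<A> f" and sf: "s = (\<lambda>c p. f p * det_frame m g c p)"
      by (rule L_section_det_frame[OF g])
    have "D s c p = D' s c p" for c p
    proof (cases "in_chart \<A> c p")
      case True
      have "E (\<lambda>c p. f p * det_frame m g c p) c p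
          = det_frame m g c p *s dbar_fun (rot g) c f p + f p *s E (det_frame m g) c p"
        if "is_dolbeault_operator \<A> m (rot g) E" for E
        using that f det_frame_section[OF g] True unfolding is_dolbeault_operator_def by blast
      from this[OF D] this[OF D'] show ?thesis unfolding sf eq[OF True] by simp
    next
      case False
      have "E s \<in> L_forms01 \<A> m (rot g)" if "is_dolbeault_operator \<A> m (rot g) E" for E
        using that s unfolding is_dolbeault_operator_def by blast
      then have zero: "E s c p = 0" if "is_dolbeault_operator \<A> m (rot g) E" for E
        using that False unfolding L_forms01_def supported_def by blast
      show ?thesis unfolding zero[OF D] zero[OF D'] ..
    qed
    then show ?thesis by (intro ext)
  next
    case False
    have undef: "E s = undefined" if "is_dolbeault_operator \<A> m (rot g) E" for E
    proof -
      have "E \<in> L_sections \<A> m \<rightarrow>\<^sub>E L_forms01 \<A> m (rot g)"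
        using that unfolding is_dolbeault_operator_def by blast
      then show ?thesis by (rule PiE_arb[OF _ False])
    qed
    show ?thesis unfolding undef[OF D] undef[OF D'] ..
  qed
qed

lemma weight_pos: "m \<ge> 2 \<Longrightarrow> weight m > 0"
  by (simp add: weight_def)

lemma connection01_inj:
  assumes g: "is_metric \<A> g" and \<theta>: "is_one_form \<A> \<theta>" and \<eta>: "is_one_form \<A> \<eta>" and m: "m \<ge> 2"
    and eq: "connection01 \<A> m (rot g) (weyl_connection \<A> g \<theta>) = connection01 \<A> m (rot g) (weyl_connection \<A> g \<eta>)"
  shows "\<theta> = \<eta>"
proof -
  have "\<theta> c p = \<eta> c p" for c p
  proof (cases "in_chart \<A> c p")
    case p: True
    have "\<theta> c p $ i = \<eta> c p $ i" for i
    proof -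
      have "of_real (weight m) * (of_real (\<theta> c p $ i) - \<i> * of_real (hodge g \<theta> c p $ i)) * det_frame m g c p
        = of_real (weight m) * (of_real (\<eta> c p $ i) - \<i> * of_real (hodge g \<eta> c p $ i)) * det_frame m g c p"
        using arg_cong[OF eq, of "\<lambda>D. D (det_frame m g) c p $ i"]
        unfolding connection01_det_frame[OF g p] by simp
      then have "complex_of_real (\<theta> c p $ i) - \<i> * of_real (hodge g \<theta> c p $ i)
        = of_real (\<eta> c p $ i) - \<i> * of_real (hodge g \<eta> c p $ i)"
        using weight_pos[OF m] det_frame_nonzero[OF g p] by simp
      from arg_cong[OF this, of Re] show ?thesis by simp
    qed
    then show ?thesis by (simp add: vec_eq_iff)
  next
    case False
    then show ?thesis using \<theta> \<eta> unfolding is_one_form_def supported_def by metis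
  qed
  then show ?thesis by (intro ext)
qed

text \<open>The 1-form is read off from the real part of \<open>D s / s\<close>. The imaginary part then is the right one because
\<open>D s / s\<close> is of type (0,1).\<close>

lemma dolbeault_connection01:
  assumes g: "is_metric \<A> g" and D: "is_dolbeault_operator \<A> m (rot g) D" and m: "m \<ge> 2"
  obtains \<theta> where "is_one_form \<A> \<theta>" "D = connection01 \<A> m (rot g) (weyl_connection \<A> g \<theta>)"
proof -
  let ?s = "det_frame m g"
  have Ds: "D ?s \<in> L_forms01 \<A> m (rot g)"
    using D det_frame_section[OF g] unfolding is_dolbeault_operator_def by blast
  define \<alpha> where "\<alpha> c p i = D ?s c p $ i * of_real (det (g c p) powr ((real m - 1) / 4))" for c p i
  have \<alpha>: "D ?s c p $ i = \<alpha> c p i * ?s c p" if "in_chart \<A> c p" for c p i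
    using metric_det_pos[OF g that] by (simp add: \<alpha>_def det_frame_def powr_minus flip: of_real_mult)
  define \<theta> where "\<theta> c p = (if in_chart \<A> c p then (\<chi> i. - Re (\<alpha> c p i) / weight m) else 0)" for c p
  have sD: "smooth_near c p (\<lambda>q. D ?s c q $ i)" if p: "in_chart \<A> c p" for c p i
  proof -
    have "smooth_in c (D ?s c)"
      using Ds p unfolding L_forms01_def in_chart_def by blast
    then show ?thesis by (intro smooth_near_nth smooth_in_near p)
  qed
  have \<alpha>_transform: "\<alpha> c p i = (\<Sum>a\<in>UNIV. \<alpha> c' p a * of_real (jac c c' p $ a $ i))"
    if ov: "in_overlap \<A> c c' p" for c c' p i
  proof -
    have p: "in_chart \<A> c p" "in_chart \<A> c' p" using ov by (auto simp: in_overlap_def)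
    have "of_real (det (jac c c' p) powr weight m) *s D ?s c p = cpull (D ?s c' p) (jac c c' p)"
      using Ds ov unfolding L_forms01_def by blast
    then have "of_real (det (jac c c' p) powr weight m) * D ?s c p $ i
        = (\<Sum>a\<in>UNIV. D ?s c' p $ a * of_real (jac c c' p $ a $ i))"
      by (simp add: vec_eq_iff cpull_def)
    then have "\<alpha> c p i * (of_real (det (jac c c' p) powr weight m) * ?s c p)
        = (\<Sum>a\<in>UNIV. \<alpha> c' p a * of_real (jac c c' p $ a $ i)) * ?s c' p"
      unfolding \<alpha>[OF p(1)] \<alpha>[OF p(2)] by (simp add: sum_2 algebra_simps)
    then show ?thesis
      unfolding det_frame_transform[OF g ov] using det_frame_nonzero[OF g p(2)] by simp
  qed
  have \<theta>: "is_one_form \<A> \<theta>"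
    unfolding is_one_form_def
  proof (intro conjI allI impI ballI)
    show "supported \<A> \<theta>" by (simp add: supported_def \<theta>_def)
    show "smooth_in c (\<theta> c)" if "c \<in> \<A>" for c
    proof (rule smooth_inI[OF that smooth_near_vec])
      fix p i assume p: "in_chart \<A> c p"
      show "smooth_near c p (\<lambda>q. \<theta> c q $ i)"
      proof (rule smooth_near_cong[OF in_overlap_refl[OF p]])
        show "smooth_near c p (\<lambda>q. - Re (D ?s c q $ i * of_real (det (g c q) powr ((real m - 1) / 4)))
            * (1 / weight m))"
          by (intro smooth_near_mult smooth_near_minus smooth_near_Re smooth_near_of_real smooth_near_const
              smooth_near_powr metric_det_smooth metric_det_pos sD g p)
      qed (simp add: \<theta>_def \<alpha>_def in_overlap_def)
    qed
    show "\<theta> c p = \<theta> c' p v* jac c c' p" if ov: "in_overlap \<A> c c' p" for c c' p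
    proof -
      have "in_chart \<A> c p" "in_chart \<A> c' p" using ov by (auto simp: in_overlap_def)
      then show ?thesis
        by (simp add: \<theta>_def vec_eq_iff vector_matrix_mult_def \<alpha>_transform[OF ov] sum_2
            add_divide_distrib diff_divide_distrib algebra_simps)
    qed
  qed
  have "D ?s c p = connection01 \<A> m (rot g) (weyl_connection \<A> g \<theta>) ?s c p" if p: "in_chart \<A> c p" for c p
  proof -
    have "type01 (rot g c p) (D ?s c p)" using Ds p unfolding L_forms01_def by blast
    then have "(\<Sum>l\<in>UNIV. D ?s c p $ l * of_real (rot g c p $ l $ i)) = - \<i> * D ?s c p $ i" for i
      by (simp add: type01_def cpull_def vec_eq_iff)
    then have "(\<Sum>l\<in>UNIV. \<alpha> c p l * of_real (rot g c p $ l $ i)) * ?s c p = - \<i> * \<alpha> c p i * ?s c p" for i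
      unfolding \<alpha>[OF p] by (simp add: sum_2 algebra_simps)
    then have "(\<Sum>l\<in>UNIV. \<alpha> c p l * of_real (rot g c p $ l $ i)) = - \<i> * \<alpha> c p i" for i
      unfolding mult_right_cancel[OF det_frame_nonzero[OF g p]] .
    from arg_cong[OF this, of Re]
    have Im: "(\<Sum>l\<in>UNIV. Re (\<alpha> c p l) * rot g c p $ l $ i) = Im (\<alpha> c p i)" for i
      by (simp add: sum_2)
    have Re: "Re (\<alpha> c p i) = - weight m * \<theta> c p $ i" for i
      using p weight_pos[OF m] by (simp add: \<theta>_def)
    moreover have "Im (\<alpha> c p i) = weight m * hodge g \<theta> c p $ i" for i
      unfolding Im[of i, symmetric] hodge_entry Re by (simp add: sum_2 algebra_simps)
    ultimately have "\<alpha> c p i = - of_real (weight m) * (of_real (\<theta> c p $ i) - \<i> * of_real (hodge g \<theta> c p $ i))" for i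
      by (simp add: complex_eq_iff)
    then show ?thesis
      unfolding vec_eq_iff connection01_det_frame[OF g p] \<alpha>[OF p] by simp
  qed
  then have "D = connection01 \<A> m (rot g) (weyl_connection \<A> g \<theta>)"
    by (intro dolbeault_determined[OF g D connection01_is_dolbeault[OF g \<theta>]])
  with \<theta> show thesis by (rule that)
qed

lemma associated_connection_weyl:
  assumes g: "is_metric \<A> g" and \<theta>: "is_one_form \<A> \<theta>" and m: "m \<ge> 2"
  shows "associated_connection \<A> m (conformal_class \<A> g)
      (connection01 \<A> m (rot g) (weyl_connection \<A> g \<theta>)) = weyl_connection \<A> g \<theta>"
  unfolding associated_connection_def rot_conformal[OF g rep_conformal[OF g]]
    conformal_connection_iff[OF g]
  by (rule the_equality) (use \<theta> connection01_inj[OF g _ \<theta> m] in blast)+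

section \<open>Differentials of degree m\<close>

text \<open>The first equation of \<open>\<kappa> \<circ> J = i \<kappa>\<close> determines the second component from the first, since \<open>J\<close> has a
positive entry at position (2,1); the second equation follows by \<open>J\<^sup>2 = -1\<close>.\<close>

lemma coframe10_spans:
  assumes g: "is_metric \<A> g" and p: "in_chart \<A> c p"
  shows "type10 (rot g c p) \<kappa> \<longleftrightarrow> \<kappa> = \<kappa> $ 1 *s coframe10 (rot g) c p"
    and "type10 (rot g c p) (coframe10 (rot g) c p)" "coframe10 (rot g) c p $ 1 = 1"
proof -
  define a b d where "a = complex_of_real (rot g c p $ 1 $ 1)" and "b = complex_of_real (rot g c p $ 1 $ 2)"
    and "d = complex_of_real (rot g c p $ 2 $ 1)"
  have J22: "complex_of_real (rot g c p $ 2 $ 2) = - a"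
    by (simp add: a_def rot_entries[OF g])
  have "rot g c p $ 2 $ 1 > 0"
    using metric_11_pos[OF g p] sqrt_det(1)[OF g p] by (simp add: rot_entries[OF g])
  then have d: "d \<noteq> 0" by (simp add: d_def)
  have "complex_of_real (\<Sum>l\<in>UNIV. rot g c p $ 1 $ l * rot g c p $ l $ 1) = -1"
    unfolding rot_square[OF g p] by simp
  then have sq: "a * a + b * d = -1" by (simp add: sum_2 a_def b_def d_def)
  define \<kappa>0 :: "complex^2" where "\<kappa>0 = vector [1, (\<i> - a) / d]"
  have type10: "type10 (rot g c p) \<kappa> \<longleftrightarrow> \<kappa> $ 1 * a + \<kappa> $ 2 * d = \<i> * \<kappa> $ 1 \<and> \<kappa> $ 1 * b - \<kappa> $ 2 * a = \<i> * \<kappa> $ 2" for \<kappa>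
    by (simp add: type10_def cpull_def vec_eq_iff forall_2 sum_2 a_def[symmetric] b_def[symmetric]
        d_def[symmetric] J22)
  have iff: "type10 (rot g c p) \<kappa> \<longleftrightarrow> \<kappa> = \<kappa> $ 1 *s \<kappa>0" for \<kappa>
  proof
    assume "type10 (rot g c p) \<kappa>"
    then have "\<kappa> $ 2 * d = \<kappa> $ 1 * (\<i> - a)" unfolding type10 by (simp add: algebra_simps)
    then have "\<kappa> $ 2 = \<kappa> $ 1 * ((\<i> - a) / d)" using d by (simp add: field_simps)
    then show "\<kappa> = \<kappa> $ 1 *s \<kappa>0" by (simp add: vec_eq_iff forall_2 \<kappa>0_def vector_2)
  next
    assume "\<kappa> = \<kappa> $ 1 *s \<kappa>0"
    then have "\<kappa> $ 2 = (\<kappa> $ 1 *s \<kappa>0) $ 2" by simp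
    then have k2: "\<kappa> $ 2 * d = \<kappa> $ 1 * (\<i> - a)" using d by (simp add: \<kappa>0_def vector_2)
    have "d * (\<kappa> $ 1 * b - \<kappa> $ 2 * a) = \<kappa> $ 1 * (b * d) - (\<kappa> $ 2 * d) * a" by (simp add: algebra_simps)
    also have "b * d = - 1 - a * a" using sq by (simp add: algebra_simps)
    also have "\<kappa> $ 1 * (- 1 - a * a) - (\<kappa> $ 2 * d) * a = \<i> * (\<kappa> $ 2 * d)"
      unfolding k2 by (simp add: algebra_simps)
    finally have "d * (\<kappa> $ 1 * b - \<kappa> $ 2 * a) = d * (\<i> * \<kappa> $ 2)" by (simp add: mult_ac)
    then have "\<kappa> $ 1 * b - \<kappa> $ 2 * a = \<i> * \<kappa> $ 2" using d by simp
    with k2 show "type10 (rot g c p) \<kappa>" unfolding type10 by (simp add: algebra_simps)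
  qed
  have one: "\<kappa>0 $ 1 = 1" by (simp add: \<kappa>0_def vector_2)
  have "coframe10 (rot g) c p = \<kappa>0"
    unfolding coframe10_def
  proof (rule the_equality)
    show "type10 (rot g c p) \<kappa>0 \<and> \<kappa>0 $ 1 = 1" using iff one by simp
    show "\<kappa> = \<kappa>0" if "type10 (rot g c p) \<kappa> \<and> \<kappa> $ 1 = 1" for \<kappa>
    proof -
      have "\<kappa> = \<kappa> $ 1 *s \<kappa>0" using iff that by blast
      also have "\<dots> = \<kappa>0" using that by simp
      finally show ?thesis .
    qed
  qed
  then show "type10 (rot g c p) \<kappa> \<longleftrightarrow> \<kappa> = \<kappa> $ 1 *s coframe10 (rot g) c p"
    and "type10 (rot g c p) (coframe10 (rot g) c p)" "coframe10 (rot g) c p $ 1 = 1"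
    using iff one by simp_all
qed

lemma cpair_scale: "cpair (a *s \<kappa>) v = a * cpair \<kappa> v"
  by (simp add: cpair_def sum_2 algebra_simps)

text \<open>Elements of the fibre are determined by their value on the first coordinate vector.\<close>

lemma canonical_power_eq:
  assumes g: "is_metric \<A> g" and p: "in_chart \<A> c p"
    and a: "a \<in> canonical_power m (rot g c p)"
  shows "a v = a (axis 1 1) * cpair (coframe10 (rot g) c p) v ^ m"
proof -
  obtain z \<kappa> where "type10 (rot g c p) \<kappa>" and av: "\<And>v. a v = z * cpair \<kappa> v ^ m"
    using a unfolding canonical_power_def by auto
  then have \<kappa>: "cpair \<kappa> v = \<kappa> $ 1 * cpair (coframe10 (rot g) c p) v" for v
    using coframe10_spans(1)[OF g p, of \<kappa>] cpair_scale by metis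
  have "cpair (coframe10 (rot g) c p) (axis 1 1) = 1"
    by (simp add: cpair_def sum_2 axis_def coframe10_spans(3)[OF g p])
  then show ?thesis unfolding av \<kappa> by (simp add: power_mult_distrib)
qed

lemma canonical_power_scale:
  assumes "a \<in> canonical_power m J"
  shows "(\<lambda>v. x * a v) \<in> canonical_power m J"
proof -
  obtain z \<kappa> where "type10 J \<kappa>" "a = (\<lambda>v. z * cpair \<kappa> v ^ m)"
    using assms unfolding canonical_power_def by auto
  then show ?thesis
    unfolding canonical_power_def
    by (intro CollectI exI[of _ "x * z"] exI[of _ \<kappa>]) (auto simp: mult.assoc)
qed

text \<open>The coframe obtained from \<open>dx\<^sup>1, dx\<^sup>2\<close> by completing the square in the quadratic form \<open>g\<close>.\<close>

lemma orthonormal_coframe: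
  assumes g: "is_metric \<A> g" and p: "in_chart \<A> c p"
  obtains \<omega>1 \<omega>2 where "oriented_orthonormal_coframe (g c p) \<omega>1 \<omega>2"
    "type10 (rot g c p) (\<chi> i. Complex (\<omega>1 $ i) (\<omega>2 $ i))"
proof -
  define r s where "r = sqrt (g c p $ 1 $ 1)" and "s = sqrt (det (g c p))"
  have r: "r > 0" "r * r = g c p $ 1 $ 1" using metric_11_pos[OF g p] by (simp_all add: r_def)
  have s: "s > 0" "s * s = g c p $ 1 $ 1 * g c p $ 2 $ 2 - g c p $ 1 $ 2 * g c p $ 1 $ 2"
    using sqrt_det[OF g p] by (simp_all add: s_def)
  have g22: "(g c p $ 1 $ 2 * g c p $ 1 $ 2 + s * s) / (r * r) = g c p $ 2 $ 2"
    using s(2) r metric_11_pos[OF g p] by (simp add: field_simps)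
  have "s * s + g c p $ 1 $ 2 * g c p $ 1 $ 2 = r * (r * g c p $ 2 $ 2)"
    unfolding s(2) r(2)[symmetric] by (simp add: mult.assoc)
  then have "r * (s * s + g c p $ 1 $ 2 * g c p $ 1 $ 2) = r * (r * (r * g c p $ 2 $ 2))" by simp
  then have rg: "r * (s * s) + r * (g c p $ 1 $ 2 * g c p $ 1 $ 2) = r * (r * (r * g c p $ 2 $ 2))"
    by (simp only: distrib_left)
  \<comment> \<open>the second covector vanishes on the first coordinate vector\<close>
  define \<omega>1 \<omega>2 :: "real^2" where "\<omega>1 = vector [r, g c p $ 1 $ 2 / r]" and "\<omega>2 = vector [0, s / r]"
  have "v \<bullet> (g c p *v w) = (\<omega>1 \<bullet> v) * (\<omega>1 \<bullet> w) + (\<omega>2 \<bullet> v) * (\<omega>2 \<bullet> w)" for v w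
  proof -
    have "(\<omega>1 \<bullet> v) * (\<omega>1 \<bullet> w) + (\<omega>2 \<bullet> v) * (\<omega>2 \<bullet> w)
      = r * r * v $ 1 * w $ 1 + g c p $ 1 $ 2 * (v $ 1 * w $ 2 + v $ 2 * w $ 1)
        + (g c p $ 1 $ 2 * g c p $ 1 $ 2 + s * s) / (r * r) * v $ 2 * w $ 2"
      using r(1) by (simp add: \<omega>1_def \<omega>2_def inner_vec_def sum_2 vector_2 field_simps)
    note coframe = this
    show ?thesis
      unfolding coframe g22 unfolding r(2)
      by (simp add: inner_vec_def sum_2 matrix_vector_mult_def metric_sym[OF g p] algebra_simps)
  qed
  moreover have "\<omega>1 $ 1 * \<omega>2 $ 2 - \<omega>1 $ 2 * \<omega>2 $ 1 > 0"
    using r s by (simp add: \<omega>1_def \<omega>2_def vector_2)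
  moreover have "type10 (rot g c p) (\<chi> i. Complex (\<omega>1 $ i) (\<omega>2 $ i))"
    unfolding type10_def cpull_def vec_eq_iff forall_2
    using r s rg by (auto simp: sum_2 rot_entries[OF g] s_def[symmetric] \<omega>1_def \<omega>2_def vector_2
        complex_eq_iff field_simps)
  ultimately show thesis
    by (intro that[of \<omega>1 \<omega>2]) (simp_all add: oriented_orthonormal_coframe_def)
qed

text \<open>An oriented orthonormal coframe satisfies \<open>|\<omega>\<^sub>1(v) + i \<omega>\<^sub>2(v)|\<^sup>2 = g(v,v)\<close>, so \<open>|z|\<^sup>2\<close> can be computed from the value
of the differential on any vector. In particular it does not depend on the coframe.\<close>

lemma norm_sq_eq:
  assumes g: "is_metric \<A> g" and p: "in_chart \<A> c p"
    and a: "a \<in> canonical_power m (rot g c p)" and v: "v \<noteq> 0"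
  shows "norm_sq m (g c p) a = (cmod (a v))\<^sup>2 / (v \<bullet> (g c p *v v)) ^ m"
proof -
  have pos: "v \<bullet> (g c p *v v) > 0"
    using g p v unfolding is_metric_def by blast
  have z: "(cmod z)\<^sup>2 = (cmod (a v))\<^sup>2 / (v \<bullet> (g c p *v v)) ^ m"
    if "oriented_orthonormal_coframe (g c p) \<omega>1 \<omega>2" and "\<forall>v. a v = z * Complex (\<omega>1 \<bullet> v) (\<omega>2 \<bullet> v) ^ m"
    for \<omega>1 \<omega>2 z
  proof -
    have "v \<bullet> (g c p *v v) = (cmod (Complex (\<omega>1 \<bullet> v) (\<omega>2 \<bullet> v)))\<^sup>2"
      using that(1) unfolding oriented_orthonormal_coframe_def
      by (simp add: cmod_def power2_eq_square)
    then have "(cmod (a v))\<^sup>2 = (cmod z)\<^sup>2 * (v \<bullet> (g c p *v v)) ^ m"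
      using that(2) by (simp add: norm_mult norm_power power_mult_distrib power_mult[symmetric] mult.commute)
    then show ?thesis using pos by simp
  qed
  obtain \<omega>1 \<omega>2 where \<omega>: "oriented_orthonormal_coframe (g c p) \<omega>1 \<omega>2"
    and \<kappa>: "type10 (rot g c p) (\<chi> i. Complex (\<omega>1 $ i) (\<omega>2 $ i))" (is "type10 _ ?\<kappa>")
    by (rule orthonormal_coframe[OF g p])
  have pair: "cpair ?\<kappa> v = Complex (\<omega>1 \<bullet> v) (\<omega>2 \<bullet> v)" for v
    by (simp add: cpair_def sum_2 inner_vec_def complex_eq_iff algebra_simps)
  have k1: "?\<kappa> $ 1 \<noteq> 0"
  proof
    assume "?\<kappa> $ 1 = 0"
    then have "\<omega>1 $ 1 = 0" "\<omega>2 $ 1 = 0" by (simp_all add: complex_eq_iff)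
    then show False using \<omega> by (simp add: oriented_orthonormal_coframe_def)
  qed
  have "\<exists>z. \<forall>v. a v = z * Complex (\<omega>1 \<bullet> v) (\<omega>2 \<bullet> v) ^ m"
  proof (intro exI allI)
    fix v
    have "?\<kappa> = ?\<kappa> $ 1 *s coframe10 (rot g) c p" using \<kappa> coframe10_spans(1)[OF g p] by blast
    then have "cpair ?\<kappa> v = ?\<kappa> $ 1 * cpair (coframe10 (rot g) c p) v"
      using cpair_scale by metis
    then have "cpair (coframe10 (rot g) c p) v = Complex (\<omega>1 \<bullet> v) (\<omega>2 \<bullet> v) / ?\<kappa> $ 1"
      unfolding pair using k1 by simp
    then show "a v = a (axis 1 1) / (?\<kappa> $ 1) ^ m * Complex (\<omega>1 \<bullet> v) (\<omega>2 \<bullet> v) ^ m"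
      using canonical_power_eq[OF g p a, of v] by (simp add: power_divide)
  qed
  then obtain w where w: "\<forall>v. a v = w * Complex (\<omega>1 \<bullet> v) (\<omega>2 \<bullet> v) ^ m" by blast
  show ?thesis
    unfolding norm_sq_def
  proof (rule the_equality)
    fix r assume "\<forall>\<omega>1 \<omega>2 z. oriented_orthonormal_coframe (g c p) \<omega>1 \<omega>2 \<and>
      (\<forall>v. a v = z * Complex (\<omega>1 \<bullet> v) (\<omega>2 \<bullet> v) ^ m) \<longrightarrow> r = (cmod z)\<^sup>2"
    then have "r = (cmod w)\<^sup>2" using \<omega> w by blast
    then show "r = (cmod (a v))\<^sup>2 / (v \<bullet> (g c p *v v)) ^ m" using z[OF \<omega> w] by simp
  qed (use z in metis)
qed

lemma dbar_differential_mult: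
  assumes g: "is_metric \<A> g" and p: "in_chart \<A> c p" and f: "smooth_near c p f"
    and A: "smooth_near c p (\<lambda>q. A c q (axis 1 1))" "A c p \<in> canonical_power m (rot g c p)"
  shows "dbar_differential m (rot g) (\<lambda>c p v. f p * A c p v) c p u v
    = cpair (dbar_fun (rot g) c f p) u * A c p v + f p * dbar_differential m (rot g) A c p u v"
proof -
  have pd: "pd c i (\<lambda>q. f q * A c q (axis 1 1)) p
      = f p * pd c i (\<lambda>q. A c q (axis 1 1)) p + pd c i f p * A c p (axis 1 1)" for i
    by (rule pd_mult[OF p f A(1)])
  have Av: "A c p v = A c p (axis 1 1) * cpair (coframe10 (rot g) c p) v ^ m"
    by (rule canonical_power_eq[OF g p A(2)])
  show ?thesis
    unfolding dbar_differential_def Let_def Av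
    by (simp add: dbar_fun_def cpair_def part01_entry pd sum_2 field_simps)
qed

lemma weighted_differential_smooth:
  assumes "weighted_differential \<A> m w j P" "in_chart \<A> c p"
  shows "smooth_near c p (\<lambda>q. P c q v)"
  using assms smooth_in_near unfolding weighted_differential_def in_chart_def by blast

lemma weighted_differential_zero:
  assumes "weighted_differential \<A> m w j P" "\<not> in_chart \<A> c p"
  shows "P c p v = 0"
  using assms unfolding weighted_differential_def by blast

lemma det_scale_det_frame: "det_scale (- ((real m - 1) / 4)) g A = (\<lambda>c p v. det_frame m g c p * A c p v)"
  by (simp add: det_scale_def det_frame_def fun_eq_iff)

lemma det_scale_inverse:
  assumes g: "is_metric \<A> g" and A: "weighted_differential \<A> m w j A"
  shows "det_scale a g (det_scale (- a) g A) = A"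
proof (intro ext)
  fix c p v
  show "det_scale a g (det_scale (- a) g A) c p v = A c p v"
  proof (cases "in_chart \<A> c p")
    case True
    then show ?thesis
      using metric_det_pos[OF g True]
      by (simp add: det_scale_def mult.assoc[symmetric] powr_add[symmetric] flip: of_real_mult)
  next
    case False
    then have "A c p v = 0" using A unfolding weighted_differential_def by blast
    then show ?thesis by (simp add: det_scale_def)
  qed
qed

lemma det_scale_differential:
  assumes g: "is_metric \<A> g" and A: "weighted_differential \<A> m w (rot g) A"
  shows "weighted_differential \<A> m (w - 2 * a) (rot g) (det_scale a g A)"
  unfolding weighted_differential_def
proof (intro conjI allI impI ballI)
  show "det_scale a g A c p v = 0" if "\<not> in_chart \<A> c p" for c p v
    by (simp add: det_scale_def weighted_differential_zero[OF A that])
  show "smooth_in c (\<lambda>p. det_scale a g A c p v)" if "c \<in> \<A>" for c v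
    unfolding det_scale_def
    by (intro smooth_inI[OF that] smooth_near_mult smooth_near_of_real smooth_near_powr
        metric_det_smooth metric_det_pos g weighted_differential_smooth[OF A])
  show "det_scale a g A c p \<in> canonical_power m (rot g c p)" if "in_chart \<A> c p" for c p
  proof -
    have "A c p \<in> canonical_power m (rot g c p)"
      using A that unfolding weighted_differential_def by blast
    from canonical_power_scale[OF this, of "of_real (det (g c p) powr a)"]
    show ?thesis by (simp add: det_scale_def[abs_def])
  qed
  show "of_real (det (jac c c' p) powr (w - 2 * a)) * det_scale a g A c p v
      = det_scale a g A c' p (jac c c' p *v v)" if ov: "in_overlap \<A> c c' p" for c c' p v
  proof -
    have p: "in_chart \<A> c p" "in_chart \<A> c' p" using ov by (auto simp: in_overlap_def)
    have J: "det (jac c c' p) > 0" by (rule transition(2)[OF ov])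
    have "of_real (det (jac c c' p) powr w) * A c p v = A c' p (jac c c' p *v v)"
      using A ov unfolding weighted_differential_def by blast
    moreover have "det (jac c c' p) powr (w - 2 * a) * det (g c p) powr a
        = det (g c' p) powr a * det (jac c c' p) powr w"
      unfolding det_metric_transform(1)[OF g ov] using J metric_det_pos[OF g p(2)]
      by (simp add: powr_mult powr_add[symmetric] mult.assoc[symmetric])
    ultimately show ?thesis
      unfolding det_scale_def by (metis mult.assoc of_real_mult)
  qed
qed

text \<open>Every other decomposition of the section as \<open>t \<otimes> B\<close> has \<open>t = f s\<close>, and then \<open>A = f B\<close>. The two Leibniz rules move
\<open>f\<close> between the factors; \<open>t\<close> may have zeros, but \<open>f\<close> is never inverted.\<close>

lemma dbar_tensor_eq:
  assumes g: "is_metric \<A> g" and D: "is_dolbeault_operator \<A> m (rot g) D"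
    and A: "is_differential \<A> m (rot g) A" and p: "in_chart \<A> c p"
  shows "dbar_tensor \<A> m (rot g) D (\<lambda>c p v. det_frame m g c p * A c p v) c p u v
    = cpair (D (det_frame m g) c p) u * A c p v + det_frame m g c p * dbar_differential m (rot g) A c p u v"
  (is "_ = ?z")
  unfolding dbar_tensor_def
proof (rule the_equality)
  let ?s = "det_frame m g"
  show "\<forall>s B. s \<in> L_sections \<A> m \<and> is_differential \<A> m (rot g) B \<and>
      (\<lambda>c p v. ?s c p * A c p v) = (\<lambda>c p v. s c p * B c p v) \<longrightarrow>
      ?z = cpair (D s c p) u * B c p v + s c p * dbar_differential m (rot g) B c p u v"
  proof (intro allI impI, elim conjE)
    fix s B assume s: "s \<in> L_sections \<A> m" and B: "is_differential \<A> m (rot g) B"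
      and eq: "(\<lambda>c p v. ?s c p * A c p v) = (\<lambda>c p v. s c p * B c p v)"
    obtain f where f: "smooth_fun \<A> f" and sf: "s = (\<lambda>c p. f p * ?s c p)"
      by (rule L_section_det_frame[OF g s])
    have A_eq: "A = (\<lambda>c p v. f p * B c p v)"
    proof (intro ext)
      fix c p v
      show "A c p v = f p * B c p v"
      proof (cases "in_chart \<A> c p")
        case True
        have "?s c p * A c p v = ?s c p * (f p * B c p v)"
          using fun_cong[OF fun_cong[OF fun_cong[OF eq, of c], of p], of v] unfolding sf by (simp add: mult_ac)
        then show ?thesis using det_frame_nonzero[OF g True] by simp
      next
        case False
        then show ?thesis
          using weighted_differential_zero[OF A[unfolded is_differential_def]]
            weighted_differential_zero[OF B[unfolded is_differential_def]] by simp
      qed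
    qed
    have Ds: "D s c p = ?s c p *s dbar_fun (rot g) c f p + f p *s D ?s c p"
      using D f det_frame_section[OF g] p unfolding sf is_dolbeault_operator_def by blast
    have Bp: "B c p \<in> canonical_power m (rot g c p)"
      using B p unfolding is_differential_def weighted_differential_def by blast
    have sB: "smooth_near c p (\<lambda>q. B c q (axis 1 1))"
      by (rule weighted_differential_smooth[OF B[unfolded is_differential_def] p])
    have "dbar_differential m (rot g) A c p u v
        = cpair (dbar_fun (rot g) c f p) u * B c p v + f p * dbar_differential m (rot g) B c p u v"
      unfolding A_eq by (rule dbar_differential_mult[where A = B, OF g p smooth_fun_near[OF f p] sB Bp])
    then show "?z = cpair (D s c p) u * B c p v + s c p * dbar_differential m (rot g) B c p u v"
      unfolding Ds by (simp add: A_eq sf cpair_def sum_2 algebra_simps)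
  qed
  then show "z = ?z" if "\<forall>s B. s \<in> L_sections \<A> m \<and> is_differential \<A> m (rot g) B \<and>
      (\<lambda>c p v. ?s c p * A c p v) = (\<lambda>c p v. s c p * B c p v) \<longrightarrow>
      z = cpair (D s c p) u * B c p v + s c p * dbar_differential m (rot g) B c p u v" for z
    using that det_frame_section[OF g] A by blast
qed

lemma holomorphic_section_iff:
  assumes g: "is_metric \<A> g" and \<theta>: "is_one_form \<A> \<theta>" and A: "is_differential \<A> m (rot g) A"
  shows "is_holomorphic_section \<A> m (rot g) (connection01 \<A> m (rot g) (weyl_connection \<A> g \<theta>))
      (det_scale (- ((real m - 1) / 4)) g A) \<longleftrightarrow>
    (\<forall>c p u v. in_chart \<A> c p \<longrightarrow>
        dbar_differential m (rot g) A c p u v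
          = (of_nat m - 1) / 2 * (of_real (\<theta> c p \<bullet> u) - \<i> * of_real (hodge g \<theta> c p \<bullet> u)) * A c p v)"
proof -
  let ?D = "connection01 \<A> m (rot g) (weyl_connection \<A> g \<theta>)"
  have P: "weighted_differential \<A> m (weight m) (rot g) (det_scale (- ((real m - 1) / 4)) g A)"
  proof -
    have "0 - 2 * - ((real m - 1) / 4) = weight m" by (simp add: weight_def field_simps)
    with det_scale_differential[OF g A[unfolded is_differential_def], of "- ((real m - 1) / 4)"]
    show ?thesis by metis
  qed
  have "dbar_tensor \<A> m (rot g) ?D (det_scale (- ((real m - 1) / 4)) g A) c p u v = 0 \<longleftrightarrow>
      dbar_differential m (rot g) A c p u v
        = (of_nat m - 1) / 2 * (of_real (\<theta> c p \<bullet> u) - \<i> * of_real (hodge g \<theta> c p \<bullet> u)) * A c p v"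
    if p: "in_chart \<A> c p" for c p u v
  proof -
    define x where "x = (of_nat m - 1) / 2 * (of_real (\<theta> c p \<bullet> u) - \<i> * of_real (hodge g \<theta> c p \<bullet> u))"
    have Ds: "cpair (?D (det_frame m g) c p) u = - det_frame m g c p * x"
      unfolding cpair_def connection01_det_frame[OF g p] x_def
      by (simp add: sum_2 inner_vec_def weight_def field_simps)
    have tensor: "dbar_tensor \<A> m (rot g) ?D (det_scale (- ((real m - 1) / 4)) g A) c p u v
      = det_frame m g c p * (dbar_differential m (rot g) A c p u v - x * A c p v)"
      unfolding det_scale_det_frame dbar_tensor_eq[OF g connection01_is_dolbeault[OF g \<theta>] A p] Ds
      by (simp add: algebra_simps)
    show ?thesis unfolding tensor x_def[symmetric] using det_frame_nonzero[OF g p] by simp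
  qed
  then show ?thesis unfolding is_holomorphic_section_def using P by blast
qed

section \<open>The two sets of triples\<close>

lemma axis_form: "axis 1 1 \<bullet> (G *v axis 1 1) = (G :: real^2^2) $ 1 $ 1"
  by (simp add: inner_vec_def matrix_vector_mult_def sum_2 axis_def)

lemma differential_canonical:
  assumes "weighted_differential \<A> m w j P" "in_chart \<A> c p"
  shows "P c p \<in> canonical_power m (j c p)"
  using assms unfolding weighted_differential_def by blast

lemma norm_sq_axis:
  assumes "is_metric \<A> g" "weighted_differential \<A> m w (rot g) A" "in_chart \<A> c p"
  shows "norm_sq m (g c p) (A c p) = (cmod (A c p (axis 1 1)))\<^sup>2 / (g c p $ 1 $ 1) ^ m"
  using norm_sq_eq[OF assms(1,3) differential_canonical[OF assms(2,3)], of "axis 1 1"]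
  unfolding axis_form by simp

lemma norm_sq_invariant:
  assumes g: "is_metric \<A> g" and A: "is_differential \<A> m (rot g) A" and ov: "in_overlap \<A> c c' p"
  shows "norm_sq m (g c p) (A c p) = norm_sq m (g c' p) (A c' p)"
proof -
  have p: "in_chart \<A> c p" "in_chart \<A> c' p" using ov by (auto simp: in_overlap_def)
  note A' = A[unfolded is_differential_def]
  define J where "J = jac c c' p"
  define v where "v = J *v axis 1 1"
  have v: "v $ i = J $ i $ 1" for i
    by (simp add: v_def matrix_vector_mult_def sum_2 axis_def)
  have J: "det J > 0" using transition(2)[OF ov] by (simp add: J_def)
  then have "v \<noteq> 0" using v[of 1] v[of 2] by (auto simp: det_2)
  from norm_sq_eq[OF g p(2) differential_canonical[OF A' p(2)] this]
  have "norm_sq m (g c' p) (A c' p) = (cmod (A c' p v))\<^sup>2 / (v \<bullet> (g c' p *v v)) ^ m" .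
  moreover have "A c' p v = A c p (axis 1 1)"
  proof -
    have "of_real (det J powr 0) * A c p (axis 1 1) = A c' p v"
      using A' ov unfolding weighted_differential_def v_def J_def by blast
    then show ?thesis using J by simp
  qed
  moreover have "v \<bullet> (g c' p *v v) = g c p $ 1 $ 1"
    unfolding metric_transform[OF g ov] J_def[symmetric]
    by (simp add: inner_vec_def matrix_vector_mult_def sum_2 v algebra_simps)
  ultimately show ?thesis unfolding norm_sq_axis[OF g A' p(1)] by simp
qed

lemma norm_sq_smooth:
  assumes g: "is_metric \<A> g" and A: "weighted_differential \<A> m w (rot g) A" and p: "in_chart \<A> c p"
  shows "smooth_near c p (\<lambda>q. norm_sq m (g c q) (A c q))"
proof (rule smooth_near_cong[OF in_overlap_refl[OF p]])
  have "smooth_near c p (\<lambda>q. inverse (g c q $ 1 $ 1 ^ m))"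
    by (intro smooth_near_inverse smooth_near_power metric_smooth g p zero_less_power metric_11_pos)
  then show "smooth_near c p (\<lambda>q. ((Re (A c q (axis 1 1))) ^ 2 + (Im (A c q (axis 1 1))) ^ 2) * inverse (g c q $ 1 $ 1 ^ m))"
    by (intro smooth_near_mult smooth_near_add smooth_near_power smooth_near_Re smooth_near_Im
        weighted_differential_smooth[OF A p])
qed (simp add: norm_sq_axis[OF g A] in_overlap_def cmod_power2 divide_inverse)

text \<open>If \<open>g\<close> is multiplied by \<open>k\<close> while \<open>P\<close> is fixed, then \<open>|A|\<^sup>2\<close> is multiplied by \<open>k\<^sup>m\<^sup>-\<^sup>1\<close> through the power of the
determinant and by \<open>k\<^sup>-\<^sup>m\<close> through the norm. The remaining factor \<open>1/k\<close> compensates for the change of \<open>g\<close>.\<close>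

lemma quadratic_form_eq:
  assumes g: "is_metric \<A> g" and A: "is_differential \<A> m (rot g) A" and m: "m \<ge> 1" and p: "in_chart \<A> c p"
  shows "quadratic_form m (conformal_class \<A> g) (det_scale (- ((real m - 1) / 4)) g A) c p
    = norm_sq m (g c p) (A c p) *\<^sub>R g c p"
proof -
  define a where "a = (real m - 1) / 4"
  define G where "G = rep (conformal_class \<A> g)"
  have G: "G \<in> conformal_class \<A> g" unfolding G_def by (rule rep_conformal[OF g])
  then obtain u where Gm: "is_metric \<A> G"
    and conf: "\<And>c p. in_chart \<A> c p \<Longrightarrow> G c p = exp (2 * u p) *\<^sub>R g c p"
    unfolding conformal_class_def by blast
  define k where "k = exp (2 * u p)"
  have k: "k > 0" by (simp add: k_def)
  have Gk: "G c p = k *\<^sub>R g c p" using conf[OF p] by (simp add: k_def)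
  define B where "B = det_scale a G (det_scale (- a) g A)"
  note A' = A[unfolded is_differential_def]
  have B: "weighted_differential \<A> m (0 - 2 * - a - 2 * a) (rot G) B"
    unfolding B_def rot_conformal[OF g G]
    using det_scale_differential[OF Gm det_scale_differential[OF g A', of "- a", folded rot_conformal[OF g G]], of a]
    unfolding rot_conformal[OF g G] .
  have D: "det (g c p) > 0" by (rule metric_det_pos[OF g p])
  have "det (G c p) = k * k * det (g c p)" by (simp add: det_2 Gk algebra_simps)
  then have "det (G c p) powr a * det (g c p) powr (- a) = k powr (2 * a)"
    using k D by (simp add: powr_mult powr_add[symmetric] mult.assoc)
  then have Bv: "B c p v = of_real (k powr (2 * a)) * A c p v" for v
    by (simp add: B_def det_scale_def mult.assoc[symmetric] flip: of_real_mult)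
  have "(k powr (2 * a))\<^sup>2 = k powr (real (m - 1))"
  proof -
    have "2 * a + 2 * a = real (m - 1)" using m by (simp add: a_def of_nat_diff field_simps)
    then show ?thesis by (simp only: power2_eq_square powr_add[symmetric])
  qed
  also have "\<dots> = k ^ (m - 1)" using k by (simp add: powr_realpow)
  finally have k2: "(k powr (2 * a))\<^sup>2 = k ^ (m - 1)" .
  have km: "k ^ m = k ^ (m - 1) * k" using m by (cases m) auto
  have "norm_sq m (G c p) (B c p) * k = norm_sq m (g c p) (A c p)"
    unfolding norm_sq_axis[OF Gm B p] norm_sq_axis[OF g A' p]
    unfolding Bv Gk
    using k by (simp add: norm_mult power_mult_distrib k2 km)
  then show ?thesis
    unfolding quadratic_form_def Let_def G_def[symmetric] a_def[symmetric] B_def[symmetric]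
    by (simp add: Gk)
qed

text \<open>The form whose definiteness is required in (ii), expressed by the data of (i).\<close>

lemma curvature_form:
  assumes g: "is_metric \<A> g" and \<theta>: "is_one_form \<A> \<theta>" and A: "is_differential \<A> m (rot g) A"
    and m: "m \<ge> 2" and p: "in_chart \<A> c p"
  shows "sym_ricci (associated_connection \<A> m (conformal_class \<A> g)
        (connection01 \<A> m (rot g) (weyl_connection \<A> g \<theta>))) c p
      + (1 - real m) *\<^sub>R quadratic_form m (conformal_class \<A> g) (det_scale (- ((real m - 1) / 4)) g A) c p
    = (gauss_curvature \<A> g c p - codifferential g \<theta> c p - (real m - 1) * norm_sq m (g c p) (A c p)) *\<^sub>R g c p"
proof -
  have "m \<ge> 1" using m by simp
  show ?thesis
    unfolding associated_connection_weyl[OF g \<theta> m] sym_ricci_weyl[OF g \<theta> p] quadratic_form_eq[OF g A \<open>m \<ge> 1\<close> p]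
    by (simp add: algebra_simps)
qed

lemma vortex_curvature_form:
  assumes "(g, A, \<theta>) \<in> vortex_triples \<A> m" and m: "m \<ge> 2" and p: "in_chart \<A> c p"
  shows "sym_ricci (associated_connection \<A> m (conformal_class \<A> g)
        (connection01 \<A> m (rot g) (weyl_connection \<A> g \<theta>))) c p
      + (1 - real m) *\<^sub>R quadratic_form m (conformal_class \<A> g) (det_scale (- ((real m - 1) / 4)) g A) c p
    = - g c p"
proof -
  have g: "is_metric \<A> g" and A: "is_differential \<A> m (rot g) A" and \<theta>: "is_one_form \<A> \<theta>"
    and K: "gauss_curvature \<A> g c p = -1 + codifferential g \<theta> c p + (real m - 1) * norm_sq m (g c p) (A c p)"
    using assms unfolding vortex_triples_def by blast+
  show ?thesis unfolding curvature_form[OF g \<theta> A m p] K by simp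
qed

lemma correspondence_in:
  assumes v: "(g, A, \<theta>) \<in> vortex_triples \<A> m" and m: "m \<ge> 2"
  shows "correspondence \<A> m (g, A, \<theta>) \<in> holomorphic_triples \<A> m"
proof -
  have g: "is_metric \<A> g" and A: "is_differential \<A> m (rot g) A" and \<theta>: "is_one_form \<A> \<theta>"
    and dbar: "\<forall>c p u v. in_chart \<A> c p \<longrightarrow> dbar_differential m (rot g) A c p u v
          = (of_nat m - 1) / 2 * (of_real (\<theta> c p \<bullet> u) - \<i> * of_real (hodge g \<theta> c p \<bullet> u)) * A c p v"
    using v unfolding vortex_triples_def by blast+
  let ?D = "connection01 \<A> m (rot g) (weyl_connection \<A> g \<theta>)"
  let ?P = "det_scale (- ((real m - 1) / 4)) g A"
  have rot: "rot (rep (conformal_class \<A> g)) = rot g"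
    by (rule rot_conformal[OF g rep_conformal[OF g]])
  have "is_conformal_structure \<A> (conformal_class \<A> g)"
    unfolding is_conformal_structure_def using g by blast
  moreover have "is_holomorphic_section \<A> m (rot g) ?D ?P"
    using dbar holomorphic_section_iff[OF g \<theta> A] by blast
  moreover have "negative_definite \<A> (\<lambda>c p. sym_ricci (associated_connection \<A> m (conformal_class \<A> g) ?D) c p
       + (1 - real m) *\<^sub>R quadratic_form m (conformal_class \<A> g) ?P c p)"
    unfolding negative_definite_def
  proof (intro allI impI, elim conjE)
    fix c p and w :: "real^2" assume p: "in_chart \<A> c p" and w: "w \<noteq> 0"
    have "w \<bullet> (g c p *v w) > 0" using g p w unfolding is_metric_def by blast
    then show "w \<bullet> ((sym_ricci (associated_connection \<A> m (conformal_class \<A> g) ?D) c p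
       + (1 - real m) *\<^sub>R quadratic_form m (conformal_class \<A> g) ?P c p) *v w) < 0"
      unfolding vortex_curvature_form[OF v m p]
      by (simp add: inner_vec_def matrix_vector_mult_def sum_2 algebra_simps)
  qed
  ultimately show ?thesis
    using connection01_is_dolbeault[OF g \<theta>, of m]
    unfolding correspondence_def holomorphic_triples_def by (simp add: rot)
qed

text \<open>The metric is minus the form of (ii), hence determined by the image; then the 1-form is determined by the operator
and the differential by the section.\<close>

lemma correspondence_inj:
  assumes v: "(g, A, \<theta>) \<in> vortex_triples \<A> m" and v': "(g', A', \<theta>') \<in> vortex_triples \<A> m" and m: "m \<ge> 2"
    and eq: "correspondence \<A> m (g, A, \<theta>) = correspondence \<A> m (g', A', \<theta>')"
  shows "(g, A, \<theta>) = (g', A', \<theta>')"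
proof -
  have g: "is_metric \<A> g" and A: "is_differential \<A> m (rot g) A" and \<theta>: "is_one_form \<A> \<theta>"
    using v unfolding vortex_triples_def by blast+
  have g': "is_metric \<A> g'" and A': "is_differential \<A> m (rot g') A'" and \<theta>': "is_one_form \<A> \<theta>'"
    using v' unfolding vortex_triples_def by blast+
  have C: "conformal_class \<A> g = conformal_class \<A> g'"
    and D: "connection01 \<A> m (rot g) (weyl_connection \<A> g \<theta>) = connection01 \<A> m (rot g') (weyl_connection \<A> g' \<theta>')"
    and P: "det_scale (- ((real m - 1) / 4)) g A = det_scale (- ((real m - 1) / 4)) g' A'"
    using eq unfolding correspondence_def by simp_all
  have "g c p = g' c p" for c p
  proof (cases "in_chart \<A> c p")
    case True
    from vortex_curvature_form[OF v m True] vortex_curvature_form[OF v' m True]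
    show ?thesis unfolding C D P by simp
  next
    case False
    then show ?thesis using g g' unfolding is_metric_def supported_def by metis
  qed
  then have gg: "g' = g" by (intro ext) simp
  have "\<theta> = \<theta>'" by (rule connection01_inj[OF g \<theta> \<theta>' m D[unfolded gg]])
  moreover have "A = A'"
    using arg_cong[OF P, of "det_scale ((real m - 1) / 4) g"]
    unfolding gg det_scale_inverse[OF g A[unfolded is_differential_def]]
      det_scale_inverse[OF g A'[unfolded is_differential_def gg]] .
  ultimately show ?thesis using gg by simp
qed

lemma is_metric_conformal:
  assumes g: "is_metric \<A> g" and u: "smooth_fun \<A> u"
  shows "is_metric \<A> (\<lambda>c p. exp (2 * u p) *\<^sub>R g c p)" (is "is_metric _ ?g")
  unfolding is_metric_def
proof (intro conjI allI impI ballI)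
  show "supported \<A> ?g" using g unfolding is_metric_def supported_def by simp
  show "smooth_in c (?g c)" if "c \<in> \<A>" for c
  proof (intro smooth_inI[OF that] smooth_near_vec)
    fix p i j assume p: "in_chart \<A> c p"
    show "smooth_near c p (\<lambda>q. ?g c q $ i $ j)"
      unfolding vector_scaleR_component
      by (intro smooth_near_scaleR smooth_near_exp smooth_near_mult smooth_near_const
          smooth_fun_near[OF u p] metric_smooth[OF g p])
  qed
  show "?g c p = transpose (jac c c' p) ** ?g c' p ** jac c c' p" if "in_overlap \<A> c c' p" for c c' p
  proof -
    have "g c p = transpose (jac c c' p) ** g c' p ** jac c c' p"
      using g that unfolding is_metric_def by blast
    then show ?thesis
      by (simp add: vec_eq_iff matrix_matrix_mult_def sum_2 algebra_simps)
  qed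
  show "transpose (?g c p) = ?g c p" if "in_chart \<A> c p" for c p
    using metric_sym_everywhere[OF g, of c p] by (simp add: transpose_def vec_eq_iff)
  show "v \<bullet> (?g c p *v v) > 0" if "in_chart \<A> c p" "v \<noteq> 0" for c p v
  proof -
    have "v \<bullet> (g c p *v v) > 0" using g that unfolding is_metric_def by blast
    moreover have "v \<bullet> (?g c p *v v) = exp (2 * u p) * (v \<bullet> (g c p *v v))"
      by (simp add: inner_vec_def matrix_vector_mult_def sum_2 algebra_simps)
    ultimately show ?thesis by simp
  qed
qed

text \<open>Express the triple by an arbitrary metric \<open>g0\<close> of the class. The form of (ii) is \<open>F g0\<close> with a negative function \<open>F\<close>,
and \<open>u = ln (-F) / 2\<close> makes \<open>e\<^sup>2\<^sup>u g0\<close> the negative of the form. Neither the form nor the Weyl connection changes when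
\<open>g0\<close> and its 1-form are replaced by this metric and the corresponding 1-form.\<close>

lemma correspondence_surj:
  assumes h: "(C, D, P) \<in> holomorphic_triples \<A> m" and m: "m \<ge> 2"
  shows "\<exists>t\<in>vortex_triples \<A> m. correspondence \<A> m t = (C, D, P)"
proof -
  from h obtain g0 where g0: "is_metric \<A> g0" and C: "C = conformal_class \<A> g0"
    unfolding holomorphic_triples_def is_conformal_structure_def by blast
  have rot: "rot (rep C) = rot g0"
    unfolding C by (rule rot_conformal[OF g0 rep_conformal[OF g0]])
  have D: "is_dolbeault_operator \<A> m (rot g0) D" and P: "is_holomorphic_section \<A> m (rot g0) D P"
    and neg: "negative_definite \<A> (\<lambda>c p. sym_ricci (associated_connection \<A> m C D) c p
       + (1 - real m) *\<^sub>R quadratic_form m C P c p)"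
    using h unfolding holomorphic_triples_def rot[symmetric] by blast+
  obtain \<theta>0 where \<theta>0: "is_one_form \<A> \<theta>0" and D0: "D = connection01 \<A> m (rot g0) (weyl_connection \<A> g0 \<theta>0)"
    by (rule dolbeault_connection01[OF g0 D m])
  define a where "a = (real m - 1) / 4"
  have wP: "weighted_differential \<A> m (weight m) (rot g0) P"
    using P unfolding is_holomorphic_section_def by blast
  have w: "weight m - 2 * a = 0" by (simp add: weight_def a_def)
  have diff: "is_differential \<A> m (rot g) (det_scale a g P)" "det_scale (- a) g (det_scale a g P) = P"
    if "g \<in> conformal_class \<A> g0" for g
  proof -
    have g: "is_metric \<A> g" using that unfolding conformal_class_def by blast
    have wPg: "weighted_differential \<A> m (weight m) (rot g) P"
      using wP unfolding rot_conformal[OF g0 that] .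
    from det_scale_differential[OF g wPg, of a] show "is_differential \<A> m (rot g) (det_scale a g P)"
      unfolding w is_differential_def .
    show "det_scale (- a) g (det_scale a g P) = P"
      using det_scale_inverse[OF g wPg, of "- a"] by simp
  qed
  note A0 = diff[OF conformal_self[OF g0]]
  define F where "F c p = gauss_curvature \<A> g0 c p - codifferential g0 \<theta>0 c p
      - (real m - 1) * norm_sq m (g0 c p) (det_scale a g0 P c p)" for c p
  have form0: "sym_ricci (associated_connection \<A> m C D) c p + (1 - real m) *\<^sub>R quadratic_form m C P c p
      = F c p *\<^sub>R g0 c p" if p: "in_chart \<A> c p" for c p
    using curvature_form[OF g0 \<theta>0 A0(1) m p, folded a_def, unfolded A0(2)]
    unfolding F_def C D0 .
  have F_neg: "F c p < 0" if p: "in_chart \<A> c p" for c p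
  proof -
    have "axis 1 1 \<noteq> (0 :: real^2)" by simp
    then have "axis 1 1 \<bullet> ((F c p *\<^sub>R g0 c p) *v axis 1 1) < 0"
      using neg p unfolding negative_definite_def form0[OF p, symmetric] by blast
    then show ?thesis
      unfolding axis_form using metric_11_pos[OF g0 p] by (simp add: mult_less_0_iff)
  qed
  have F_smooth: "smooth_near c p (F c)" if p: "in_chart \<A> c p" for c p
    unfolding F_def
    by (intro smooth_near_diff[OF curvature_smooth] smooth_near_mult smooth_near_const
        norm_sq_smooth[OF g0 A0(1)[unfolded is_differential_def]] g0 \<theta>0 p)
  have F_invariant: "F c p = F c' p" if ov: "in_overlap \<A> c c' p" for c c' p
    unfolding F_def curvature_scalar_invariant[OF g0 \<theta>0 ov] norm_sq_invariant[OF g0 A0(1) ov] ..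
  obtain u where u: "smooth_fun \<A> u" and uF: "\<And>c p. in_chart \<A> c p \<Longrightarrow> u p = ln (- F c p) * (1/2)"
  proof -
    have "smooth_near c p (\<lambda>q. ln (- F c q) * (1/2))" if p: "in_chart \<A> c p" for c p
      by (intro smooth_near_mult smooth_near_const smooth_near_ln smooth_near_minus F_smooth p)
         (use F_neg[OF p] in simp)
    moreover have "ln (- F c p) * (1/2) = ln (- F c' p) * (1/2)" if "in_overlap \<A> c c' p" for c c' p
      using F_invariant[OF that] by simp
    ultimately show thesis using glue[of "\<lambda>c p. ln (- F c p) * (1/2)"] that by blast
  qed
  define g where "g c p = exp (2 * u p) *\<^sub>R g0 c p" for c p
  define \<theta> where "\<theta> c p = \<theta>0 c p + exact_form u c p" for c p
  define A where "A = det_scale a g P"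
  have g: "is_metric \<A> g" unfolding g_def by (rule is_metric_conformal[OF g0 u])
  have gC: "g \<in> conformal_class \<A> g0"
    unfolding conformal_class_def using g u by (auto simp: g_def)
  have gF: "g c p = - F c p *\<^sub>R g0 c p" if p: "in_chart \<A> c p" for c p
    unfolding g_def uF[OF p] using F_neg[OF p] by simp
  have \<theta>: "is_one_form \<A> \<theta>"
    unfolding \<theta>_def by (rule is_one_form_add[OF \<theta>0 is_one_form_exact[OF u]])
  have weyl: "weyl_connection \<A> g \<theta> = weyl_connection \<A> g0 \<theta>0"
    unfolding \<theta>_def by (rule weyl_conformal[OF g0 g u]) (simp add: g_def)
  have rot_g: "rot g = rot g0" by (rule rot_conformal[OF g0 gC])
  have class_g: "conformal_class \<A> g = C" unfolding C by (rule conformal_class_eq[OF g0 gC])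
  have D_g: "D = connection01 \<A> m (rot g) (weyl_connection \<A> g \<theta>)" unfolding weyl rot_g by (rule D0)
  have A: "is_differential \<A> m (rot g) A" and PA: "det_scale (- a) g A = P"
    unfolding A_def by (rule diff[OF gC])+
  have "gauss_curvature \<A> g c p = -1 + codifferential g \<theta> c p + (real m - 1) * norm_sq m (g c p) (A c p)"
    if p: "in_chart \<A> c p" for c p
  proof -
    define x where "x = gauss_curvature \<A> g c p - codifferential g \<theta> c p - (real m - 1) * norm_sq m (g c p) (A c p)"
    have "x *\<^sub>R g c p = F c p *\<^sub>R g0 c p"
      using curvature_form[OF g \<theta> A m p, folded a_def x_def D_g, unfolded PA class_g] form0[OF p]
      by (rule trans[OF sym])
    also have "\<dots> = - g c p" unfolding gF[OF p] by simp
    finally have "x *\<^sub>R g c p = - g c p" .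
    then have "(x *\<^sub>R g c p) $ 1 $ 1 = (- g c p) $ 1 $ 1" by simp
    then have "(x + 1) * g c p $ 1 $ 1 = 0" by (simp add: algebra_simps)
    then have "x = -1" using metric_11_pos[OF g p] by simp
    then show ?thesis by (simp add: x_def)
  qed
  moreover have "is_holomorphic_section \<A> m (rot g) (connection01 \<A> m (rot g) (weyl_connection \<A> g \<theta>))
      (det_scale (- ((real m - 1) / 4)) g A)"
    using P unfolding rot_g[symmetric] D_g PA[unfolded a_def] .
  then have "\<forall>c p u v. in_chart \<A> c p \<longrightarrow> dbar_differential m (rot g) A c p u v
          = (of_nat m - 1) / 2 * (of_real (\<theta> c p \<bullet> u) - \<i> * of_real (hodge g \<theta> c p \<bullet> u)) * A c p v"
    using holomorphic_section_iff[OF g \<theta> A] by blast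
  ultimately have "(g, A, \<theta>) \<in> vortex_triples \<A> m"
    unfolding vortex_triples_def using g A \<theta> by blast
  moreover have "correspondence \<A> m (g, A, \<theta>) = (C, D, P)"
    unfolding correspondence_def using class_g D_g PA[unfolded a_def] by simp
  ultimately show ?thesis by blast
qed

lemma correspondence_bij:
  assumes m: "m \<ge> 2"
  shows "bij_betw (correspondence \<A> m) (vortex_triples \<A> m) (holomorphic_triples \<A> m)"
  unfolding bij_betw_def
proof
  show "inj_on (correspondence \<A> m) (vortex_triples \<A> m)"
  proof (rule inj_onI)
    fix s t assume "s \<in> vortex_triples \<A> m" "t \<in> vortex_triples \<A> m" "correspondence \<A> m s = correspondence \<A> m t"
    then show "s = t" using correspondence_inj[OF _ _ m] by (cases s, cases t) blast
  qed
  show "correspondence \<A> m ` vortex_triples \<A> m = holomorphic_triples \<A> m"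
  proof
    show "correspondence \<A> m ` vortex_triples \<A> m \<subseteq> holomorphic_triples \<A> m"
    proof (rule image_subsetI)
      fix t assume "t \<in> vortex_triples \<A> m"
      then show "correspondence \<A> m t \<in> holomorphic_triples \<A> m"
        using correspondence_in[OF _ m] by (cases t) blast
    qed
    show "holomorphic_triples \<A> m \<subseteq> correspondence \<A> m ` vortex_triples \<A> m"
    proof
      fix t assume "t \<in> holomorphic_triples \<A> m"
      then have "\<exists>s\<in>vortex_triples \<A> m. correspondence \<A> m s = t"
        using correspondence_surj[OF _ m] by (cases t) blast
      then show "t \<in> correspondence \<A> m ` vortex_triples \<A> m" by blast
    qed
  qed
qed

end

theorem proposition4p9:
  fixes X :: "'a topology" and \<A> :: "'a chart set" and m :: nat
  assumes "m \<ge> 2"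
    and "oriented_surface X \<A>" and "compact_space X" and "euler_characteristic X < 0"
  shows "bij_betw (correspondence \<A> m) (vortex_triples \<A> m) (holomorphic_triples \<A> m)"
proof -
  interpret surface X \<A> using assms(2) by unfold_locales
  show ?thesis by (rule correspondence_bij[OF assms(1)])
qed

end
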